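(* Let $\Omega\subset\mathbb R^n$ be a bounded Lipschitz domain, $0<\mu_0\le\mu_1<\infty$, and let $\mathcal A\subseteq\mathcal M[\mu_0,\mu_1]$ be nonempty, convex and closed in $L^1(\Omega;\mathbb S^n)$. Then: (i) There exists $\bar a(\cdot)\in\mathcal A$ with $\lambda_{\bar a(\cdot)}=\sup_{a(\cdot)\in\mathcal A}\lambda_{a(\cdot)}$. Further, $\bar a(\cdot)\in\mathcal A$ satisfies $\lambda_{\bar a(\cdot)}=\sup_{a(\cdot)\in\mathcal A}\lambda_{a(\cdot)}$ if and only if $$\int_\Omega\big\langle[a(x)-\bar a(x)]\nabla y_{\bar a(\cdot)}(x),\nabla y_{\bar a(\cdot)}(x)\big\rangle\,dx\le0\qquad\text{for all }a(\cdot)\in\mathcal A.$$ (ii) If $\underline a(\cdot)\in\mathcal A$ satisfies $\lambda_{\underline a(\cdot)}=\inf_{a(\cdot)\in\mathcal A}\lambda_{a(\cdot)}$, then $$\int_\Omega\big\langle[a(x)-\underline a(x)]\nabla y_{\underline a(\cdot)}(x),\nabla y_{\underline a(\cdot)}(x)\big\rangle\,dx\ge0\qquad\text{for all }a(\cdot)\in\mathcal A.$$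
   Context: $\mathbb S^n$ is the set of real symmetric $n\times n$ matrices with the usual order ($A\le B$ iff $B-A$ is positive semidefinite). $M[\mu_0,\mu_1]=\{A\in\mathbb S^n: \mu_0 I\le A\le\mu_1 I\}$, and $\mathcal M[\mu_0,\mu_1]$ is the set of all measurable $a:\Omega\to M[\mu_0,\mu_1]$. For $a(\cdot)\in\mathcal M[\mu_0,\mu_1]$, the principal eigenvalue is $$\lambda_{a(\cdot)}=\inf_{y\in W^{1,2}_0(\Omega)\setminus\{0\}}\frac{\int_\Omega\langle a(x)\nabla y(x),\nabla y(x)\rangle\,dx}{\|y\|_{L^2(\Omega)}^2}.$$ It is a simple eigenvalue, and the normalized principal eigenfunction $y_{a(\cdot)}\in W_0^{1,2}(\Omega)$ is the unique weak solution of $-\nabla\cdot(a\nabla y)=\lambda_{a(\cdot)}y$ in $\Omega$, $y|_{\partial\Omega}=0$, with $y>0$ in $\Omega$ and $\|y\|_{L^2(\Omega)}=1$. *)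

theory Defs
  imports "HOL-Analysis.Analysis"
begin

text \<open>
  Functions on a set \<open>\<Omega>\<close> are represented by total functions of which only the
  restriction to \<open>\<Omega>\<close> matters; measurability and integrals refer to Lebesgue measure
  on \<open>\<Omega>\<close>. Elements of Lebesgue and Sobolev spaces are represented by arbitrary
  representatives of their classes modulo equality almost everywhere in \<open>\<Omega>\<close>.
\<close>

text \<open>
  The local condition is the usual one without coordinates: after a rigid motion that turns
  the unit vector \<open>e\<close> into the last coordinate direction, \<open>\<Omega>\<close> is near \<open>p\<close> the region
  strictly above the graph of a Lipschitz function \<open>h\<close>, which is defined on the hyperplane
  orthogonal to \<open>e\<close>; the argument of \<open>h\<close> below is the projection of \<open>x\<close> to it.
\<close>

definition lipschitz_boundary :: "(real^'n) set \<Rightarrow> bool" where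
  "lipschitz_boundary \<Omega> \<longleftrightarrow>
     (\<forall>p\<in>frontier \<Omega>. \<exists>r>0. \<exists>e. norm e = 1 \<and>
        (\<exists>(h :: real^'n \<Rightarrow> real) L. L-lipschitz_on {z. z \<bullet> e = 0} h \<and>
           \<Omega> \<inter> ball p r = {x \<in> ball p r. h (x - (x \<bullet> e) *\<^sub>R e) < x \<bullet> e}))"

definition bounded_lipschitz_domain :: "(real^'n) set \<Rightarrow> bool" where
  "bounded_lipschitz_domain \<Omega> \<longleftrightarrow>
     open \<Omega> \<and> connected \<Omega> \<and> \<Omega> \<noteq> {} \<and> bounded \<Omega> \<and> lipschitz_boundary \<Omega>"

definition sym_matrices :: "(real^'n^'n) set" where
  "sym_matrices = {A. transpose A = A}"

definition pos_semidef :: "real^'n^'n \<Rightarrow> bool" where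
  "pos_semidef A \<longleftrightarrow> A \<in> sym_matrices \<and> (\<forall>v. 0 \<le> (A *v v) \<bullet> v)"

definition loewner_le :: "real^'n^'n \<Rightarrow> real^'n^'n \<Rightarrow> bool" where
  "loewner_le A B \<longleftrightarrow> pos_semidef (B - A)"

text \<open>Here \<open>mat \<mu>\<close> is \<open>\<mu>\<close> times the identity matrix.\<close>

definition matrix_interval :: "real \<Rightarrow> real \<Rightarrow> (real^'n^'n) set" where
  "matrix_interval \<mu>0 \<mu>1 =
     {A \<in> sym_matrices. loewner_le (mat \<mu>0) A \<and> loewner_le A (mat \<mu>1)}"

definition coefficients :: "(real^'n) set \<Rightarrow> real \<Rightarrow> real \<Rightarrow> (real^'n \<Rightarrow> real^'n^'n) set" where
  "coefficients \<Omega> \<mu>0 \<mu>1 =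
     {a \<in> borel_measurable (lebesgue_on \<Omega>). \<forall>x\<in>\<Omega>. a x \<in> matrix_interval \<mu>0 \<mu>1}"

text \<open>
  A set of coefficients stands for the set of classes of its members in \<open>L\<^sup>1(\<Omega>; S\<^sup>n)\<close>, and
  convexity and closedness are those of this set of classes. The new element (the convex
  combination or the limit) is therefore only required to have a representative in the set.
\<close>

definition L1_sym :: "(real^'n) set \<Rightarrow> (real^'n \<Rightarrow> real^'n^'n) set" where
  "L1_sym \<Omega> = {f. integrable (lebesgue_on \<Omega>) f \<and> (\<forall>x\<in>\<Omega>. f x \<in> sym_matrices)}"

definition L1_convex :: "(real^'n) set \<Rightarrow> (real^'n \<Rightarrow> real^'n^'n) set \<Rightarrow> bool" where
  "L1_convex \<Omega> \<A> \<longleftrightarrow>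
     (\<forall>a\<in>\<A>. \<forall>b\<in>\<A>. \<forall>t\<in>{0..1}. \<exists>c\<in>\<A>.
        AE x in lebesgue_on \<Omega>. c x = (1 - t) *\<^sub>R a x + t *\<^sub>R b x)"

definition L1_closed :: "(real^'n) set \<Rightarrow> (real^'n \<Rightarrow> real^'n^'n) set \<Rightarrow> bool" where
  "L1_closed \<Omega> \<A> \<longleftrightarrow>
     (\<forall>f\<in>L1_sym \<Omega>. \<forall>s :: nat \<Rightarrow> real^'n \<Rightarrow> real^'n^'n.
        (\<forall>k. s k \<in> \<A>) \<longrightarrow>
        (\<lambda>k. LINT x|lebesgue_on \<Omega>. norm (s k x - f x)) \<longlonglongrightarrow> 0 \<longrightarrow>
        (\<exists>c\<in>\<A>. AE x in lebesgue_on \<Omega>. c x = f x))"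

primrec Ck :: "nat \<Rightarrow> (real^'n \<Rightarrow> real) \<Rightarrow> bool" where
  "Ck 0 f \<longleftrightarrow> continuous_on UNIV f"
| "Ck (Suc k) f \<longleftrightarrow>
     f differentiable_on UNIV \<and> (\<forall>v. Ck k (\<lambda>x. frechet_derivative f (at x) v))"

definition test_functions :: "(real^'n) set \<Rightarrow> (real^'n \<Rightarrow> real) set" where
  "test_functions \<Omega> =
     {\<phi>. (\<forall>k. Ck k \<phi>) \<and> compact (closure {x. \<phi> x \<noteq> 0}) \<and> closure {x. \<phi> x \<noteq> 0} \<subseteq> \<Omega>}"

definition grad :: "(real^'n \<Rightarrow> real) \<Rightarrow> real^'n \<Rightarrow> real^'n" where
  "grad \<phi> x = (\<chi> i. frechet_derivative \<phi> (at x) (axis i 1))"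

definition L2 :: "(real^'n) set \<Rightarrow> (real^'n \<Rightarrow> 'b::euclidean_space) set" where
  "L2 \<Omega> = {f \<in> borel_measurable (lebesgue_on \<Omega>).
             integrable (lebesgue_on \<Omega>) (\<lambda>x. (norm (f x))\<^sup>2)}"

definition L2_norm :: "(real^'n) set \<Rightarrow> (real^'n \<Rightarrow> 'b::euclidean_space) \<Rightarrow> real" where
  "L2_norm \<Omega> f = sqrt (LINT x|lebesgue_on \<Omega>. (norm (f x))\<^sup>2)"

text \<open>Integration by parts, with all partial derivatives collected in one vector equation.\<close>

definition is_weak_gradient ::
  "(real^'n) set \<Rightarrow> (real^'n \<Rightarrow> real) \<Rightarrow> (real^'n \<Rightarrow> real^'n) \<Rightarrow> bool" where
  "is_weak_gradient \<Omega> y g \<longleftrightarrow>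
     (\<forall>\<phi>\<in>test_functions \<Omega>.
        (LINT x|lebesgue_on \<Omega>. y x *\<^sub>R grad \<phi> x) = - (LINT x|lebesgue_on \<Omega>. \<phi> x *\<^sub>R g x))"

definition W12 :: "(real^'n) set \<Rightarrow> (real^'n \<Rightarrow> real) set" where
  "W12 \<Omega> = {y \<in> L2 \<Omega>. \<exists>g\<in>L2 \<Omega>. is_weak_gradient \<Omega> y g}"

text \<open>The choice is immaterial: on \<open>W12 \<Omega>\<close> weak gradients are unique almost everywhere.\<close>

definition weak_grad :: "(real^'n) set \<Rightarrow> (real^'n \<Rightarrow> real) \<Rightarrow> real^'n \<Rightarrow> real^'n" where
  "weak_grad \<Omega> y = (SOME g. g \<in> L2 \<Omega> \<and> is_weak_gradient \<Omega> y g)"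

definition W12_norm :: "(real^'n) set \<Rightarrow> (real^'n \<Rightarrow> real) \<Rightarrow> real" where
  "W12_norm \<Omega> y = sqrt ((L2_norm \<Omega> y)\<^sup>2 + (L2_norm \<Omega> (weak_grad \<Omega> y))\<^sup>2)"

definition W12_0 :: "(real^'n) set \<Rightarrow> (real^'n \<Rightarrow> real) set" where
  "W12_0 \<Omega> =
     {y \<in> W12 \<Omega>. \<exists>\<phi> :: nat \<Rightarrow> real^'n \<Rightarrow> real.
        (\<forall>k. \<phi> k \<in> test_functions \<Omega>) \<and> (\<lambda>k. W12_norm \<Omega> (\<lambda>x. \<phi> k x - y x)) \<longlonglongrightarrow> 0}"

definition principal_eigenvalue ::
  "(real^'n) set \<Rightarrow> (real^'n \<Rightarrow> real^'n^'n) \<Rightarrow> real" where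
  "principal_eigenvalue \<Omega> a =
     (INF y\<in>{y \<in> W12_0 \<Omega>. \<not> (AE x in lebesgue_on \<Omega>. y x = 0)}.
        (LINT x|lebesgue_on \<Omega>. (a x *v weak_grad \<Omega> y x) \<bullet> weak_grad \<Omega> y x)
        / (L2_norm \<Omega> y)\<^sup>2)"

definition is_principal_eigenfunction ::
  "(real^'n) set \<Rightarrow> (real^'n \<Rightarrow> real^'n^'n) \<Rightarrow> (real^'n \<Rightarrow> real) \<Rightarrow> bool" where
  "is_principal_eigenfunction \<Omega> a y \<longleftrightarrow>
     y \<in> W12_0 \<Omega> \<and>
     (\<forall>z\<in>W12_0 \<Omega>.
        (LINT x|lebesgue_on \<Omega>. (a x *v weak_grad \<Omega> y x) \<bullet> weak_grad \<Omega> z x)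
        = principal_eigenvalue \<Omega> a * (LINT x|lebesgue_on \<Omega>. y x * z x)) \<and>
     (AE x in lebesgue_on \<Omega>. 0 < y x) \<and>
     L2_norm \<Omega> y = 1"

text \<open>
  The normalized principal eigenfunction is unique as an element of \<open>W12_0 \<Omega>\<close>, hence only
  up to equality almost everywhere as a function; the choice picks a representative.
\<close>

definition principal_eigenfunction ::
  "(real^'n) set \<Rightarrow> (real^'n \<Rightarrow> real^'n^'n) \<Rightarrow> real^'n \<Rightarrow> real" where
  "principal_eigenfunction \<Omega> a = (SOME y. is_principal_eigenfunction \<Omega> a y)"

end

theory Submission
  imports Defs "HOL-Library.Diagonal_Subsequence"
begin

text \<open>
  For a coefficient \<open>a\<close> write \<open>E a g h\<close> for the integral of \<open>a g \<bullet> h\<close>. The principal eigenvalue \<open>lam a\<close> is the minimum of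
  \<open>E a g g\<close> over the functions \<open>y\<close> in \<open>W\<^sub>0\<^sup>1\<^sup>,\<^sup>2\<close> with gradient \<open>g\<close> and \<open>L\<^sup>2\<close> norm \<open>1\<close>. Being an infimum of functions that are affine
  in \<open>a\<close>, it is concave and upper semicontinuous in \<open>a\<close>.

  Let \<open>y\<close> be the normalized principal eigenfunction of \<open>b\<close> and \<open>g\<close> its gradient. Then \<open>lam b = E b g g\<close> and
  \<open>lam a \<le> E a g g\<close>, so the integral of \<open>(a - b) g \<bullet> g\<close>, which is \<open>E a g g - E b g g\<close>, is at least \<open>lam a - lam b\<close>. This
  gives the necessary condition for a minimum and the sufficient condition for a maximum. Conversely, let \<open>b\<close> be maximal and
  let \<open>y\<^sub>t\<close> be a minimizer for \<open>(1 - t) b + t a\<close>, with gradient \<open>g\<^sub>t\<close>. The eigenvalue of this coefficient is at most \<open>lam b\<close>,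
  which is at most \<open>E b g\<^sub>t g\<^sub>t\<close>; hence \<open>E a g\<^sub>t g\<^sub>t \<le> E b g\<^sub>t g\<^sub>t\<close>, and \<open>E b g\<^sub>t g\<^sub>t\<close> tends to \<open>lam b\<close> as \<open>t \<rightarrow> 0\<close>. By
  compactness and simplicity \<open>y\<^sub>t\<close> converges along a sequence to a multiple of \<open>y\<close>, and the inequality passes to
  the limit (\<open>maximizer_variation\<close>). A maximal coefficient exists because a sequence of coefficients with almost maximal eigenvalue and
  almost minimal \<open>L\<^sup>2\<close> norm converges strongly, by concavity and the parallelogram law (\<open>maximizer_exists\<close>).

  Existence, positivity and simplicity of the principal eigenfunction are built from test functions. A function in \<open>W\<^sub>0\<^sup>1\<^sup>,\<^sup>2\<close> is
  handled together with its gradient, as the limit of test functions and their gradients (\<open>H0\<close>). The Poincare inequality on convex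
  sets (\<open>poincare_C1\<close>), summed over a fine division into boxes, yields the Rellich theorem (\<open>rellich\<close>), and a minimizing sequence that
  converges in \<open>L\<^sup>2\<close> converges in energy by the parallelogram law (\<open>minimizing_sequence_compact\<close>).

  If \<open>u\<close> is an eigenfunction, so is \<open>\<bar>u\<bar>\<close>. A nonnegative eigenfunction \<open>w\<close> is tested with a function comparable to
  \<open>\<psi>\<^sup>2 / (w + e)\<close>, where \<open>\<psi>\<close> is a cutoff; this bounds the gradient of \<open>arsinh (w / e)\<close> in \<open>L\<^sup>2\<close> of a ball uniformly in \<open>e\<close>. If \<open>w\<close> vanishes on
  a set of positive measure in the ball, so does \<open>arsinh (w / e)\<close>, and the Poincare inequality bounds it uniformly in \<open>e\<close>; as
  \<open>e \<rightarrow> 0\<close> this forces \<open>w = 0\<close> on the ball (\<open>local_dichotomy\<close>). By connectedness \<open>w\<close> is positive almost everywhere or zero. Hence every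
  eigenfunction has a sign, and a combination of two eigenfunctions with integral \<open>0\<close> vanishes, which is simplicity.
\<close>


section \<open>Square-integrable functions\<close>


text \<open>The class \<open>L2\<close> for an arbitrary measure; it is used on domains, on balls and boxes, and on the real line.\<close>

definition sqint :: "'a measure \<Rightarrow> ('a \<Rightarrow> 'b::euclidean_space) \<Rightarrow> bool" where
  "sqint M f \<longleftrightarrow> f \<in> borel_measurable M \<and> integrable M (\<lambda>x. (norm (f x))\<^sup>2)"

lemma nonneg_quadratic_discriminant:
  fixes A B C :: real
  assumes "\<And>t. 0 \<le> A + 2 * t * B + t\<^sup>2 * C" "0 \<le> C"
  shows "B\<^sup>2 \<le> A * C"
proof (cases "C = 0")
  case True
  have "B = 0"
  proof (rule ccontr)
    assume "B \<noteq> 0"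
    with assms(1)[of "- (A + 1) / (2 * B)"] True show False by (simp add: field_simps)
  qed
  with True show ?thesis by simp
next
  case False
  with assms(1)[of "- B / C"] assms(2) show ?thesis
    by (simp add: field_simps power2_eq_square)
qed

lemma tendsto_zero_of_square:
  fixes f :: "nat \<Rightarrow> real"
  assumes "(\<lambda>k. (f k)\<^sup>2) \<longlonglongrightarrow> 0" shows "f \<longlonglongrightarrow> 0"
  using tendsto_real_sqrt[OF assms] by (simp add: tendsto_rabs_zero_iff)

lemma norm_add_sq_le: "(norm (a + b :: 'b::real_inner))\<^sup>2 \<le> 2 * (norm a)\<^sup>2 + 2 * (norm b)\<^sup>2"
proof -
  have "0 \<le> (norm (a - b))\<^sup>2" by simp
  then show ?thesis by (simp add: power2_norm_eq_inner inner_simps inner_commute)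
qed

lemma sqint_measurable [measurable_dest]: "sqint M f \<Longrightarrow> f \<in> borel_measurable M"
  and sqint_integrable: "sqint M f \<Longrightarrow> integrable M (\<lambda>x. (norm (f x))\<^sup>2)"
  by (auto simp: sqint_def)

lemma sqint_dominated:
  assumes "sqint M h" and [measurable]: "f \<in> borel_measurable M"
    and "AE x in M. norm (f x) \<le> norm (h x)"
  shows "sqint M f"
  unfolding sqint_def
proof (intro conjI)
  show "integrable M (\<lambda>x. (norm (f x))\<^sup>2)"
    by (rule Bochner_Integration.integrable_bound[OF sqint_integrable[OF assms(1)]])
      (use assms(3) in \<open>auto elim!: eventually_mono intro!: power_mono\<close>)
qed fact

lemma sqint_scale: "sqint M f \<Longrightarrow> sqint M (\<lambda>x. c *\<^sub>R f x)"
  by (auto simp: sqint_def power_mult_distrib)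

lemma sqint_add:
  assumes "sqint M f" "sqint M g" shows "sqint M (\<lambda>x. f x + g x)"
  unfolding sqint_def
proof (intro conjI)
  note [measurable] = assms[THEN sqint_measurable]
  show "(\<lambda>x. f x + g x) \<in> borel_measurable M" by measurable
  have "integrable M (\<lambda>x. 2 * (norm (f x))\<^sup>2 + 2 * (norm (g x))\<^sup>2)"
    using assms by (simp add: sqint_integrable)
  then show "integrable M (\<lambda>x. (norm (f x + g x))\<^sup>2)"
    by (rule Bochner_Integration.integrable_bound) (auto simp: norm_add_sq_le)
qed

lemma sqint_diff: "sqint M f \<Longrightarrow> sqint M g \<Longrightarrow> sqint M (\<lambda>x. f x - g x)"
  using sqint_add[of M f "\<lambda>x. (-1) *\<^sub>R g x"] sqint_scale[of M g "-1"] by simp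

lemma sqint_zero: "sqint M (\<lambda>x. 0)"
  by (simp add: sqint_def)

lemma sqint_norm: "sqint M f \<Longrightarrow> sqint M (\<lambda>x. norm (f x))"
  by (auto simp: sqint_def)

lemma sqint_bounded_mult:
  assumes "sqint M f" and [measurable]: "(h :: 'a \<Rightarrow> real) \<in> borel_measurable M"
    and "AE x in M. \<bar>h x\<bar> \<le> C"
  shows "sqint M (\<lambda>x. h x *\<^sub>R f x)"
proof (rule sqint_dominated[OF sqint_scale[OF assms(1), of C]])
  note [measurable] = assms(1)[THEN sqint_measurable]
  show "(\<lambda>x. h x *\<^sub>R f x) \<in> borel_measurable M" by measurable
  show "AE x in M. norm (h x *\<^sub>R f x) \<le> norm (C *\<^sub>R f x)"
    using assms(3) by (auto elim!: eventually_mono intro!: mult_right_mono)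
qed

lemma (in finite_measure) sqint_bounded:
  assumes [measurable]: "f \<in> borel_measurable M" and "AE x in M. norm (f x) \<le> C"
  shows "sqint M f"
proof (rule sqint_dominated[of M "\<lambda>_. C"])
  show "sqint M (\<lambda>_. C)" by (simp add: sqint_def)
  show "AE x in M. norm (f x) \<le> norm C" using assms(2) by (auto elim!: eventually_mono)
qed simp

lemma sqint_inner_integrable:
  assumes "sqint M f" "sqint M g" shows "integrable M (\<lambda>x. f x \<bullet> g x)"
proof -
  note [measurable] = assms[THEN sqint_measurable]
  have "integrable M (\<lambda>x. (norm (f x))\<^sup>2 + (norm (g x))\<^sup>2)"
    using assms by (simp add: sqint_integrable)
  then show ?thesis
  proof (rule Bochner_Integration.integrable_bound, measurable, intro AE_I2)
    fix x
    have "\<bar>f x \<bullet> g x\<bar> \<le> norm (f x) * norm (g x)" by (rule Cauchy_Schwarz_ineq2)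
    also have "\<dots> \<le> (norm (f x))\<^sup>2 + (norm (g x))\<^sup>2"
      using sum_squares_bound[of "norm (f x)" "norm (g x)"]
        mult_nonneg_nonneg[OF norm_ge_zero norm_ge_zero, of "f x" "g x"] by linarith
    finally show "norm (f x \<bullet> g x) \<le> norm ((norm (f x))\<^sup>2 + (norm (g x))\<^sup>2)" by simp
  qed
qed

lemma sqint_mult_integrable:
  fixes f g :: "'a \<Rightarrow> real"
  shows "sqint M f \<Longrightarrow> sqint M g \<Longrightarrow> integrable M (\<lambda>x. f x * g x)"
  using sqint_inner_integrable[of M f g] by simp

lemma integral_norm_sq_add:
  assumes "sqint M f" "sqint M g"
  shows "(LINT x|M. (norm (f x + t *\<^sub>R g x))\<^sup>2) =
    (LINT x|M. (norm (f x))\<^sup>2) + 2 * t * (LINT x|M. f x \<bullet> g x) + t\<^sup>2 * (LINT x|M. (norm (g x))\<^sup>2)"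
proof -
  have "(norm (f x + t *\<^sub>R g x))\<^sup>2 = (norm (f x))\<^sup>2 + 2 * t * (f x \<bullet> g x) + t\<^sup>2 * (norm (g x))\<^sup>2" for x
    unfolding power2_norm_eq_inner by (simp add: inner_simps inner_commute power2_eq_square)
  then show ?thesis
    using assms by (simp add: sqint_integrable sqint_inner_integrable)
qed

lemma integral_norm_sq_nonneg: "0 \<le> (LINT x|M. (norm (f x))\<^sup>2)"
  by simp

text \<open>The square norm of \<open>f + t g\<close> is a nonnegative quadratic polynomial in \<open>t\<close>.\<close>

lemma L2_Cauchy_Schwarz:
  assumes "sqint M f" "sqint M g"
  shows "(LINT x|M. f x \<bullet> g x)\<^sup>2 \<le> (LINT x|M. (norm (f x))\<^sup>2) * (LINT x|M. (norm (g x))\<^sup>2)"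
proof (rule nonneg_quadratic_discriminant)
  fix t
  show "0 \<le> (LINT x|M. (norm (f x))\<^sup>2) + 2 * t * (LINT x|M. f x \<bullet> g x) + t\<^sup>2 * (LINT x|M. (norm (g x))\<^sup>2)"
    using integral_norm_sq_add[OF assms, of t] integral_norm_sq_nonneg[of M] by metis
qed simp

lemma integral_norm_sq_le:
  assumes "sqint M f" "sqint M g"
  shows "(LINT x|M. (norm (f x + g x))\<^sup>2) \<le> 2 * (LINT x|M. (norm (f x))\<^sup>2) + 2 * (LINT x|M. (norm (g x))\<^sup>2)"
proof -
  have "(LINT x|M. (norm (f x + g x))\<^sup>2) \<le> (LINT x|M. 2 * (norm (f x))\<^sup>2 + 2 * (norm (g x))\<^sup>2)"
    using assms by (intro integral_mono) (auto simp: sqint_integrable sqint_add norm_add_sq_le)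
  then show ?thesis using assms by (simp add: sqint_integrable)
qed

text \<open>Convergence in \<open>L\<^sup>2\<close>. The members and the limit are required to be square integrable because the integral of a
  function that is not integrable is \<open>0\<close>, so that the last condition alone would not express convergence.\<close>

definition sqlim :: "'a measure \<Rightarrow> (nat \<Rightarrow> 'a \<Rightarrow> 'b::euclidean_space) \<Rightarrow> ('a \<Rightarrow> 'b) \<Rightarrow> bool" where
  "sqlim M f g \<longleftrightarrow> (\<forall>k. sqint M (f k)) \<and> sqint M g \<and>
     (\<lambda>k. LINT x|M. (norm (f k x - g x))\<^sup>2) \<longlonglongrightarrow> 0"

lemma sqlimD:
  assumes "sqlim M f g"
  shows "\<And>k. sqint M (f k)" "sqint M g" "(\<lambda>k. LINT x|M. (norm (f k x - g x))\<^sup>2) \<longlonglongrightarrow> 0"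
  using assms by (auto simp: sqlim_def)

lemma sqlim_const: "sqint M f \<Longrightarrow> sqlim M (\<lambda>k. f) f"
  by (simp add: sqlim_def)

lemma sqlim_subseq: "sqlim M f g \<Longrightarrow> strict_mono r \<Longrightarrow> sqlim M (\<lambda>k. f (r k)) g"
  by (auto simp: sqlim_def dest: LIMSEQ_subseq_LIMSEQ[unfolded o_def])

lemma sqlimI_le:
  assumes "\<And>k. sqint M (f k)" "sqint M g"
    and "\<And>k. (LINT x|M. (norm (f k x - g x))\<^sup>2) \<le> e k" "e \<longlonglongrightarrow> 0"
  shows "sqlim M f g"
  unfolding sqlim_def
  using assms by (auto intro!: tendsto_sandwich[OF _ _ tendsto_const assms(4)] always_eventually)

lemma sqlim_add:
  assumes "sqlim M f g" "sqlim M f' g'"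
  shows "sqlim M (\<lambda>k x. f k x + f' k x) (\<lambda>x. g x + g' x)"
proof (rule sqlimI_le)
  note 1 = sqlimD[OF assms(1)] and 2 = sqlimD[OF assms(2)]
  show "(\<lambda>k. 2 * (LINT x|M. (norm (f k x - g x))\<^sup>2) + 2 * (LINT x|M. (norm (f' k x - g' x))\<^sup>2)) \<longlonglongrightarrow> 0"
    using tendsto_add[OF tendsto_mult_left[OF 1(3), of 2] tendsto_mult_left[OF 2(3), of 2]] by simp
  fix k
  have "f k x + f' k x - (g x + g' x) = (f k x - g x) + (f' k x - g' x)" for x by (simp add: algebra_simps)
  then show "(LINT x|M. (norm (f k x + f' k x - (g x + g' x)))\<^sup>2) \<le>
      2 * (LINT x|M. (norm (f k x - g x))\<^sup>2) + 2 * (LINT x|M. (norm (f' k x - g' x))\<^sup>2)"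
    using integral_norm_sq_le[OF sqint_diff[OF 1(1) 1(2)] sqint_diff[OF 2(1) 2(2)], of k k] by presburger
qed (use assms in \<open>auto intro!: sqint_add dest: sqlimD\<close>)

text \<open>Lipschitz maps and multiplication by a bounded function preserve convergence in \<open>L\<^sup>2\<close>.\<close>

lemma sqlim_dominated_diff:
  assumes "sqlim M f g" "\<And>k. u k \<in> borel_measurable M" "sqint M v"
    and "\<And>k. AE x in M. norm (u k x - v x) \<le> C * norm (f k x - g x)"
  shows "sqlim M u v"
proof (rule sqlimI_le)
  note 1 = sqlimD[OF assms(1)]
  note [measurable] = assms(2) sqint_measurable[OF assms(3)]
  show "(\<lambda>k. C\<^sup>2 * (LINT x|M. (norm (f k x - g x))\<^sup>2)) \<longlonglongrightarrow> 0"
    using tendsto_mult_left[OF 1(3), of "C\<^sup>2"] by simp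
  fix k
  have d: "sqint M (\<lambda>x. u k x - v x)"
  proof (rule sqint_dominated[OF sqint_scale[OF sqint_diff[OF 1(1)[of k] 1(2)], of C]])
    show "AE x in M. norm (u k x - v x) \<le> norm (C *\<^sub>R (f k x - g x))"
      using assms(4)[of k] by eventually_elim (simp, smt (verit) abs_ge_self mult_right_mono norm_ge_zero)
  qed measurable
  from sqint_add[OF d assms(3)] show "sqint M (u k)" by simp
  have "(LINT x|M. (norm (u k x - v x))\<^sup>2) \<le> (LINT x|M. C\<^sup>2 * (norm (f k x - g x))\<^sup>2)"
  proof (rule integral_mono_AE)
    show "AE x in M. (norm (u k x - v x))\<^sup>2 \<le> C\<^sup>2 * (norm (f k x - g x))\<^sup>2"
      using assms(4)[of k] by eventually_elim (subst power_mult_distrib[symmetric], rule power_mono, auto)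
  qed (use d 1 in \<open>auto intro!: sqint_integrable sqint_diff\<close>)
  then show "(LINT x|M. (norm (u k x - v x))\<^sup>2) \<le> C\<^sup>2 * (LINT x|M. (norm (f k x - g x))\<^sup>2)" by simp
qed fact

lemma sqlim_scale: "sqlim M f g \<Longrightarrow> sqlim M (\<lambda>k x. c *\<^sub>R f k x) (\<lambda>x. c *\<^sub>R g x)"
  by (rule sqlim_dominated_diff[of M f g _ _ "\<bar>c\<bar>"])
    (auto simp: scaleR_diff_right[symmetric] intro!: sqint_scale
      dest: sqlimD intro: sqint_measurable[OF sqint_scale[OF sqlimD(1)]])

lemma sqlim_AE_cong:
  assumes "sqlim M f g" "AE x in M. g x = g' x" and [measurable]: "g' \<in> borel_measurable M"
  shows "sqlim M f g'"
proof -
  note 1 = sqlimD[OF assms(1)]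
  note [measurable] = 1(1,2)[THEN sqint_measurable]
  have "sqint M g'" by (rule sqint_dominated[OF 1(2)]) (use assms(2) in auto)
  moreover have "(LINT x|M. (norm (f k x - g x))\<^sup>2) = (LINT x|M. (norm (f k x - g' x))\<^sup>2)" for k
    by (rule integral_cong_AE) (measurable, use assms(2) in auto)
  ultimately show ?thesis using 1 by (simp add: sqlim_def)
qed

text \<open>Expanding around the limits leaves three error terms, each bounded by the Cauchy-Schwarz inequality.\<close>

lemma sqlim_inner:
  assumes "sqlim M f g" "sqlim M f' g'"
  shows "(\<lambda>k. LINT x|M. f k x \<bullet> f' k x) \<longlonglongrightarrow> (LINT x|M. g x \<bullet> g' x)"
proof -
  note 1 = sqlimD[OF assms(1)] and 2 = sqlimD[OF assms(2)]
  have small: "(\<lambda>k. LINT x|M. u k x \<bullet> v k x) \<longlonglongrightarrow> 0"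
    if u: "\<And>k. sqint M (u k)" and v: "\<And>k. sqint M (v k)"
      and ul: "(\<lambda>k. LINT x|M. (norm (u k x))\<^sup>2) \<longlonglongrightarrow> 0" and vl: "(\<lambda>k. LINT x|M. (norm (v k x))\<^sup>2) \<longlonglongrightarrow> B"
    for u v :: "nat \<Rightarrow> 'a \<Rightarrow> 'b" and B
  proof -
    have "(\<lambda>k. (LINT x|M. u k x \<bullet> v k x)\<^sup>2) \<longlonglongrightarrow> 0"
      by (rule tendsto_sandwich[OF _ _ tendsto_const tendsto_mult[OF ul vl, unfolded mult_zero_left]])
        (auto intro!: always_eventually L2_Cauchy_Schwarz u v)
    then show ?thesis by (rule tendsto_zero_of_square)
  qed
  have d1: "sqint M (\<lambda>x. f k x - g x)" and d2: "sqint M (\<lambda>x. f' k x - g' x)" for k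
    using 1 2 by (auto intro: sqint_diff)
  have a: "(\<lambda>k. LINT x|M. (f k x - g x) \<bullet> (f' k x - g' x)) \<longlonglongrightarrow> 0"
    by (rule small[OF d1 d2 1(3) 2(3)])
  have b: "(\<lambda>k. LINT x|M. (f k x - g x) \<bullet> g' x) \<longlonglongrightarrow> 0"
    by (rule small[OF d1 2(2) 1(3) tendsto_const])
  have c: "(\<lambda>k. LINT x|M. (f' k x - g' x) \<bullet> g x) \<longlonglongrightarrow> 0"
    by (rule small[OF d2 1(2) 2(3) tendsto_const])
  have "(LINT x|M. f k x \<bullet> f' k x) = (LINT x|M. (f k x - g x) \<bullet> (f' k x - g' x))
     + (LINT x|M. (f k x - g x) \<bullet> g' x) + (LINT x|M. (f' k x - g' x) \<bullet> g x) + (LINT x|M. g x \<bullet> g' x)" for k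
  proof -
    have "f k x \<bullet> f' k x = (f k x - g x) \<bullet> (f' k x - g' x) + (f k x - g x) \<bullet> g' x
       + (f' k x - g' x) \<bullet> g x + g x \<bullet> g' x" for x
      by (simp add: inner_simps inner_commute)
    then show ?thesis
      using sqint_inner_integrable[OF d1[of k] d2[of k]] sqint_inner_integrable[OF d1[of k] 2(2)]
        sqint_inner_integrable[OF d2[of k] 1(2)] sqint_inner_integrable[OF 1(2) 2(2)] by simp
  qed
  then show ?thesis
    using tendsto_add[OF tendsto_add[OF tendsto_add[OF a b] c] tendsto_const] by simp
qed

lemma sqlim_norm_sq:
  "sqlim M f g \<Longrightarrow> (\<lambda>k. LINT x|M. (norm (f k x))\<^sup>2) \<longlonglongrightarrow> (LINT x|M. (norm (g x))\<^sup>2)"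
  using sqlim_inner[of M f g f g] by (simp add: power2_norm_eq_inner)

lemma (in finite_measure) sqlim_integral:
  fixes f :: "nat \<Rightarrow> 'a \<Rightarrow> real"
  assumes "sqlim M f g"
  shows "(\<lambda>k. LINT x|M. f k x) \<longlonglongrightarrow> (LINT x|M. g x)"
  using sqlim_inner[OF assms sqlim_const[OF sqint_bounded[of "\<lambda>_. 1::real" 1]]] by simp

lemma sqlim_AE_subseq:
  assumes "sqlim M f g"
  obtains r where "strict_mono r" "AE x in M. (\<lambda>k. f (r k) x) \<longlonglongrightarrow> g x"
proof -
  note 1 = sqlimD[OF assms]
  obtain r :: "nat \<Rightarrow> nat" where r: "strict_mono r" "AE x in M. (\<lambda>n. (norm (f (r n) x - g x))\<^sup>2) \<longlonglongrightarrow> 0"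
    using tendsto_L1_AE_subseq[of M "\<lambda>n x. (norm (f n x - g x))\<^sup>2"] 1
    by (auto simp: sqint_integrable sqint_diff)
  show ?thesis
  proof (rule that[OF r(1)])
    show "AE x in M. (\<lambda>k. f (r k) x) \<longlonglongrightarrow> g x"
      using r(2) by eventually_elim
        (drule tendsto_zero_of_square, simp add: tendsto_norm_zero_iff LIM_zero_iff)
  qed
qed

lemma sqlim_dominated_convergence:
  assumes "\<And>k. f k \<in> borel_measurable M" "g \<in> borel_measurable M" "sqint M h"
    and "AE x in M. (\<lambda>k. f k x) \<longlonglongrightarrow> g x"
    and "\<And>k. AE x in M. norm (f k x) \<le> norm (h x)"
  shows "sqlim M f g"
  unfolding sqlim_def
proof (intro conjI allI)
  note [measurable] = assms(1,2) sqint_measurable[OF assms(3)]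
  show sf: "sqint M (f k)" for k
    by (rule sqint_dominated[OF assms(3,1,5)])
  have gh: "AE x in M. norm (g x) \<le> norm (h x)"
  proof -
    have "AE x in M. \<forall>k. norm (f k x) \<le> norm (h x)" using assms(5) by (simp add: AE_all_countable)
    with assms(4) show ?thesis
      by eventually_elim (rule LIMSEQ_le_const2[OF tendsto_norm], auto)
  qed
  show sg: "sqint M g" by (rule sqint_dominated[OF assms(3,2) gh])
  have "(\<lambda>k. LINT x|M. (norm (f k x - g x))\<^sup>2) \<longlonglongrightarrow> (LINT x|M. 0)"
  proof (rule integral_dominated_convergence[where w = "\<lambda>x. 4 * (norm (h x))\<^sup>2"])
    show "AE x in M. (\<lambda>k. (norm (f k x - g x))\<^sup>2) \<longlonglongrightarrow> 0"
      using assms(4)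
    proof eventually_elim
      case (elim x)
      then have "(\<lambda>k. norm (f k x - g x)) \<longlonglongrightarrow> 0" by (simp add: tendsto_norm_zero_iff LIM_zero_iff)
      from tendsto_power[OF this, of 2] show ?case by simp
    qed
    show "AE x in M. norm ((norm (f k x - g x))\<^sup>2) \<le> 4 * (norm (h x))\<^sup>2" for k
      using assms(5)[of k] gh
    proof eventually_elim
      case (elim x)
      have "norm (f k x - g x) \<le> 2 * norm (h x)"
        using norm_triangle_ineq4[of "f k x" "g x"] elim by simp
      from power_mono[OF this, of 2] show ?case by (simp add: power_mult_distrib)
    qed
  qed (use assms(3) in \<open>auto intro: sqint_integrable\<close>)
  then show "(\<lambda>k. LINT x|M. (norm (f k x - g x))\<^sup>2) \<longlonglongrightarrow> 0" by simp
qed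

lemma sqlim_bounded_mult:
  assumes "sqlim M f g" and [measurable]: "h \<in> borel_measurable M" and "AE x in M. \<bar>h x\<bar> \<le> C"
  shows "sqlim M (\<lambda>k x. h x *\<^sub>R f k x) (\<lambda>x. h x *\<^sub>R g x)"
proof (rule sqlim_dominated_diff[OF assms(1)])
  note 1 = sqlimD[OF assms(1)]
  note [measurable] = 1(1,2)[THEN sqint_measurable]
  show "(\<lambda>x. h x *\<^sub>R f k x) \<in> borel_measurable M" for k by measurable
  show "sqint M (\<lambda>x. h x *\<^sub>R g x)" by (rule sqint_bounded_mult) (use 1 assms in auto)
  show "AE x in M. norm (h x *\<^sub>R f k x - h x *\<^sub>R g x) \<le> C * norm (f k x - g x)" for k
    using assms(3) by eventually_elim (simp add: scaleR_diff_right[symmetric] mult_right_mono)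
qed

text \<open>In \<open>h\<^sub>k f\<^sub>k - h' g = h\<^sub>k (f\<^sub>k - g) + (h\<^sub>k - h') g\<close> the first term is small in \<open>L\<^sup>2\<close>, and the second is
  dominated by a multiple of \<open>g\<close>.\<close>

lemma sqlim_bounded_mult_seq:
  assumes f: "sqlim M f g" and h [measurable]: "\<And>k. h k \<in> borel_measurable M" "h' \<in> borel_measurable M"
    and b: "\<And>k x. \<bar>h k x\<bar> \<le> C" and l: "AE x in M. (\<lambda>k. h k x) \<longlonglongrightarrow> h' x"
  shows "sqlim M (\<lambda>k x. h k x *\<^sub>R f k x) (\<lambda>x. h' x *\<^sub>R g x)"
proof -
  note 1 = sqlimD[OF f]
  note [measurable] = 1(1,2)[THEN sqint_measurable]
  have "sqlim M (\<lambda>k x. h k x *\<^sub>R (f k x - g x)) (\<lambda>x. 0)"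
    by (rule sqlim_dominated_diff[OF f, of _ _ C]) (auto intro!: mult_right_mono b simp: sqint_zero)
  moreover have "sqlim M (\<lambda>k x. h k x *\<^sub>R g x) (\<lambda>x. h' x *\<^sub>R g x)"
  proof (rule sqlim_dominated_convergence[of _ _ _ "\<lambda>x. C *\<^sub>R g x"])
    show "sqint M (\<lambda>x. C *\<^sub>R g x)" by (rule sqint_scale[OF 1(2)])
    show "AE x in M. (\<lambda>k. h k x *\<^sub>R g x) \<longlonglongrightarrow> h' x *\<^sub>R g x"
      using l by eventually_elim (intro tendsto_intros)
    show "AE x in M. norm (h k x *\<^sub>R g x) \<le> norm (C *\<^sub>R g x)" for k
      using order_trans[OF b abs_ge_self] by (auto intro!: mult_right_mono)
  qed measurable
  ultimately have "sqlim M (\<lambda>k x. h k x *\<^sub>R (f k x - g x) + h k x *\<^sub>R g x) (\<lambda>x. 0 + h' x *\<^sub>R g x)"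
    by (rule sqlim_add)
  then show ?thesis by (simp add: scaleR_diff_right)
qed

lemma sqint_zero_iff:
  assumes "sqint M f" shows "(LINT x|M. (norm (f x))\<^sup>2) = 0 \<longleftrightarrow> (AE x in M. f x = 0)"
  using integral_nonneg_eq_0_iff_AE[OF sqint_integrable[OF assms]] by simp

text \<open>The limit is found along an almost everywhere convergent subsequence, and Fatou's lemma
  controls the distance to it.\<close>

lemma sqint_complete:
  fixes f :: "nat \<Rightarrow> 'a \<Rightarrow> 'b::euclidean_space"
  assumes f: "\<And>k. sqint M (f k)"
    and C: "\<And>e. e > 0 \<Longrightarrow> \<exists>N. \<forall>i\<ge>N. \<forall>j\<ge>N. (LINT x|M. (norm (f i x - f j x))\<^sup>2) < e"
  obtains g where "sqlim M f g"
proof -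
  note [measurable] = f[THEN sqint_measurable]
  have nn: "ennreal (LINT x|M. (norm (f i x - f j x))\<^sup>2) = (\<integral>\<^sup>+x. ennreal ((norm (f i x - f j x))\<^sup>2) \<partial>M)" for i j
    by (rule nn_integral_eq_integral[symmetric]) (auto intro!: sqint_integrable sqint_diff f)
  obtain s :: "nat \<Rightarrow> nat" where s: "strict_mono s"
    "\<And>n i j. i \<ge> s n \<Longrightarrow> j \<ge> s n \<Longrightarrow> (LINT x|M. (norm (f i x - f j x))\<^sup>2) < (1/4)^n"
  proof -
    have "\<exists>s. \<forall>n. (\<forall>i\<ge>s n. \<forall>j\<ge>s n. (LINT x|M. (norm (f i x - f j x))\<^sup>2) < (1/4)^n) \<and> s (Suc n) > (s n :: nat)"
    proof (intro dependent_nat_choice)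
      show "\<exists>x. \<forall>i\<ge>x. \<forall>j\<ge>x. (LINT x|M. (norm (f i x - f j x))\<^sup>2) < (1/4)^0" using C[of 1] by simp
      fix x n
      obtain N where "\<forall>i\<ge>N. \<forall>j\<ge>N. (LINT x|M. (norm (f i x - f j x))\<^sup>2) < (1/4)^Suc n"
        using C[of "(1/4)^Suc n"] by auto
      then show "\<exists>y. (\<forall>i\<ge>y. \<forall>j\<ge>y. (LINT x|M. (norm (f i x - f j x))\<^sup>2) < (1/4)^Suc n) \<and> x < y"
        by (intro exI[of _ "max N (Suc x)"]) auto
    qed
    then show ?thesis using that by (auto simp: strict_mono_Suc_iff)
  qed
  define u where "u n x = norm (f (s (Suc n)) x - f (s n) x)" for n x
  have [measurable]: "u n \<in> borel_measurable M" for n unfolding u_def by measurable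
  have un: "(\<integral>\<^sup>+x. ennreal ((u n x)\<^sup>2) \<partial>M) \<le> ennreal ((1/4)^n)" for n
    using s(2)[of n "s (Suc n)" "s n"] strict_monoD[OF s(1), of n "Suc n"]
    by (simp add: u_def nn[symmetric] ennreal_leI)
  \<comment> \<open>\<open>u n\<close> need not be integrable when the measure is infinite, so the weights \<open>2 ^ n\<close> are
    put on the squares; summability of these gives \<open>u n \<le> (1 / sqrt 2) ^ n\<close> eventually.\<close>
  have "(\<integral>\<^sup>+x. (\<Sum>n. ennreal (2^n * (u n x)\<^sup>2)) \<partial>M) = (\<Sum>n. \<integral>\<^sup>+x. ennreal (2^n * (u n x)\<^sup>2) \<partial>M)"
    by (rule nn_integral_suminf) measurable
  also have "\<dots> \<le> (\<Sum>n. ennreal ((1/2)^n))"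
  proof (rule suminf_le)
    fix n
    have "(\<integral>\<^sup>+x. ennreal (2^n * (u n x)\<^sup>2) \<partial>M) = ennreal (2^n) * (\<integral>\<^sup>+x. ennreal ((u n x)\<^sup>2) \<partial>M)"
      by (subst nn_integral_cmult[symmetric]) (auto simp: ennreal_mult)
    also have "\<dots> \<le> ennreal (2^n) * ennreal ((1/4)^n)" by (intro mult_left_mono un) simp
    also have "\<dots> = ennreal ((1/2)^n)"
      by (simp add: ennreal_mult[symmetric] power_mult_distrib[symmetric])
    finally show "(\<integral>\<^sup>+x. ennreal (2^n * (u n x)\<^sup>2) \<partial>M) \<le> ennreal ((1/2)^n)" .
  qed auto
  also have "\<dots> = ennreal (\<Sum>n. (1/2)^n)" by (rule suminf_ennreal2) (auto intro!: summable_geometric)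
  also have "\<dots> < \<infinity>" by simp
  finally have "AE x in M. (\<Sum>n. ennreal (2^n * (u n x)\<^sup>2)) \<noteq> \<infinity>"
    by (intro nn_integral_noteq_infinite) auto
  then have conv: "AE x in M. convergent (\<lambda>n. f (s n) x)"
  proof eventually_elim
    case (elim x)
    have "summable (\<lambda>n. 2^n * (u n x)\<^sup>2)"
      by (rule summable_suminf_not_top) (use elim in auto)
    from summable_LIMSEQ_zero[OF this] have "eventually (\<lambda>n. 2^n * (u n x)\<^sup>2 < 1) sequentially"
      by (rule order_tendstoD) simp
    then have "eventually (\<lambda>n. norm (f (s (Suc n)) x - f (s n) x) \<le> (1 / sqrt 2)^n) sequentially"
    proof eventually_elim
      case (elim n)
      have "((1 / sqrt 2)^n)\<^sup>2 = ((1 / sqrt 2)\<^sup>2)^n" by (simp only: power_mult[symmetric] mult.commute)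
      also have "\<dots> = 1 / 2^n" by (simp add: power_divide)
      finally have "(u n x)\<^sup>2 \<le> ((1 / sqrt 2)^n)\<^sup>2"
        using elim by (simp add: pos_le_divide_eq mult.commute)
      then have "u n x \<le> (1 / sqrt 2)^n" by (rule power2_le_imp_le) simp
      then show ?case by (simp add: u_def)
    qed
    moreover have "summable (\<lambda>n. (1 / sqrt 2)^n)"
      by (rule summable_geometric) (simp add: real_less_rsqrt)
    ultimately have "summable (\<lambda>n. f (s (Suc n)) x - f (s n) x)"
      by (rule summable_comparison_test_ev)
    then have "convergent (\<lambda>n. f (s n) x - f (s 0) x)"
      by (simp add: summable_iff_convergent sum_lessThan_telescope[of "\<lambda>n. f (s n) x"])
    from convergent_add[OF this convergent_const[of "f (s 0) x"]] show ?case by simp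
  qed
  define g where "g x = lim (\<lambda>n. f (s n) x)" for x
  have [measurable]: "g \<in> borel_measurable M" unfolding g_def[abs_def] by measurable
  have lim: "AE x in M. (\<lambda>n. f (s n) x) \<longlonglongrightarrow> g x"
    using conv by eventually_elim (simp add: g_def convergent_LIMSEQ_iff)
  have fatou: "(\<integral>\<^sup>+x. ennreal ((norm (f k x - g x))\<^sup>2) \<partial>M) \<le> ennreal ((1/4)^n)" if k: "k \<ge> s n" for k n
  proof -
    have "(\<integral>\<^sup>+x. ennreal ((norm (f k x - g x))\<^sup>2) \<partial>M)
        = (\<integral>\<^sup>+x. liminf (\<lambda>j. ennreal ((norm (f k x - f (s j) x))\<^sup>2)) \<partial>M)"
    proof (rule nn_integral_cong_AE)
      show "AE x in M. ennreal ((norm (f k x - g x))\<^sup>2) = liminf (\<lambda>j. ennreal ((norm (f k x - f (s j) x))\<^sup>2))"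
        using lim
      proof eventually_elim
        case (elim x)
        have "(\<lambda>j. ennreal ((norm (f k x - f (s j) x))\<^sup>2)) \<longlonglongrightarrow> ennreal ((norm (f k x - g x))\<^sup>2)"
          by (intro tendsto_intros elim)
        from lim_imp_Liminf[OF _ this] show ?case by simp
      qed
    qed
    also have "\<dots> \<le> liminf (\<lambda>j. \<integral>\<^sup>+x. ennreal ((norm (f k x - f (s j) x))\<^sup>2) \<partial>M)"
      by (rule nn_integral_liminf) measurable
    also have "\<dots> \<le> ennreal ((1/4)^n)"
    proof (rule Liminf_le)
      show "\<forall>\<^sub>F j in sequentially. (\<integral>\<^sup>+x. ennreal ((norm (f k x - f (s j) x))\<^sup>2) \<partial>M) \<le> ennreal ((1/4)^n)"
        unfolding nn[symmetric]
      proof (rule eventually_mono[OF eventually_ge_at_top[of n]])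
        fix j assume "n \<le> j"
        then have "s n \<le> s j" using s(1) by (simp add: strict_mono_less_eq)
        with s(2)[OF k, of "s j"] show "ennreal (LINT x|M. (norm (f k x - f (s j) x))\<^sup>2) \<le> ennreal ((1/4)^n)"
          by (intro ennreal_leI) simp
      qed
    qed simp
    finally show ?thesis .
  qed
  have d: "sqint M (\<lambda>x. f (s 0) x - g x)"
    unfolding sqint_def
  proof (intro conjI)
    show "integrable M (\<lambda>x. (norm (f (s 0) x - g x))\<^sup>2)"
      by (rule integrableI_nonneg) (use order_le_less_trans[OF fatou[of 0 "s 0"]] in auto)
  qed measurable
  have g: "sqint M g" using sqint_diff[OF f[of "s 0"] d] by simp
  have "(\<lambda>k. LINT x|M. (norm (f k x - g x))\<^sup>2) \<longlonglongrightarrow> 0"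
  proof (rule LIMSEQ_I)
    fix e :: real assume "0 < e"
    then obtain n where n: "(1/4)^n < e" using real_arch_pow_inv[of e "1/4"] by auto
    have "norm ((LINT x|M. (norm (f k x - g x))\<^sup>2) - 0) < e" if "k \<ge> s n" for k
    proof -
      have "ennreal (LINT x|M. (norm (f k x - g x))\<^sup>2) = (\<integral>\<^sup>+x. ennreal ((norm (f k x - g x))\<^sup>2) \<partial>M)"
        by (rule nn_integral_eq_integral[symmetric]) (auto intro!: sqint_integrable sqint_diff f g)
      then have "(LINT x|M. (norm (f k x - g x))\<^sup>2) \<le> (1/4)^n"
        using fatou[OF that] by (metis ennreal_le_iff zero_le_divide_1_iff zero_le_numeral zero_le_power)
      with n show ?thesis by simp
    qed
    then show "\<exists>N. \<forall>k\<ge>N. norm ((LINT x|M. (norm (f k x - g x))\<^sup>2) - 0) < e" by blast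
  qed
  with f g have "sqlim M f g" by (simp add: sqlim_def)
  then show ?thesis by (rule that)
qed


section \<open>Smooth functions and test functions\<close>


abbreviation smooth :: "(real^'n \<Rightarrow> real) \<Rightarrow> bool" where
  "smooth f \<equiv> \<forall>k. Ck k f"

lemma has_derivative_grad:
  assumes "f differentiable (at x)"
  shows "(f has_derivative (\<lambda>v. grad f x \<bullet> v)) (at x)"
proof -
  let ?D = "frechet_derivative f (at x)"
  have D: "(f has_derivative ?D) (at x)" using assms by (simp add: frechet_derivative_works)
  then have lin: "linear ?D" by (rule has_derivative_linear)
  have "?D v = grad f x \<bullet> v" for v
  proof -
    have "?D v = ?D (\<Sum>i\<in>UNIV. v $ i *\<^sub>R axis i 1)"
      by (simp add: basis_expansion[of v, unfolded scalar_mult_eq_scaleR] )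
    also have "\<dots> = (\<Sum>i\<in>UNIV. v $ i * ?D (axis i 1))"
      by (simp add: linear_sum[OF lin] linear_scale[OF lin])
    finally show ?thesis by (simp add: grad_def inner_vec_def mult.commute)
  qed
  with D show ?thesis by (metis (no_types, lifting) has_derivative_eq_rhs ext)
qed

lemma grad_eqI:
  assumes "(f has_derivative (\<lambda>v. g \<bullet> v)) (at x)" shows "grad f x = g"
proof -
  have "frechet_derivative f (at x) = (\<lambda>v. g \<bullet> v)" using frechet_derivative_at[OF assms] by simp
  then show ?thesis by (simp add: grad_def vec_eq_iff inner_axis)
qed

text \<open>Closure properties of \<open>Ck k\<close> are proved by induction on \<open>k\<close> through this rule: the derivative of each of the
  constructions below is built from constructions of the same kind.\<close>

lemma Ck_SucI:
  assumes "\<And>x. (f has_derivative f' x) (at x)" "\<And>v. Ck k (\<lambda>x. f' x v)"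
  shows "Ck (Suc k) f"
proof -
  have "frechet_derivative f (at x) = f' x" for x using frechet_derivative_at[OF assms(1)] by simp
  with assms show ?thesis by (auto simp: differentiable_on_def differentiable_def)
qed

lemma Ck_Suc_less: "Ck (Suc k) f \<Longrightarrow> Ck k f"
  by (induction k arbitrary: f) (auto intro: differentiable_imp_continuous_on)

lemma Ck_SucD:
  assumes "Ck (Suc k) f"
  shows "(f has_derivative (\<lambda>v. frechet_derivative f (at x) v)) (at x)" "Ck k (\<lambda>x. frechet_derivative f (at x) v)"
  using assms by (auto simp: differentiable_on_def frechet_derivative_works)

lemma Ck_const: "Ck k (\<lambda>x. c)"
  by (induction k arbitrary: c) (simp, rule Ck_SucI[OF has_derivative_const], simp)

lemma Ck_add: "Ck k f \<Longrightarrow> Ck k g \<Longrightarrow> Ck k (\<lambda>x. f x + g x)"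
proof (induction k arbitrary: f g)
  case (Suc k)
  show ?case
    by (rule Ck_SucI[OF has_derivative_add[OF Ck_SucD(1)[OF Suc.prems(1)] Ck_SucD(1)[OF Suc.prems(2)]]])
      (intro Suc.IH Ck_SucD(2)[OF Suc.prems(1)] Ck_SucD(2)[OF Suc.prems(2)])
qed (auto intro: continuous_intros)

lemma Ck_mult: "Ck k f \<Longrightarrow> Ck k g \<Longrightarrow> Ck k (\<lambda>x. f x * g x)"
proof (induction k arbitrary: f g)
  case (Suc k)
  show ?case
    by (rule Ck_SucI[OF has_derivative_mult[OF Ck_SucD(1)[OF Suc.prems(1)] Ck_SucD(1)[OF Suc.prems(2)]]])
      (intro Ck_add Suc.IH Ck_SucD(2)[OF Suc.prems(1)] Ck_SucD(2)[OF Suc.prems(2)] Ck_Suc_less[OF Suc.prems(1)]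
         Ck_Suc_less[OF Suc.prems(2)])
qed (auto intro: continuous_intros)

lemma Ck_cmult: "Ck k f \<Longrightarrow> Ck k (\<lambda>x. c * f x)"
  by (intro Ck_mult Ck_const)

lemma Ck_diff: "Ck k f \<Longrightarrow> Ck k g \<Longrightarrow> Ck k (\<lambda>x. f x - g x)"
  using Ck_add[of k f "\<lambda>x. (-1) * g x"] Ck_cmult[of k g "-1"] by simp

lemma Ck_inner: "Ck k (\<lambda>x. x \<bullet> w)"
proof (cases k)
  case (Suc m)
  then show ?thesis by (simp only:) (rule Ck_SucI[OF has_derivative_inner_left[OF has_derivative_ident]], rule Ck_const)
qed (simp add: continuous_on_inner continuous_on_id continuous_on_const)

lemma Ck_sum: "finite I \<Longrightarrow> (\<And>i. i \<in> I \<Longrightarrow> Ck k (f i)) \<Longrightarrow> Ck k (\<lambda>x. \<Sum>i\<in>I. f i x)"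
  by (induction I rule: finite_induct) (auto intro: Ck_const Ck_add)

lemma Ck_inverse: "Ck k f \<Longrightarrow> (\<And>x. f x \<noteq> 0) \<Longrightarrow> Ck k (\<lambda>x. inverse (f x))"
proof (induction k arbitrary: f)
  case (Suc k)
  have "Ck k (\<lambda>x. - (inverse (f x) * frechet_derivative f (at x) v * inverse (f x)))" for v
    using Ck_cmult[OF Ck_mult[OF Ck_mult[OF Suc.IH[OF Ck_Suc_less[OF Suc.prems(1)] Suc.prems(2)] Ck_SucD(2)[OF Suc.prems(1), of v]]
       Suc.IH[OF Ck_Suc_less[OF Suc.prems(1)] Suc.prems(2)]], of "-1"] by simp
  then show ?case
    by (intro Ck_SucI[OF Deriv.has_derivative_inverse[OF Suc.prems(2) Ck_SucD(1)[OF Suc.prems(1)]]])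
qed (auto intro!: continuous_intros)

lemma Ck_sqrt: "Ck k f \<Longrightarrow> (\<And>x. f x > 0) \<Longrightarrow> Ck k (\<lambda>x. sqrt (f x))"
proof (induction k arbitrary: f)
  case (Suc k)
  note IH = Suc.IH[OF Ck_Suc_less[OF Suc.prems(1)] Suc.prems(2)]
  have "((\<lambda>x. sqrt (f x)) has_derivative (\<lambda>v. frechet_derivative f (at x) v * (inverse (sqrt (f x)) / 2))) (at x)" for x
    using has_derivative_real_sqrt[OF Suc.prems(2) Ck_SucD(1)[OF Suc.prems(1)]] .
  moreover have "Ck k (\<lambda>x. frechet_derivative f (at x) v * (inverse (sqrt (f x)) / 2))" for v
    using Ck_mult[OF Ck_SucD(2)[OF Suc.prems(1), of v] Ck_cmult[OF Ck_inverse[OF IH], of "1/2"]] Suc.prems(2)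
    by (simp add: less_imp_neq[symmetric])
  ultimately show ?case by (rule Ck_SucI)
qed (auto intro!: continuous_intros)

text \<open>The functions \<open>t \<mapsto> exp (- 1 / t) / t ^ m\<close> (for \<open>t > 0\<close>) vanish to infinite order at \<open>0\<close>, and
  the derivative of one of them is a combination of two others; this closure property makes smoothness
  of compositions an easy induction.\<close>

definition flat :: "nat \<Rightarrow> real \<Rightarrow> real" where
  "flat m t = (if 0 < t then inverse t ^ m * exp (- inverse t) else 0)"

lemma flat_tendsto_zero: "(flat m \<longlongrightarrow> 0) (at 0)"
proof -
  have 1: "((\<lambda>t. inverse t ^ m * exp (- inverse t)) \<longlongrightarrow> 0) (at_right (0::real))"
    by (rule filterlim_compose[OF tendsto_power_div_exp_0[of m, unfolded divide_inverse exp_minus[symmetric]] filterlim_inverse_at_top_right])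
  have "(flat m \<longlongrightarrow> 0) (at_right 0)"
    by (rule Lim_transform_eventually[OF 1])
      (auto simp: eventually_at_filter flat_def)
  moreover have "(flat m \<longlongrightarrow> 0) (at_left 0)"
    by (rule Lim_transform_eventually[OF tendsto_const]) (auto simp: eventually_at_filter flat_def)
  ultimately show ?thesis by (simp add: filterlim_split_at)
qed

lemma flat_has_derivative: "(flat m has_real_derivative (flat (m + 2) t - m * flat (m + 1) t)) (at t)"
proof -
  consider "t > 0" | "t < 0" | "t = 0" by linarith
  then show ?thesis
  proof cases
    case 1
    have i: "(inverse has_real_derivative - (inverse t ^ 2)) (at t)"
      using DERIV_inverse[of t] 1 by (simp add: numeral_2_eq_2)
    have e: "((\<lambda>t. exp (- inverse t)) has_real_derivative exp (- inverse t) * - (- (inverse t ^ 2))) (at t)"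
      by (rule DERIV_chain2[OF DERIV_exp DERIV_minus[OF i]])
    have "flat (m + 2) t - m * flat (m + 1) t =
        m * (- (inverse t ^ 2) * inverse t ^ (m - Suc 0)) * exp (- inverse t)
          + exp (- inverse t) * - (- (inverse t ^ 2)) * inverse t ^ m"
      using 1 unfolding flat_def by (cases m) (simp_all add: algebra_simps power2_eq_square)
    then have "((\<lambda>t. inverse t ^ m * exp (- inverse t)) has_real_derivative (flat (m + 2) t - m * flat (m + 1) t)) (at t)"
      using DERIV_mult[OF DERIV_power[OF i, of m] e] by metis
    then show ?thesis
      by (rule has_field_derivative_transform_within_open[of _ _ _ "{0<..}"]) (use 1 in \<open>auto simp: flat_def\<close>)
  next
    case 2
    have "((\<lambda>t. 0) has_real_derivative (flat (m + 2) t - m * flat (m + 1) t)) (at t)"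
      using 2 by (simp add: flat_def)
    then show ?thesis
      by (rule has_field_derivative_transform_within_open[of _ _ _ "{..<0}"]) (use 2 in \<open>auto simp: flat_def\<close>)
  next
    case 3
    have "((\<lambda>h. flat m h / h) \<longlongrightarrow> 0) (at 0)"
      by (rule Lim_transform_eventually[OF flat_tendsto_zero[of "Suc m"]])
        (auto simp: eventually_at_filter flat_def field_simps)
    with 3 show ?thesis by (simp add: DERIV_def flat_def)
  qed
qed

lemma Ck_flat: "Ck k f \<Longrightarrow> Ck k (\<lambda>x. flat m (f x))"
proof (induction k arbitrary: m)
  case 0
  have "continuous_on UNIV (flat m)"
    by (rule DERIV_continuous_on[OF flat_has_derivative[THEN has_field_derivative_at_within]])
  with 0 show ?case by (auto intro: continuous_on_compose2)
next
  case (Suc k)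
  have "((\<lambda>x. flat m (f x)) has_derivative
      (\<lambda>v. (flat (m + 2) (f x) - m * flat (m + 1) (f x)) * frechet_derivative f (at x) v)) (at x)" for x
    using has_derivative_compose[OF Ck_SucD(1)[OF Suc.prems] has_field_derivative_imp_has_derivative[OF flat_has_derivative]]
    by simp
  then show ?case
    by (rule Ck_SucI) (intro Ck_mult Ck_diff Ck_cmult Suc.IH Ck_SucD(2)[OF Suc.prems] Ck_Suc_less[OF Suc.prems])
qed

lemma flat_0: "flat 0 t = (if 0 < t then exp (- inverse t) else 0)"
  by (simp add: flat_def)

text \<open>Any compact subset of \<open>\<Omega>\<close> outside of which \<open>\<phi>\<close> vanishes will do; this is easier to supply than the support itself.\<close>

lemma test_functionsI:
  assumes "smooth \<phi>" "compact K" "K \<subseteq> \<Omega>" "\<And>x. x \<notin> K \<Longrightarrow> \<phi> x = 0"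
  shows "\<phi> \<in> test_functions \<Omega>"
proof -
  have s: "closure {x. \<phi> x \<noteq> 0} \<subseteq> K"
    using assms(2,4) by (intro closure_minimal) (auto intro: compact_imp_closed)
  moreover have "compact (closure {x. \<phi> x \<noteq> 0})"
    using s assms(2) by (meson bounded_subset closed_closure compact_eq_bounded_closed)
  ultimately show ?thesis using assms(1,3) by (auto simp: test_functions_def)
qed

lemma test_functionsE:
  assumes "\<phi> \<in> test_functions \<Omega>"
  obtains K where "smooth \<phi>" "compact K" "K \<subseteq> \<Omega>" "\<And>x. x \<notin> K \<Longrightarrow> \<phi> x = 0"
proof (rule that[of "closure {x. \<phi> x \<noteq> 0}"])
  show "smooth \<phi>" "compact (closure {x. \<phi> x \<noteq> 0})" "closure {x. \<phi> x \<noteq> 0} \<subseteq> \<Omega>"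
    using assms unfolding test_functions_def by simp_all
  show "\<phi> x = 0" if "x \<notin> closure {x. \<phi> x \<noteq> 0}" for x
    using that closure_subset[of "{x. \<phi> x \<noteq> 0}"] by blast
qed

definition C1 :: "(real^'n \<Rightarrow> real) \<Rightarrow> bool" where
  "C1 f \<longleftrightarrow> (\<forall>x. (f has_derivative (\<lambda>v. grad f x \<bullet> v)) (at x)) \<and> continuous_on UNIV (grad f)"

lemma C1I:
  assumes "\<And>x. (f has_derivative (\<lambda>v. g x \<bullet> v)) (at x)" "continuous_on UNIV g"
  shows "C1 f" "grad f = g"
proof -
  show "grad f = g" using grad_eqI[OF assms(1)] by auto
  with assms show "C1 f" by (simp add: C1_def)
qed

lemma smooth_C1: "smooth f \<Longrightarrow> C1 f"
proof -
  assume "smooth f"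
  then have f: "Ck (Suc 0) f" by blast
  show "C1 f"
    unfolding C1_def
  proof (intro conjI allI)
    show "(f has_derivative (\<lambda>v. grad f x \<bullet> v)) (at x)" for x
      using f by (intro has_derivative_grad) (simp add: differentiable_on_def)
    show "continuous_on UNIV (grad f)"
      unfolding grad_def[abs_def] using f by (intro continuous_on_vec_lambda) auto
  qed
qed

lemma C1D: "C1 f \<Longrightarrow> (f has_derivative (\<lambda>v. grad f x \<bullet> v)) (at x)"
  by (simp add: C1_def)

lemma C1_continuous: "C1 f \<Longrightarrow> continuous_on UNIV f"
  by (intro continuous_at_imp_continuous_on ballI) (rule has_derivative_continuous[OF C1D])

lemma C1_compose:
  assumes f: "C1 f" and F: "\<And>t. (F has_real_derivative F' t) (at t)" "continuous_on UNIV F'"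
  shows "C1 (\<lambda>x. F (f x))" "grad (\<lambda>x. F (f x)) = (\<lambda>x. F' (f x) *\<^sub>R grad f x)"
proof -
  have "((\<lambda>x. F (f x)) has_derivative (\<lambda>v. (F' (f x) *\<^sub>R grad f x) \<bullet> v)) (at x)" for x
    using has_derivative_compose[OF _ has_field_derivative_imp_has_derivative[OF F(1)], of f "\<lambda>v. grad f x \<bullet> v" x UNIV] f
    by (simp add: C1_def)
  moreover have "continuous_on UNIV (\<lambda>x. F' (f x) *\<^sub>R grad f x)"
    using f by (intro continuous_intros continuous_on_compose2[OF F(2)] C1_continuous) (auto simp: C1_def)
  ultimately show "C1 (\<lambda>x. F (f x))" "grad (\<lambda>x. F (f x)) = (\<lambda>x. F' (f x) *\<^sub>R grad f x)"
    by (fact C1I)+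
qed

lemma grad_add: "C1 f \<Longrightarrow> C1 g \<Longrightarrow> grad (\<lambda>x. f x + g x) x = grad f x + grad g x"
  by (rule grad_eqI, unfold inner_add_left, rule has_derivative_add) (erule C1D)+

lemma grad_cmult: "C1 f \<Longrightarrow> grad (\<lambda>x. c * f x) x = c *\<^sub>R grad f x"
  by (rule grad_eqI, unfold inner_scaleR_left, rule has_derivative_mult_right) (erule C1D)

lemma grad_diff: "C1 f \<Longrightarrow> C1 g \<Longrightarrow> grad (\<lambda>x. f x - g x) x = grad f x - grad g x"
  by (rule grad_eqI, unfold inner_diff_left, rule has_derivative_diff) (erule C1D)+

lemma grad_mult: 
  assumes "C1 f" "C1 g" shows "grad (\<lambda>x. f x * g x) x = f x *\<^sub>R grad g x + g x *\<^sub>R grad f x"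
proof (rule grad_eqI)
  have "((\<lambda>x. f x * g x) has_derivative (\<lambda>v. f x * (grad g x \<bullet> v) + (grad f x \<bullet> v) * g x)) (at x)"
    using assms by (intro has_derivative_mult) (auto simp: C1_def)
  then show "((\<lambda>x. f x * g x) has_derivative (\<lambda>v. (f x *\<^sub>R grad g x + g x *\<^sub>R grad f x) \<bullet> v)) (at x)"
    by (simp add: inner_add_left mult.commute)
qed

lemma test_C1: "\<phi> \<in> test_functions \<Omega> \<Longrightarrow> C1 \<phi>"
  by (rule smooth_C1) (auto simp: test_functions_def)

lemma test_grad_support:
  assumes "\<phi> \<in> test_functions \<Omega>"
  obtains K where "compact K" "K \<subseteq> \<Omega>" "\<And>x. x \<notin> K \<Longrightarrow> \<phi> x = 0" "\<And>x. x \<notin> K \<Longrightarrow> grad \<phi> x = 0"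
proof -
  obtain K where K: "compact K" "K \<subseteq> \<Omega>" "\<And>x. x \<notin> K \<Longrightarrow> \<phi> x = 0"
    using test_functionsE[OF assms] by metis
  have "grad \<phi> x = 0" if "x \<notin> K" for x
  proof (rule grad_eqI)
    have "open (- K)" using K(1) by (simp add: compact_imp_closed open_Compl)
    show "(\<phi> has_derivative (\<lambda>v. 0 \<bullet> v)) (at x)"
      by (rule has_derivative_transform_within_open[of "\<lambda>_. 0" _ _ _ "- K"])
        (use that K \<open>open (- K)\<close> in auto)
  qed
  with K that show ?thesis by blast
qed

lemma test_bounded:
  assumes "\<phi> \<in> test_functions \<Omega>"
  obtains B where "0 \<le> B" "\<And>x. \<bar>\<phi> x\<bar> \<le> B" "\<And>x. norm (grad \<phi> x) \<le> B"
proof -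
  obtain K where K: "compact K" "K \<subseteq> \<Omega>" "\<And>x. x \<notin> K \<Longrightarrow> \<phi> x = 0" "\<And>x. x \<notin> K \<Longrightarrow> grad \<phi> x = 0"
    using test_grad_support[OF assms] by metis
  note C = test_C1[OF assms]
  have "bounded (\<phi> ` K)" "bounded (grad \<phi> ` K)"
    using K(1) C C1_continuous[OF C] unfolding C1_def
    by (auto intro!: compact_imp_bounded compact_continuous_image intro: continuous_on_subset)
  then obtain b c where bc: "\<And>x. x \<in> K \<Longrightarrow> norm (\<phi> x) \<le> b" "\<And>x. x \<in> K \<Longrightarrow> norm (grad \<phi> x) \<le> c"
    unfolding bounded_iff by blast
  show ?thesis
  proof (rule that[of "max 0 (max b c)"])
    show "\<bar>\<phi> x\<bar> \<le> max 0 (max b c)" "norm (grad \<phi> x) \<le> max 0 (max b c)" for x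
      using bc(1)[of x] bc(2)[of x] K(3)[of x] K(4)[of x] by (cases "x \<in> K"; force)+
  qed simp
qed

lemma test_add:
  assumes "\<phi> \<in> test_functions \<Omega>" "\<psi> \<in> test_functions \<Omega>"
  shows "(\<lambda>x. \<phi> x + \<psi> x) \<in> test_functions \<Omega>"
proof -
  obtain K where K: "smooth \<phi>" "compact K" "K \<subseteq> \<Omega>" "\<And>x. x \<notin> K \<Longrightarrow> \<phi> x = 0"
    using test_functionsE[OF assms(1)] by metis
  obtain L where L: "smooth \<psi>" "compact L" "L \<subseteq> \<Omega>" "\<And>x. x \<notin> L \<Longrightarrow> \<psi> x = 0"
    using test_functionsE[OF assms(2)] by metis
  show ?thesis
    by (rule test_functionsI[of _ "K \<union> L"]) (use K L in \<open>auto intro: Ck_add\<close>)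
qed

lemma test_mult:
  assumes "\<phi> \<in> test_functions \<Omega>" "smooth \<psi>"
  shows "(\<lambda>x. \<phi> x * \<psi> x) \<in> test_functions \<Omega>"
proof -
  obtain K where K: "smooth \<phi>" "compact K" "K \<subseteq> \<Omega>" "\<And>x. x \<notin> K \<Longrightarrow> \<phi> x = 0"
    using test_functionsE[OF assms(1)] by metis
  show ?thesis
    by (rule test_functionsI[OF _ K(2,3)]) (simp_all add: Ck_mult K assms)
qed

lemma test_cmult: "\<phi> \<in> test_functions \<Omega> \<Longrightarrow> (\<lambda>x. c * \<phi> x) \<in> test_functions \<Omega>"
  using test_mult[of \<phi> \<Omega> "\<lambda>x. c"] by (simp add: Ck_const mult.commute)

lemma test_diff: "\<phi> \<in> test_functions \<Omega> \<Longrightarrow> \<psi> \<in> test_functions \<Omega> \<Longrightarrow> (\<lambda>x. \<phi> x - \<psi> x) \<in> test_functions \<Omega>"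
  using test_add[of \<phi> \<Omega> "\<lambda>x. (-1) * \<psi> x"] test_cmult[of \<psi> \<Omega> "-1"] by simp

lemma smooth_sqrt: "smooth \<phi> \<Longrightarrow> 0 < e \<Longrightarrow> smooth (\<lambda>x. sqrt ((\<phi> x)\<^sup>2 + e\<^sup>2))"
  unfolding power2_eq_square
  by (intro allI Ck_sqrt Ck_add Ck_mult Ck_const) (blast, blast, simp add: add_nonneg_pos)

text \<open>A smooth substitute for \<open>\<bar>\<phi>\<bar>\<close>, which is not smooth; the constant \<open>e\<close> is subtracted to keep the support compact.\<close>

lemma test_sqrt:
  assumes "\<phi> \<in> test_functions \<Omega>" "0 < e"
  shows "(\<lambda>x. sqrt ((\<phi> x)\<^sup>2 + e\<^sup>2) - e) \<in> test_functions \<Omega>"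
proof -
  obtain K where K: "smooth \<phi>" "compact K" "K \<subseteq> \<Omega>" "\<And>x. x \<notin> K \<Longrightarrow> \<phi> x = 0"
    using test_functionsE[OF assms(1)] by metis
  show ?thesis
  proof (rule test_functionsI[OF _ K(2,3)])
    show "smooth (\<lambda>x. sqrt ((\<phi> x)\<^sup>2 + e\<^sup>2) - e)"
      using smooth_sqrt[OF K(1) assms(2)] by (intro allI Ck_diff Ck_const) blast
  qed (use K assms in auto)
qed

definition bump :: "real^'n \<Rightarrow> real \<Rightarrow> real^'n \<Rightarrow> real" where
  "bump p r x = flat 0 (r\<^sup>2 - (x - p) \<bullet> (x - p))"

lemma bump_pos_iff: "0 < r \<Longrightarrow> 0 < bump p r x \<longleftrightarrow> x \<in> ball p r"
  and bump_nonneg: "0 \<le> bump p r x"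
  and bump_zero: "0 < r \<Longrightarrow> x \<notin> ball p r \<Longrightarrow> bump p r x = 0"
proof -
  assume r: "0 < r"
  have *: "0 < r\<^sup>2 - (x - p) \<bullet> (x - p) \<longleftrightarrow> x \<in> ball p r"
  proof -
    have "(norm (x - p))\<^sup>2 < r\<^sup>2 \<longleftrightarrow> norm (x - p) < r"
    proof
      show "norm (x - p) < r" if "(norm (x - p))\<^sup>2 < r\<^sup>2"
        by (rule power_less_imp_less_base[OF that]) (use r in simp)
      show "(norm (x - p))\<^sup>2 < r\<^sup>2" if "norm (x - p) < r"
        by (rule power_strict_mono[OF that]) auto
    qed
    then show ?thesis by (simp add: power2_norm_eq_inner dist_commute[of p x]) (simp add: dist_norm)
  qed
  then show "0 < bump p r x \<longleftrightarrow> x \<in> ball p r" by (auto simp: bump_def flat_0)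
  show "x \<notin> ball p r \<Longrightarrow> bump p r x = 0" using * by (auto simp: bump_def flat_0)
qed (simp add: bump_def flat_0)

lemma smooth_bump: "smooth (bump p r)"
proof
  fix k
  have "Ck k (\<lambda>x. flat 0 (r\<^sup>2 - (\<Sum>i\<in>UNIV. (x \<bullet> axis i 1 - p $ i) * (x \<bullet> axis i 1 - p $ i))))"
    by (intro Ck_flat Ck_diff Ck_const Ck_sum Ck_mult Ck_inner finite)
  moreover have "(\<Sum>i\<in>UNIV. (x \<bullet> axis i 1 - p $ i) * (x \<bullet> axis i 1 - p $ i)) = (x - p) \<bullet> (x - p)" for x
    by (simp only: inner_axis) (simp add: inner_vec_def)
  ultimately show "Ck k (bump p r)" by (simp add: bump_def[abs_def])
qed


section \<open>Weak gradients\<close>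


lemma C1_measurable:
  assumes "C1 u" shows "u \<in> borel_measurable borel" "grad u \<in> borel_measurable borel"
  using C1_continuous[OF assms] assms unfolding C1_def by (simp_all add: borel_measurable_continuous_onI)

lemma C1_line:
  assumes "C1 f"
  shows "((\<lambda>t. f (x + t *\<^sub>R v)) has_real_derivative grad f (x + t *\<^sub>R v) \<bullet> v) (at t)"
proof -
  have "((\<lambda>t. x + t *\<^sub>R v) has_derivative (\<lambda>s. s *\<^sub>R v)) (at t)"
    by (auto intro!: derivative_eq_intros)
  from has_derivative_compose[OF this C1D[OF assms]] show ?thesis
    unfolding has_field_derivative_def by (rule has_derivative_eq_rhs) (auto simp: fun_eq_iff)
qed

text \<open>The integral of \<open>f (x + h *\<^sub>R v)\<close> does not depend on \<open>h\<close>; differentiate at \<open>h = 0\<close>.\<close>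

lemma integral_grad_compact_support:
  fixes f :: "real^'n \<Rightarrow> real"
  assumes f: "C1 f" and K: "compact K" "\<And>x. x \<notin> K \<Longrightarrow> f x = 0"
    and B: "\<And>x. norm (grad f x) \<le> B"
  shows "integrable lborel (\<lambda>x. grad f x \<bullet> v)" "(LINT x|lborel. grad f x \<bullet> v) = 0"
proof -
  note [measurable] = C1_measurable[OF f]
  obtain R where "\<And>x. x \<in> K \<Longrightarrow> norm x \<le> R" using compact_imp_bounded[OF K(1)] bounded_iff by metis
  then have R: "K \<subseteq> cball 0 R" by auto
  have B0: "0 \<le> B" using norm_ge_zero B order_trans by blast
  define h where "h k = 1 / real (Suc k)" for k
  have h: "0 < h k" "h k \<le> 1" for k by (auto simp: h_def)
  have h0: "h \<longlonglongrightarrow> 0" unfolding h_def[abs_def] by (rule LIMSEQ_Suc[OF lim_1_over_n])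
  define D where "D k x = (f (x + h k *\<^sub>R v) - f x) / h k" for k x
  let ?w = "\<lambda>x. (B * norm v) * indicator (cball 0 (R + norm v)) x :: real"
  have w: "integrable lborel ?w"
    by (rule integrable_mult_right, rule integrable_real_indicator) (simp_all add: emeasure_lborel_cball_finite[unfolded infinity_ennreal_def])
  have intf: "integrable lborel f"
  proof -
    have "continuous_on K f" using C1_continuous[OF f] continuous_on_subset by blast
    from borel_integrable_compact[OF K(1) this] show ?thesis
      by (rule Bochner_Integration.integrable_cong[THEN iffD1, rotated -1]) (use K(2) in \<open>auto simp: indicator_def\<close>)
  qed
  have tr: "integrable lborel (\<lambda>x. f (x + c))" "(LINT x|lborel. f (x + c)) = (LINT x|lborel. f x)" for c
    using lborel_distr_plus[of c] intf integrable_distr_eq[of "(+) c" lborel borel f] integral_distr[of "(+) c" lborel borel f]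
    by (auto simp: add.commute)
  have bound: "\<bar>D k x\<bar> \<le> ?w x" for k x
  proof (cases "x \<in> cball 0 (R + norm v)")
    case True
    obtain z where "f (x + h k *\<^sub>R v) - f (x + 0 *\<^sub>R v) = (h k - 0) * (grad f (x + z *\<^sub>R v) \<bullet> v)"
      using MVT2[of 0 "h k" "\<lambda>t. f (x + t *\<^sub>R v)" "\<lambda>t. grad f (x + t *\<^sub>R v) \<bullet> v"] h(1) C1_line[OF f] by blast
    then have "D k x = grad f (x + z *\<^sub>R v) \<bullet> v" using h(1)[of k] by (simp add: D_def)
    also have "\<bar>\<dots>\<bar> \<le> norm (grad f (x + z *\<^sub>R v)) * norm v" by (rule Cauchy_Schwarz_ineq2)
    also have "\<dots> \<le> B * norm v" by (intro mult_right_mono B) simp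
    finally show ?thesis using True by simp
  next
    case False
    have n: "norm (h k *\<^sub>R v) \<le> norm v" using h[of k] by (simp add: mult_left_le_one_le)
    have "norm x \<le> norm (x + h k *\<^sub>R v) + norm (h k *\<^sub>R v)"
      using norm_triangle_ineq4[of "x + h k *\<^sub>R v" "h k *\<^sub>R v"] by simp
    then have "x \<notin> cball 0 R" "x + h k *\<^sub>R v \<notin> cball 0 R"
      using False n norm_ge_zero[of v] unfolding mem_cball_0 by linarith+
    then have "f x = 0" "f (x + h k *\<^sub>R v) = 0" using R K(2) by blast+
    then show ?thesis using B0 by (simp add: D_def)
  qed
  have lim: "(\<lambda>k. D k x) \<longlonglongrightarrow> grad f x \<bullet> v" for x
  proof -
    have "((\<lambda>t. (f (x + t *\<^sub>R v) - f x) / t) \<longlongrightarrow> grad f x \<bullet> v) (at 0)"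
      using C1_line[OF f, of x v 0] by (simp add: has_field_derivative_iff)
    moreover have "filterlim h (at 0) sequentially"
      using h h0 by (auto simp: filterlim_at intro!: always_eventually) (metis less_irrefl)
    ultimately show ?thesis unfolding D_def[abs_def] by (rule filterlim_compose)
  qed
  have "has_bochner_integral lborel (\<lambda>x. grad f x \<bullet> v) (LINT x|lborel. grad f x \<bullet> v)
     \<and> (\<lambda>k. LINT x|lborel. D k x) \<longlonglongrightarrow> (LINT x|lborel. grad f x \<bullet> v)"
  proof (intro conjI)
    have m: "D k \<in> borel_measurable lborel" for k unfolding D_def[abs_def] by measurable
    show "(\<lambda>k. LINT x|lborel. D k x) \<longlonglongrightarrow> (LINT x|lborel. grad f x \<bullet> v)"
      by (rule integral_dominated_convergence[OF _ m w]) (use lim bound in \<open>auto simp: abs_mult\<close>)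
    show "has_bochner_integral lborel (\<lambda>x. grad f x \<bullet> v) (LINT x|lborel. grad f x \<bullet> v)"
      using integrable_dominated_convergence[where s = D, OF _ m w, of "\<lambda>x. grad f x \<bullet> v"] lim bound
      by (simp add: has_bochner_integral_iff)
  qed
  moreover have "(LINT x|lborel. D k x) = 0" for k
    unfolding D_def using tr intf by (subst Bochner_Integration.integral_divide_zero) simp
  ultimately show "integrable lborel (\<lambda>x. grad f x \<bullet> v)" "(LINT x|lborel. grad f x \<bullet> v) = 0"
    by (auto simp: LIMSEQ_const_iff has_bochner_integral_iff)
qed

lemma lebesgue_on_eq_lborel:
  fixes f :: "'a::euclidean_space \<Rightarrow> 'b::euclidean_space"
  assumes "\<Omega> \<in> sets lebesgue" "\<And>x. x \<notin> \<Omega> \<Longrightarrow> f x = 0" "f \<in> borel_measurable borel"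
  shows "(LINT x|lebesgue_on \<Omega>. f x) = (LINT x|lborel. f x)"
proof -
  have "(\<lambda>x. if x \<in> \<Omega> then f x else 0) = f" using assms(2) by auto
  with Lebesgue_Measure.integral_restrict_UNIV[OF assms(1), of f] integral_completion[of f lborel] assms(3)
  show ?thesis by simp
qed

locale bounded_domain =
  fixes \<Omega> :: "(real^'n) set"
  assumes open_dom: "open \<Omega>" and bounded_dom: "bounded \<Omega>" and connected_dom: "connected \<Omega>"
    and nonempty_dom: "\<Omega> \<noteq> {}"
begin

abbreviation M :: "(real^'n) measure" where "M \<equiv> lebesgue_on \<Omega>"

lemma dom_sets [simp]: "\<Omega> \<in> sets lebesgue"
  by (intro sets_completionI_sets) (simp add: open_dom borel_open)

lemma finite_M: "finite_measure M"
  by (rule finite_measure_lebesgue_on[OF lmeasurable_open[OF bounded_dom open_dom]])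

sublocale M: finite_measure M by (rule finite_M)

lemma L2_iff: "f \<in> L2 \<Omega> \<longleftrightarrow> sqint M f"
  by (simp add: L2_def sqint_def)

lemma borel_measurable_M: "f \<in> borel_measurable borel \<Longrightarrow> f \<in> borel_measurable M"
  by (rule measurable_restrict_space1, rule measurable_completion) simp

lemma C1_measurable_M:
  "C1 u \<Longrightarrow> u \<in> borel_measurable M" "C1 u \<Longrightarrow> grad u \<in> borel_measurable M"
  by (rule borel_measurable_M, erule C1_measurable)+

lemma test_sqint:
  assumes "\<phi> \<in> test_functions \<Omega>"
  shows "sqint M \<phi>" "sqint M (grad \<phi>)"
proof -
  obtain B where "\<And>x. \<bar>\<phi> x\<bar> \<le> B" "\<And>x. norm (grad \<phi> x) \<le> B" using test_bounded[OF assms] by metis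
  then show "sqint M \<phi>" "sqint M (grad \<phi>)"
    using C1_measurable_M[OF test_C1[OF assms]] by (simp_all add: M.sqint_bounded[of _ B])
qed

lemma sqint_integrable_M: 
  assumes "sqint M f" shows "integrable M f"
proof -
  have "sqint M (\<lambda>x. 1::real)" by (rule M.sqint_bounded[of _ 1]) auto
  from sqint_mult_integrable[OF sqint_norm[OF assms] this] show ?thesis
    by (simp add: integrable_norm_iff[OF sqint_measurable[OF assms]])
qed

text \<open>Integration by parts: the gradient of \<open>\<phi> \<psi>\<close> has integral \<open>0\<close>.\<close>

lemma test_weak_gradient:
  assumes \<phi>: "\<phi> \<in> test_functions \<Omega>" shows "is_weak_gradient \<Omega> \<phi> (grad \<phi>)"
  unfolding is_weak_gradient_def
proof
  fix \<psi> assume \<psi>: "\<psi> \<in> test_functions \<Omega>"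
  note C = test_C1[OF \<phi>] test_C1[OF \<psi>]
  note [measurable] = C1_measurable[OF C(1)] C1_measurable[OF C(2)]
  have \<phi>\<psi>: "(\<lambda>x. \<phi> x * \<psi> x) \<in> test_functions \<Omega>"
    using test_mult[OF \<phi>, of \<psi>] \<psi> by (simp add: test_functions_def)
  obtain K where K: "compact K" "K \<subseteq> \<Omega>" "\<And>x. x \<notin> K \<Longrightarrow> \<phi> x * \<psi> x = 0"
    using test_functionsE[OF \<phi>\<psi>] by metis
  obtain B where B: "\<And>x. norm (grad (\<lambda>x. \<phi> x * \<psi> x) x) \<le> B" using test_bounded[OF \<phi>\<psi>] by metis
  obtain b where b: "\<And>x. \<bar>\<phi> x\<bar> \<le> b" using test_bounded[OF \<phi>] by metis
  obtain c where c: "\<And>x. \<bar>\<psi> x\<bar> \<le> c" using test_bounded[OF \<psi>] by metis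
  obtain K1 where K1: "K1 \<subseteq> \<Omega>" "\<And>x. x \<notin> K1 \<Longrightarrow> \<phi> x = 0" "\<And>x. x \<notin> K1 \<Longrightarrow> grad \<phi> x = 0"
    using test_grad_support[OF \<phi>] by metis
  have C12: "C1 (\<lambda>x. \<phi> x * \<psi> x)" by (rule test_C1[OF \<phi>\<psi>])
  have i1: "integrable M (\<lambda>x. \<phi> x *\<^sub>R grad \<psi> x)" "integrable M (\<lambda>x. \<psi> x *\<^sub>R grad \<phi> x)"
  proof -
    have "sqint M (\<lambda>x. \<phi> x *\<^sub>R grad \<psi> x)"
      by (rule sqint_bounded_mult[OF test_sqint(2)[OF \<psi>], of _ b]) (use b C1_measurable_M C in auto)
    moreover have "sqint M (\<lambda>x. \<psi> x *\<^sub>R grad \<phi> x)"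
      by (rule sqint_bounded_mult[OF test_sqint(2)[OF \<phi>], of _ c]) (use c C1_measurable_M C in auto)
    ultimately show "integrable M (\<lambda>x. \<phi> x *\<^sub>R grad \<psi> x)" "integrable M (\<lambda>x. \<psi> x *\<^sub>R grad \<phi> x)"
      by (simp_all only: sqint_integrable_M)
  qed
  have "(LINT x|M. \<phi> x *\<^sub>R grad \<psi> x + \<psi> x *\<^sub>R grad \<phi> x) = 0"
  proof -
    have g: "grad (\<lambda>x. \<phi> x * \<psi> x) x = \<phi> x *\<^sub>R grad \<psi> x + \<psi> x *\<^sub>R grad \<phi> x" for x
      by (rule grad_mult[OF C])
    have "(LINT x|M. (\<phi> x *\<^sub>R grad \<psi> x + \<psi> x *\<^sub>R grad \<phi> x) \<bullet> v) = 0" for v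
    proof -
      have "(LINT x|M. (\<phi> x *\<^sub>R grad \<psi> x + \<psi> x *\<^sub>R grad \<phi> x) \<bullet> v)
          = (LINT x|lborel. grad (\<lambda>x. \<phi> x * \<psi> x) x \<bullet> v)"
        unfolding g
      proof (rule lebesgue_on_eq_lborel[OF dom_sets])
        show "(\<phi> x *\<^sub>R grad \<psi> x + \<psi> x *\<^sub>R grad \<phi> x) \<bullet> v = 0" if "x \<notin> \<Omega>" for x
        proof -
          have "x \<notin> K1" using that K1(1) by blast
          then show ?thesis by (simp add: K1)
        qed
      qed measurable
      also have "\<dots> = 0" by (rule integral_grad_compact_support(2)[OF C12 K(1,3) B])
      finally show ?thesis .
    qed
    then have "(LINT x|M. \<phi> x *\<^sub>R grad \<psi> x + \<psi> x *\<^sub>R grad \<phi> x) \<bullet> v = 0" for v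
      using i1 by (subst integral_inner_left[symmetric]) auto
    then show ?thesis using inner_eq_zero_iff by blast
  qed
  then show "(LINT x|M. \<phi> x *\<^sub>R grad \<psi> x) = - (LINT x|M. \<psi> x *\<^sub>R grad \<phi> x)"
    using i1 by (simp add: eq_neg_iff_add_eq_0)
qed

lemma indicator_scaleR_limit:
  fixes g :: "real^'n \<Rightarrow> real^'n"
  assumes "integrable M g" "\<And>k. w k \<in> borel_measurable M" "\<And>k x. \<bar>w k x\<bar> \<le> (1::real)"
    "\<And>x. x \<in> \<Omega> \<Longrightarrow> (\<lambda>k. w k x) \<longlonglongrightarrow> w' x" "\<And>k. (LINT x|M. w k x *\<^sub>R g x) = 0"
    "w' \<in> borel_measurable M"
  shows "(LINT x|M. w' x *\<^sub>R g x) = 0"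
proof -
  note [measurable] = assms(2,6) borel_measurable_integrable[OF assms(1)]
  have "(\<lambda>k. LINT x|M. w k x *\<^sub>R g x) \<longlonglongrightarrow> (LINT x|M. w' x *\<^sub>R g x)"
  proof (rule integral_dominated_convergence[where w = "\<lambda>x. norm (g x)"])
    show "AE x in M. (\<lambda>k. w k x *\<^sub>R g x) \<longlonglongrightarrow> w' x *\<^sub>R g x"
      using assms(4) by (intro AE_I2) (auto intro!: tendsto_intros)
    show "AE x in M. norm (w k x *\<^sub>R g x) \<le> norm (g x)" for k
      using assms(3)[of k] by (auto intro!: mult_left_le_one_le)
  qed (use assms(1) in auto)
  then show ?thesis using assms(5) by (simp add: LIMSEQ_const_iff)
qed

text \<open>The fundamental lemma of the calculus of variations. A finite union of balls is the set where
  the sum \<open>s\<close> of their bump functions is positive, and \<open>s / (s + 1 / k)\<close> are test functions that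
  converge to its indicator; open sets, \<open>G\<^sub>\<delta>\<close> sets and measurable sets follow in turn.\<close>

lemma fundamental_lemma:
  fixes g :: "real^'n \<Rightarrow> real^'n"
  assumes g: "integrable M g" and z: "\<And>\<phi>. \<phi> \<in> test_functions \<Omega> \<Longrightarrow> (LINT x|M. \<phi> x *\<^sub>R g x) = 0"
  shows "AE x in M. g x = 0"
proof -
  have balls: "(LINT x|M. indicator (\<Union>i<n::nat. ball (p i) (r i)) x *\<^sub>R g x) = 0"
    if r: "\<And>i. 0 < r i" "\<And>i. cball (p i) (r i) \<subseteq> \<Omega>" for p :: "nat \<Rightarrow> real^'n" and r n
  proof -
    define s where "s x = (\<Sum>i<n. bump (p i) (r i) x)" for x
    have s0: "0 \<le> s x" for x unfolding s_def by (intro sum_nonneg bump_nonneg)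
    have sp: "s x = 0 \<longleftrightarrow> x \<notin> (\<Union>i<n. ball (p i) (r i))" for x
    proof -
      have "bump (p i) (r i) x = 0 \<longleftrightarrow> x \<notin> ball (p i) (r i)" for i
        using bump_pos_iff[OF r(1)[of i], of "p i" x] bump_nonneg[of "p i" "r i" x] by linarith
      then show ?thesis
        unfolding s_def by (subst sum_nonneg_eq_0_iff) (simp_all add: bump_nonneg)
    qed
    have smooth: "smooth s" unfolding s_def[abs_def] by (intro allI Ck_sum smooth_bump[rule_format] finite_lessThan)
    have st: "s \<in> test_functions \<Omega>"
    proof (rule test_functionsI[OF smooth, of "\<Union>i<n. cball (p i) (r i)"])
      show "s x = 0" if "x \<notin> (\<Union>i<n. cball (p i) (r i))" for x
        unfolding sp using that by (force intro: less_imp_le)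
      show "compact (\<Union>i<n. cball (p i) (r i))" by (intro compact_UN finite_lessThan compact_cball)
      show "(\<Union>i<n. cball (p i) (r i)) \<subseteq> \<Omega>" by (intro UN_least r(2))
    qed
    define w where "w k x = s x * inverse (s x + 1 / real (Suc k))" for k x
    have pos: "0 < s x + 1 / real (Suc k)" for k x by (intro add_nonneg_pos s0) simp
    have wt: "w k \<in> test_functions \<Omega>" for k
      unfolding w_def[abs_def]
    proof (rule test_mult[OF st], intro allI Ck_inverse Ck_add Ck_const)
      show "Ck j s" for j using smooth by blast
      show "s x + 1 / real (Suc k) \<noteq> 0" for x using pos[of x k] by linarith
    qed
    have mU: "(\<lambda>x. indicator (\<Union>i<n. ball (p i) (r i)) x :: real) \<in> borel_measurable M"
      by (intro borel_measurable_M borel_measurable_indicator) (auto intro!: borel_open)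
    show ?thesis
    proof (rule indicator_scaleR_limit[OF g, of w])
      show "w k \<in> borel_measurable M" for k by (rule C1_measurable_M[OF test_C1[OF wt]])
      show "\<bar>w k x\<bar> \<le> 1" for k x using s0[of x] pos[of x k] by (simp add: w_def field_simps)
      show "(\<lambda>k. w k x) \<longlonglongrightarrow> indicator (\<Union>i<n. ball (p i) (r i)) x" for x
      proof (cases "s x = 0")
        case True then show ?thesis using sp[of x] by (simp add: w_def)
      next
        case False
        have "(\<lambda>k. s x * inverse (s x + 1 / real (Suc k))) \<longlonglongrightarrow> s x * inverse (s x + 0)"
          using False by (intro tendsto_intros LIMSEQ_Suc[OF lim_1_over_n]) simp
        then show ?thesis using False sp[of x] by (simp add: w_def[abs_def])
      qed
    qed (use z wt mU in auto)
  qed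
  have open_int: "(LINT x|M. indicator U x *\<^sub>R g x) = 0" if U: "open U" "U \<subseteq> \<Omega>" for U
  proof (cases "U = {}")
    case False
    define F where "F = {B. \<exists>p r. 0 < r \<and> cball p r \<subseteq> U \<and> B = ball p r}"
    obtain F' where F': "F' \<subseteq> F" "countable F'" "\<Union>F' = \<Union>F"
      using Lindelof[of F] by (auto simp: F_def)
    have UF: "\<Union>F = U"
    proof
      show "U \<subseteq> \<Union>F"
      proof
        fix x assume "x \<in> U"
        then obtain e where "0 < e" "cball x e \<subseteq> U" using U(1) open_contains_cball by blast
        then show "x \<in> \<Union>F" by (auto simp: F_def intro!: exI[of _ "ball x e"])
      qed
      show "\<Union>F \<subseteq> U" using ball_subset_cball by (force simp: F_def)
    qed
    have "F' \<noteq> {}" using F' UF False by auto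
    define b where "b = from_nat_into F'"
    have rb: "range b = F'" using F'(2) \<open>F' \<noteq> {}\<close> by (simp add: b_def)
    then have "b i \<in> F" for i using F'(1) by auto
    then have "\<forall>i. \<exists>p r. 0 < r \<and> cball p r \<subseteq> U \<and> b i = ball p r" by (simp add: F_def)
    then obtain p r where pr: "\<And>i. 0 < r i" "\<And>i. cball (p i) (r i) \<subseteq> U" "\<And>i. b i = ball (p i) (r i)"
      by metis
    have Ub: "U = (\<Union>i. ball (p i) (r i))" using rb F'(3) UF pr(3) by auto
    show ?thesis
    proof (rule indicator_scaleR_limit[OF g, of "\<lambda>n. indicator (\<Union>i<n. ball (p i) (r i))"])
      show "(\<lambda>n. indicator (\<Union>i<n. ball (p i) (r i)) x :: real) \<longlonglongrightarrow> indicator U x" for x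
        unfolding Ub by (rule LIMSEQ_indicator_UN)
      show "(LINT x|M. indicator (\<Union>i<k. ball (p i) (r i)) x *\<^sub>R g x) = 0" for k
        using pr(2) U(2) by (intro balls pr(1)) (rule order_trans)
      show "indicator (\<Union>i<k. ball (p i) (r i)) \<in> borel_measurable M" for k
        by (intro borel_measurable_M borel_measurable_indicator borel_open) auto
      show "(\<lambda>x. indicator U x :: real) \<in> borel_measurable M"
        by (intro borel_measurable_M borel_measurable_indicator borel_open U)
    qed (simp add: indicator_def)
  qed simp
  have "(LINT x|M. indicator A x *\<^sub>R g x) = 0" if "A \<in> sets M" for A
  proof -
    have A: "A \<in> sets lebesgue" "A \<subseteq> \<Omega>" using that by (auto simp: sets_restrict_space_iff)
    obtain C T where C: "gdelta C" "T \<in> null_sets lebesgue" "A \<union> T = C" "disjnt A T"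
      using lebesgue_set_almost_gdelta[OF A(1)] by metis
    obtain G :: "nat \<Rightarrow> _" where G: "\<And>n. open (G n)" "C = \<Inter>(G ` UNIV)" using C(1) by (auto simp: gdelta.simps)
    have CM: "C \<in> sets lebesgue" using G by (auto intro!: borel_open)
    have "(LINT x|M. indicator C x *\<^sub>R g x) = 0"
    proof (rule indicator_scaleR_limit[OF g, of "\<lambda>n. indicator (\<Omega> \<inter> (\<Inter>i<n. G i))"])
      show "(\<lambda>n. indicator (\<Omega> \<inter> (\<Inter>i<n. G i)) x :: real) \<longlonglongrightarrow> indicator C x" if "x \<in> \<Omega>" for x
      proof -
        have "(\<lambda>n. indicator (\<Inter>i<n. G i) x :: real) \<longlonglongrightarrow> indicator (\<Inter>i. G i) x"
          by (rule LIMSEQ_indicator_INT)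
        then show ?thesis using that G(2) by (simp add: indicator_inter_arith)
      qed
      have op: "open (\<Omega> \<inter> (\<Inter>i<k. G i))" for k using G open_dom by auto
      show "(LINT x|M. indicator (\<Omega> \<inter> (\<Inter>i<k. G i)) x *\<^sub>R g x) = 0" for k
        by (rule open_int[OF op]) auto
      show "indicator (\<Omega> \<inter> (\<Inter>i<k. G i)) \<in> borel_measurable M" for k
        by (intro borel_measurable_M borel_measurable_indicator) (use op in \<open>auto intro: borel_open\<close>)
      show "(\<lambda>x. indicator C x :: real) \<in> borel_measurable M"
        by (rule measurable_restrict_space1) (use CM in auto)
    qed (auto simp: indicator_def)
    moreover have "(LINT x|M. indicator A x *\<^sub>R g x) = (LINT x|M. indicator C x *\<^sub>R g x)"
    proof (rule integral_cong_AE)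
      have "AE x in lebesgue. x \<notin> T" using C(2) by (rule AE_not_in)
      then have "AE x in M. x \<notin> T" by (auto simp: AE_restrict_space_iff)
      then show "AE x in M. indicat_real A x *\<^sub>R g x = indicat_real C x *\<^sub>R g x"
        by eventually_elim (use C(3) in \<open>auto simp: indicator_def\<close>)
      have "indicat_real A \<in> borel_measurable M" "indicat_real C \<in> borel_measurable M"
        by (rule measurable_restrict_space1, use CM A in simp)+
      with g show "(\<lambda>x. indicat_real A x *\<^sub>R g x) \<in> borel_measurable M" "(\<lambda>x. indicat_real C x *\<^sub>R g x) \<in> borel_measurable M"
        by auto
    qed
    ultimately show ?thesis by simp
  qed
  then show ?thesis
    by (intro M.density_zero g) (simp add: set_lebesgue_integral_def)
qed

lemma test_scale_integrable:
  assumes "\<phi> \<in> test_functions \<Omega>"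
  shows "sqint M g \<Longrightarrow> integrable M (\<lambda>x. \<phi> x *\<^sub>R g x)" "sqint M y \<Longrightarrow> integrable M (\<lambda>x. y x *\<^sub>R grad \<phi> x)"
proof -
  obtain B where B: "\<And>x. \<bar>\<phi> x\<bar> \<le> B" "\<And>x. norm (grad \<phi> x) \<le> B" and B0: "0 \<le> B" using test_bounded[OF assms] by metis
  note m = C1_measurable_M[OF test_C1[OF assms]]
  show "integrable M (\<lambda>x. \<phi> x *\<^sub>R g x)" if "sqint M g"
    by (rule sqint_integrable_M[OF sqint_bounded_mult[OF that m(1), of B]]) (simp add: B)
  show "integrable M (\<lambda>x. y x *\<^sub>R grad \<phi> x)" if "sqint M y"
  proof (rule sqint_integrable_M[OF sqint_dominated[OF sqint_scale[OF that, of B]]])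
    show "(\<lambda>x. y x *\<^sub>R grad \<phi> x) \<in> borel_measurable M"
      by (intro borel_measurable_scaleR m sqint_measurable[OF that])
    have "\<bar>y x\<bar> * norm (grad \<phi> x) \<le> B * \<bar>y x\<bar>" for x
      using mult_left_mono[OF B(2) abs_ge_zero, of "y x" x] by (simp only: mult.commute)
    then show "AE x in M. norm (y x *\<^sub>R grad \<phi> x) \<le> norm (B *\<^sub>R y x)"
      using B0 by (intro AE_I2) (simp add: abs_mult)
  qed
qed

lemma weak_gradient_diff:
  assumes "is_weak_gradient \<Omega> y g" "is_weak_gradient \<Omega> y' g'" "sqint M y" "sqint M y'" "sqint M g" "sqint M g'"
  shows "is_weak_gradient \<Omega> (\<lambda>x. y x - y' x) (\<lambda>x. g x - g' x)"
  unfolding is_weak_gradient_def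
proof
  fix \<phi> assume p: "\<phi> \<in> test_functions \<Omega>"
  note i = test_scale_integrable[OF p]
  have "(LINT x|M. (y x - y' x) *\<^sub>R grad \<phi> x) = (LINT x|M. y x *\<^sub>R grad \<phi> x) - (LINT x|M. y' x *\<^sub>R grad \<phi> x)"
    unfolding scaleR_diff_left by (intro Bochner_Integration.integral_diff i assms)
  moreover have "(LINT x|M. \<phi> x *\<^sub>R (g x - g' x)) = (LINT x|M. \<phi> x *\<^sub>R g x) - (LINT x|M. \<phi> x *\<^sub>R g' x)"
    unfolding scaleR_diff_right by (intro Bochner_Integration.integral_diff i assms)
  ultimately show "(LINT x|M. (y x - y' x) *\<^sub>R grad \<phi> x) = - (LINT x|M. \<phi> x *\<^sub>R (g x - g' x))"
    using assms(1,2) p by (simp add: is_weak_gradient_def)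
qed

text \<open>This makes the choice in \<open>weak_grad\<close> immaterial up to null sets.\<close>

lemma weak_gradient_unique:
  assumes "is_weak_gradient \<Omega> y g" "is_weak_gradient \<Omega> y g'" "sqint M y" "sqint M g" "sqint M g'"
  shows "AE x in M. g x = g' x"
proof -
  have "AE x in M. g x - g' x = 0"
  proof (rule fundamental_lemma)
    show "integrable M (\<lambda>x. g x - g' x)" using assms by (auto intro: sqint_integrable_M)
    show "(LINT x|M. \<phi> x *\<^sub>R (g x - g' x)) = 0" if "\<phi> \<in> test_functions \<Omega>" for \<phi>
      using weak_gradient_diff[OF assms(1,2,3,3,4,5)] that by (simp add: is_weak_gradient_def)
  qed
  then show ?thesis by simp
qed

end


section \<open>The space \<open>W\<^sub>0\<^sup>1\<^sup>,\<^sup>2\<close> and the chain rule\<close>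


lemma sqlim_close:
  assumes "sqlim M f g" "\<And>k. sqint M (f' k)" "\<And>k. (LINT x|M. (norm (f' k x - f k x))\<^sup>2) \<le> e k" "e \<longlonglongrightarrow> 0"
  shows "sqlim M f' g"
proof -
  have "sqlim M (\<lambda>k x. f' k x - f k x) (\<lambda>x. 0)"
    by (rule sqlimI_le[OF _ _ _ assms(4)]) (use assms sqlimD[OF assms(1)] in \<open>auto intro: sqint_diff sqint_zero\<close>)
  from sqlim_add[OF this assms(1)] show ?thesis by simp
qed

lemma sqrt_regularisation:
  fixes e s :: real assumes "0 < e"
  shows "((\<lambda>s. sqrt (s\<^sup>2 + e\<^sup>2)) has_real_derivative s / sqrt (s\<^sup>2 + e\<^sup>2)) (at s)"
    "\<bar>s / sqrt (s\<^sup>2 + e\<^sup>2)\<bar> \<le> 1" "continuous_on UNIV (\<lambda>s. s / sqrt (s\<^sup>2 + e\<^sup>2))" "0 < sqrt (s\<^sup>2 + e\<^sup>2)" 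
    "\<bar>s\<bar> \<le> sqrt (s\<^sup>2 + e\<^sup>2)"
proof -
  have p: "0 < t\<^sup>2 + e\<^sup>2" for t :: real using assms by (simp add: add_nonneg_pos)
  show "((\<lambda>s. sqrt (s\<^sup>2 + e\<^sup>2)) has_real_derivative s / sqrt (s\<^sup>2 + e\<^sup>2)) (at s)"
    using p[of s] by (auto intro!: derivative_eq_intros simp: field_simps)
  show q: "0 < sqrt (s\<^sup>2 + e\<^sup>2)" using p[of s] by simp
  have "sqrt (s\<^sup>2) \<le> sqrt (s\<^sup>2 + e\<^sup>2)" by (rule real_sqrt_le_mono) simp
  then show a: "\<bar>s\<bar> \<le> sqrt (s\<^sup>2 + e\<^sup>2)" by simp
  with q show "\<bar>s / sqrt (s\<^sup>2 + e\<^sup>2)\<bar> \<le> 1" by (simp add: abs_divide)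
  show "continuous_on UNIV (\<lambda>s. s / sqrt (s\<^sup>2 + e\<^sup>2))"
    using assms by (intro continuous_intros) (simp add: sum_power2_eq_zero_iff)
qed

context bounded_domain
begin

text \<open>A function of \<open>W\<^sub>0\<^sup>1\<^sup>,\<^sup>2\<close> paired with its weak gradient. One sequence of test functions approximates both at the same
  time, so that identities and inequalities for test functions carry over by passing to the limit, and linear combinations
  do not involve the choice hidden in \<open>weak_grad\<close>.\<close>

definition H0 :: "(real^'n \<Rightarrow> real) \<Rightarrow> (real^'n \<Rightarrow> real^'n) \<Rightarrow> bool" where
  "H0 y g \<longleftrightarrow> (\<exists>\<phi>. (\<forall>k. \<phi> k \<in> test_functions \<Omega>) \<and> sqlim M \<phi> y \<and> sqlim M (\<lambda>k. grad (\<phi> k)) g)"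

lemma H0I: "(\<And>k. \<phi> k \<in> test_functions \<Omega>) \<Longrightarrow> sqlim M \<phi> y \<Longrightarrow> sqlim M (\<lambda>k. grad (\<phi> k)) g \<Longrightarrow> H0 y g"
  unfolding H0_def by blast

lemma H0_AE_approx:
  assumes "H0 y g"
  shows "\<exists>\<phi>. (\<forall>k. \<phi> k \<in> test_functions \<Omega>) \<and> sqlim M \<phi> y \<and> sqlim M (\<lambda>k. grad (\<phi> k)) g \<and>
    (AE x in M. (\<lambda>k. \<phi> k x) \<longlonglongrightarrow> y x)"
proof -
  obtain \<phi> where \<phi>: "\<And>k. \<phi> k \<in> test_functions \<Omega>" "sqlim M \<phi> y" "sqlim M (\<lambda>k. grad (\<phi> k)) g"
    using assms unfolding H0_def by blast
  obtain r where r: "strict_mono r" "AE x in M. (\<lambda>k. \<phi> (r k) x) \<longlonglongrightarrow> y x"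
    using sqlim_AE_subseq[OF \<phi>(2)] by metis
  show ?thesis
    by (intro exI[of _ "\<lambda>k. \<phi> (r k)"] conjI allI) (rule \<phi> r sqlim_subseq[OF \<phi>(2) r(1)] sqlim_subseq[OF \<phi>(3) r(1)])+
qed

lemma H0_sqint: assumes "H0 y g" shows "sqint M y" "sqint M g"
  using assms unfolding H0_def by (auto dest: sqlimD)

lemma H0_test: "\<phi> \<in> test_functions \<Omega> \<Longrightarrow> H0 \<phi> (grad \<phi>)"
  by (rule H0I[of "\<lambda>k. \<phi>"]) (assumption, (rule sqlim_const, erule test_sqint)+)

lemma H0_AE_cong:
  assumes "H0 y g" "AE x in M. y x = y' x" "AE x in M. g x = g' x" "sqint M y'" "sqint M g'"
  shows "H0 y' g'"
proof -
  obtain \<phi> where \<phi>: "\<And>k. \<phi> k \<in> test_functions \<Omega>" "sqlim M \<phi> y" "sqlim M (\<lambda>k. grad (\<phi> k)) g"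
    using assms unfolding H0_def by blast
  show ?thesis
    by (rule H0I[OF \<phi>(1) sqlim_AE_cong[OF \<phi>(2) assms(2)] sqlim_AE_cong[OF \<phi>(3) assms(3)]])
      (use assms in \<open>auto dest: sqint_measurable\<close>)
qed

lemma H0_add: 
  assumes "H0 y g" "H0 y' g'" shows "H0 (\<lambda>x. y x + y' x) (\<lambda>x. g x + g' x)"
proof -
  obtain \<phi> where \<phi>: "\<And>k. \<phi> k \<in> test_functions \<Omega>" "sqlim M \<phi> y" "sqlim M (\<lambda>k. grad (\<phi> k)) g"
    using assms(1) unfolding H0_def by blast
  obtain \<psi> where \<psi>: "\<And>k. \<psi> k \<in> test_functions \<Omega>" "sqlim M \<psi> y'" "sqlim M (\<lambda>k. grad (\<psi> k)) g'"
    using assms(2) unfolding H0_def by blast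
  have "grad (\<lambda>x. \<phi> k x + \<psi> k x) = (\<lambda>x. grad (\<phi> k) x + grad (\<psi> k) x)" for k
    using grad_add[OF test_C1[OF \<phi>(1)] test_C1[OF \<psi>(1)]] by (rule ext)
  then show ?thesis
    using sqlim_add[OF \<phi>(2) \<psi>(2)] sqlim_add[OF \<phi>(3) \<psi>(3)] by (intro H0I[OF test_add[OF \<phi>(1) \<psi>(1)]]) auto
qed

lemma H0_scale:
  assumes "H0 y g" shows "H0 (\<lambda>x. c * y x) (\<lambda>x. c *\<^sub>R g x)"
proof -
  obtain \<phi> where \<phi>: "\<And>k. \<phi> k \<in> test_functions \<Omega>" "sqlim M \<phi> y" "sqlim M (\<lambda>k. grad (\<phi> k)) g"
    using assms unfolding H0_def by blast
  have "grad (\<lambda>x. c * \<phi> k x) = (\<lambda>x. c *\<^sub>R grad (\<phi> k) x)" for k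
    using grad_cmult[OF test_C1[OF \<phi>(1)]] by (rule ext)
  then show ?thesis
    using sqlim_scale[OF \<phi>(2), of c] sqlim_scale[OF \<phi>(3), of c] by (intro H0I[OF test_cmult[OF \<phi>(1)]]) auto
qed

lemma H0_approx:
  assumes "H0 y g" "0 < e"
  obtains \<phi> where "\<phi> \<in> test_functions \<Omega>" "(LINT x|M. (norm (\<phi> x - y x))\<^sup>2) < e" "(LINT x|M. (norm (grad \<phi> x - g x))\<^sup>2) < e"
proof -
  obtain \<phi> where \<phi>: "\<And>k. \<phi> k \<in> test_functions \<Omega>" "sqlim M \<phi> y" "sqlim M (\<lambda>k. grad (\<phi> k)) g"
    using assms unfolding H0_def by blast
  have "eventually (\<lambda>k. (LINT x|M. (norm (\<phi> k x - y x))\<^sup>2) < e \<and> (LINT x|M. (norm (grad (\<phi> k) x - g x))\<^sup>2) < e) sequentially"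
    using order_tendstoD(2)[OF sqlimD(3)[OF \<phi>(2)] assms(2)] order_tendstoD(2)[OF sqlimD(3)[OF \<phi>(3)] assms(2)]
    by (rule eventually_conj)
  then obtain k where "(LINT x|M. (norm (\<phi> k x - y x))\<^sup>2) < e \<and> (LINT x|M. (norm (grad (\<phi> k) x - g x))\<^sup>2) < e"
    using eventually_happens' sequentially_bot by blast
  with \<phi>(1) that show ?thesis by blast
qed

lemma H0_approx_sequence:
  fixes y :: "nat \<Rightarrow> real^'n \<Rightarrow> real"
  assumes H: "\<And>k. H0 (y k) (g k)"
  shows "\<exists>\<phi>. \<forall>k. \<phi> k \<in> test_functions \<Omega> \<and> (LINT x|M. (norm (\<phi> k x - y k x))\<^sup>2) < 1 / real (Suc k)
     \<and> (LINT x|M. (norm (grad (\<phi> k) x - g k x))\<^sup>2) < 1 / real (Suc k)"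
proof -
  define P where "P k \<phi> \<longleftrightarrow> \<phi> \<in> test_functions \<Omega> \<and> (LINT x|M. (norm (\<phi> x - y k x))\<^sup>2) < 1 / real (Suc k)
     \<and> (LINT x|M. (norm (grad \<phi> x - g k x))\<^sup>2) < 1 / real (Suc k)" for k :: nat and \<phi>
  have "\<exists>\<phi>. P k \<phi>" for k
  proof -
    have "0 < 1 / real (Suc k)" by simp
    then obtain \<phi> where "\<phi> \<in> test_functions \<Omega>" "(LINT x|M. (norm (\<phi> x - y k x))\<^sup>2) < 1 / real (Suc k)"
        "(LINT x|M. (norm (grad \<phi> x - g k x))\<^sup>2) < 1 / real (Suc k)"
      by (rule H0_approx[OF H[of k]])
    then have "P k \<phi>" unfolding P_def by blast
    then show ?thesis by blast
  qed
  then obtain \<phi> where "\<And>k. P k (\<phi> k)" by metis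
  then show ?thesis unfolding P_def by (intro exI[of _ \<phi>] allI)
qed

text \<open>Test functions approximating the \<open>k\<close>-th member up to \<open>1 / (k + 1)\<close> approximate the limit.\<close>

lemma H0_closed:
  fixes y :: "nat \<Rightarrow> real^'n \<Rightarrow> real"
  assumes H: "\<And>k. H0 (y k) (g k)" and y: "sqlim M y y'" and g: "sqlim M g g'"
  shows "H0 y' g'"
proof -
  obtain \<phi> where \<phi>: "\<And>k. \<phi> k \<in> test_functions \<Omega>" "\<And>k. (LINT x|M. (norm (\<phi> k x - y k x))\<^sup>2) < 1 / real (Suc k)"
     "\<And>k. (LINT x|M. (norm (grad (\<phi> k) x - g k x))\<^sup>2) < 1 / real (Suc k)"
    using H0_approx_sequence[of y g, OF H] by blast
  have l: "(\<lambda>k. 1 / real (Suc k)) \<longlonglongrightarrow> 0" by (rule LIMSEQ_Suc[OF lim_1_over_n])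
  show ?thesis
    by (rule H0I[OF \<phi>(1) sqlim_close[OF y test_sqint(1)[OF \<phi>(1)] less_imp_le[OF \<phi>(2)] l]
        sqlim_close[OF g test_sqint(2)[OF \<phi>(1)] less_imp_le[OF \<phi>(3)] l]])
qed

lemma H0_weak_gradient:
  assumes "H0 y g" shows "is_weak_gradient \<Omega> y g"
  unfolding is_weak_gradient_def
proof
  fix \<psi> assume \<psi>: "\<psi> \<in> test_functions \<Omega>"
  obtain \<phi> where \<phi>: "\<And>k. \<phi> k \<in> test_functions \<Omega>" "sqlim M \<phi> y" "sqlim M (\<lambda>k. grad (\<phi> k)) g"
    using assms unfolding H0_def by blast
  note i = test_scale_integrable[OF \<psi>]
  have "((LINT x|M. y x *\<^sub>R grad \<psi> x) + (LINT x|M. \<psi> x *\<^sub>R g x)) \<bullet> v = 0" for v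
  proof -
    have s1: "sqint M (\<lambda>x. grad \<psi> x \<bullet> v)"
    proof (rule sqint_dominated[OF sqint_scale[OF test_sqint(2)[OF \<psi>], of "norm v"]])
      show "(\<lambda>x. grad \<psi> x \<bullet> v) \<in> borel_measurable M"
        by (intro borel_measurable_inner C1_measurable_M test_C1[OF \<psi>]) simp
      show "AE x in M. norm (grad \<psi> x \<bullet> v) \<le> norm (norm v *\<^sub>R grad \<psi> x)"
        by (intro AE_I2) (simp add: mult.commute[of "norm v"] Cauchy_Schwarz_ineq2)
    qed
    have s2: "sqint M (\<lambda>x. \<psi> x *\<^sub>R v)"
      by (rule sqint_dominated[OF sqint_scale[OF test_sqint(1)[OF \<psi>], of "norm v"]])
        (auto intro!: borel_measurable_scaleR C1_measurable_M test_C1[OF \<psi>] simp: mult.commute)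
    have sum: "((LINT x|M. z x *\<^sub>R grad \<psi> x) + (LINT x|M. \<psi> x *\<^sub>R h x)) \<bullet> v
        = (LINT x|M. z x \<bullet> (grad \<psi> x \<bullet> v)) + (LINT x|M. h x \<bullet> (\<psi> x *\<^sub>R v))"
      if "sqint M z" "sqint M h" for z h
      using i(2)[OF that(1)] i(1)[OF that(2)] by (simp add: inner_add_left integral_inner_left[symmetric])
    have "(\<lambda>k. (LINT x|M. \<phi> k x \<bullet> (grad \<psi> x \<bullet> v)) + (LINT x|M. grad (\<phi> k) x \<bullet> (\<psi> x *\<^sub>R v)))
        \<longlonglongrightarrow> (LINT x|M. y x \<bullet> (grad \<psi> x \<bullet> v)) + (LINT x|M. g x \<bullet> (\<psi> x *\<^sub>R v))"
      by (intro tendsto_add sqlim_inner \<phi> sqlim_const s1 s2)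
    moreover have "(LINT x|M. \<phi> k x \<bullet> (grad \<psi> x \<bullet> v)) + (LINT x|M. grad (\<phi> k) x \<bullet> (\<psi> x *\<^sub>R v)) = 0" for k
      unfolding sum[OF test_sqint[OF \<phi>(1)], symmetric]
      using test_weak_gradient[OF \<phi>(1)[of k]] \<psi> by (simp add: is_weak_gradient_def)
    ultimately show ?thesis unfolding sum[OF H0_sqint[OF assms]] by (simp add: LIMSEQ_const_iff)
  qed
  then have "(LINT x|M. y x *\<^sub>R grad \<psi> x) + (LINT x|M. \<psi> x *\<^sub>R g x) = 0"
    using inner_eq_zero_iff by blast
  then show "(LINT x|M. y x *\<^sub>R grad \<psi> x) = - (LINT x|M. \<psi> x *\<^sub>R g x)" by (simp add: eq_neg_iff_add_eq_0)
qed

lemma H0_gradient_unique: "H0 y g \<Longrightarrow> H0 y g' \<Longrightarrow> AE x in M. g x = g' x"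
  by (rule weak_gradient_unique[OF H0_weak_gradient H0_weak_gradient]) (auto dest: H0_sqint)

lemma weak_grad_props:
  assumes "y \<in> W12 \<Omega>"
  shows "sqint M y" "sqint M (weak_grad \<Omega> y)" "is_weak_gradient \<Omega> y (weak_grad \<Omega> y)"
proof -
  show "sqint M y" using assms by (simp add: W12_def L2_iff)
  have "\<exists>g. g \<in> L2 \<Omega> \<and> is_weak_gradient \<Omega> y g" using assms by (auto simp: W12_def)
  from someI_ex[OF this] have "weak_grad \<Omega> y \<in> L2 \<Omega> \<and> is_weak_gradient \<Omega> y (weak_grad \<Omega> y)"
    unfolding weak_grad_def .
  then show "sqint M (weak_grad \<Omega> y)" "is_weak_gradient \<Omega> y (weak_grad \<Omega> y)" by (simp_all add: L2_iff)
qed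

lemma weak_grad_AE:
  assumes "is_weak_gradient \<Omega> y g" "sqint M y" "sqint M g"
  shows "y \<in> W12 \<Omega>" "AE x in M. weak_grad \<Omega> y x = g x"
proof -
  show W: "y \<in> W12 \<Omega>" using assms by (auto simp: W12_def L2_iff)
  show "AE x in M. weak_grad \<Omega> y x = g x"
    by (rule weak_gradient_unique[OF weak_grad_props(3)[OF W] assms(1,2) weak_grad_props(2)[OF W] assms(3)])
qed

lemma W12_norm_sq:
  assumes "is_weak_gradient \<Omega> y g" "sqint M y" "sqint M g"
  shows "(W12_norm \<Omega> y)\<^sup>2 = (LINT x|M. (norm (y x))\<^sup>2) + (LINT x|M. (norm (g x))\<^sup>2)"
proof -
  have "(LINT x|M. (norm (weak_grad \<Omega> y x))\<^sup>2) = (LINT x|M. (norm (g x))\<^sup>2)"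
  proof (rule integral_cong_AE)
    show "AE x in M. (norm (weak_grad \<Omega> y x))\<^sup>2 = (norm (g x))\<^sup>2" using weak_grad_AE(2)[OF assms] by eventually_elim simp
  qed (use sqint_integrable[OF weak_grad_props(2)[OF weak_grad_AE(1)[OF assms]]] sqint_integrable[OF assms(3)] in auto)
  then show ?thesis by (simp add: W12_norm_def L2_norm_def integral_norm_sq_nonneg)
qed

lemma W12_0_imp_H0:
  assumes "y \<in> W12_0 \<Omega>" shows "H0 y (weak_grad \<Omega> y)"
proof -
  let ?g = "weak_grad \<Omega> y"
  have W: "y \<in> W12 \<Omega>" using assms by (simp add: W12_0_def)
  note wp = weak_grad_props[OF W]
  obtain \<phi> where \<phi>: "\<And>k. \<phi> k \<in> test_functions \<Omega>" "(\<lambda>k. W12_norm \<Omega> (\<lambda>x. \<phi> k x - y x)) \<longlonglongrightarrow> 0"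
    using assms unfolding W12_0_def by blast
  have s: "(W12_norm \<Omega> (\<lambda>x. \<phi> k x - y x))\<^sup>2 = (LINT x|M. (norm (\<phi> k x - y x))\<^sup>2) + (LINT x|M. (norm (grad (\<phi> k) x - ?g x))\<^sup>2)" for k
    by (rule W12_norm_sq[OF weak_gradient_diff[OF test_weak_gradient[OF \<phi>(1)] wp(3)]])
      (intro sqint_diff test_sqint[OF \<phi>(1)] wp)+
  have l: "(\<lambda>k. (W12_norm \<Omega> (\<lambda>x. \<phi> k x - y x))\<^sup>2) \<longlonglongrightarrow> 0"
    using tendsto_power[OF \<phi>(2), of 2] by simp
  show ?thesis
  proof (rule H0I[OF \<phi>(1)])
    show "sqlim M \<phi> y" by (rule sqlimI_le[OF test_sqint(1)[OF \<phi>(1)] wp(1) _ l]) (simp add: s)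
    show "sqlim M (\<lambda>k. grad (\<phi> k)) ?g" by (rule sqlimI_le[OF test_sqint(2)[OF \<phi>(1)] wp(2) _ l]) (simp add: s)
  qed
qed

lemma H0_imp_W12_0:
  assumes "H0 y g" shows "y \<in> W12_0 \<Omega>" "AE x in M. weak_grad \<Omega> y x = g x"
proof -
  note w = H0_weak_gradient[OF assms] H0_sqint[OF assms]
  show "AE x in M. weak_grad \<Omega> y x = g x" by (rule weak_grad_AE(2)[OF w])
  obtain \<phi> where \<phi>: "\<And>k. \<phi> k \<in> test_functions \<Omega>" "sqlim M \<phi> y" "sqlim M (\<lambda>k. grad (\<phi> k)) g"
    using assms unfolding H0_def by blast
  have s: "(W12_norm \<Omega> (\<lambda>x. \<phi> k x - y x))\<^sup>2 = (LINT x|M. (norm (\<phi> k x - y x))\<^sup>2) + (LINT x|M. (norm (grad (\<phi> k) x - g x))\<^sup>2)" for k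
    by (rule W12_norm_sq[OF weak_gradient_diff[OF test_weak_gradient[OF \<phi>(1)] w(1)]])
      (intro sqint_diff test_sqint[OF \<phi>(1)] w)+
  have "(\<lambda>k. (W12_norm \<Omega> (\<lambda>x. \<phi> k x - y x))\<^sup>2) \<longlonglongrightarrow> 0"
    unfolding s using tendsto_add[OF sqlimD(3)[OF \<phi>(2)] sqlimD(3)[OF \<phi>(3)]] by simp
  then have "(\<lambda>k. W12_norm \<Omega> (\<lambda>x. \<phi> k x - y x)) \<longlonglongrightarrow> 0" by (rule tendsto_zero_of_square)
  then show "y \<in> W12_0 \<Omega>" using weak_grad_AE(1)[OF w] \<phi>(1) by (auto simp: W12_0_def)
qed

text \<open>The chain rule for test functions passes to the limit by dominated convergence: \<open>F'\<close> is bounded, and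
  \<open>F' (\<phi> k)\<close> converges almost everywhere because \<open>F'\<close> is continuous.\<close>

lemma chain_rule_limit:
  assumes \<phi>: "\<And>k. \<phi> k \<in> test_functions \<Omega>" "sqlim M \<phi> y" "sqlim M (\<lambda>k. grad (\<phi> k)) g"
      "AE x in M. (\<lambda>k. \<phi> k x) \<longlonglongrightarrow> y x"
    and F: "\<And>t. (F has_real_derivative F' t) (at t)" "continuous_on UNIV F'" "\<And>t. \<bar>F' t\<bar> \<le> L"
  shows "sqlim M (\<lambda>k x. F (\<phi> k x)) (\<lambda>x. F (y x))"
    and "sqlim M (\<lambda>k. grad (\<lambda>x. F (\<phi> k x))) (\<lambda>x. F' (y x) *\<^sub>R g x)"
proof -
  have [measurable]: "F \<in> borel_measurable borel" "F' \<in> borel_measurable borel"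
    using F(2) by (auto intro!: borel_measurable_continuous_onI DERIV_continuous_on[of _ F F'] has_field_derivative_at_within F(1))
  note [measurable] = C1_measurable_M(1)[OF test_C1[OF \<phi>(1)]] sqint_measurable[OF sqlimD(2)[OF \<phi>(2)]]
  have lip: "\<bar>F s - F t\<bar> \<le> L * \<bar>s - t\<bar>" for s t
  proof -
    have "norm (F s - F t) \<le> L * norm (s - t)"
      by (rule field_differentiable_bound[of UNIV F F']) (use F in auto)
    then show ?thesis by simp
  qed
  have "sqint M (\<lambda>x. L * y x)" using sqint_scale[OF sqlimD(2)[OF \<phi>(2)], of L] by simp
  moreover have "sqint M (\<lambda>x. F 0)" by (rule M.sqint_bounded[of _ "\<bar>F 0\<bar>"]) auto
  ultimately have "sqint M (\<lambda>x. norm (F 0) + norm (L * y x))" by (intro sqint_add sqint_norm)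
  then have Fy: "sqint M (\<lambda>x. F (y x))"
  proof (rule sqint_dominated)
    have "\<bar>F (y x)\<bar> \<le> \<bar>F 0\<bar> + \<bar>L * y x\<bar>" for x
      using lip[of "y x" 0] F(3)[of 0] by (simp add: abs_mult)
    then show "AE x in M. norm (F (y x)) \<le> norm (norm (F 0) + norm (L * y x))" by (intro AE_I2) simp
  qed measurable
  show "sqlim M (\<lambda>k x. F (\<phi> k x)) (\<lambda>x. F (y x))"
    by (rule sqlim_dominated_diff[OF \<phi>(2) _ Fy, of _ L]) (simp_all add: lip)
  have "grad (\<lambda>x. F (\<phi> k x)) = (\<lambda>x. F' (\<phi> k x) *\<^sub>R grad (\<phi> k) x)" for k
    by (rule C1_compose(2)[OF test_C1[OF \<phi>(1)] F(1,2)])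
  moreover have "sqlim M (\<lambda>k x. F' (\<phi> k x) *\<^sub>R grad (\<phi> k) x) (\<lambda>x. F' (y x) *\<^sub>R g x)"
  proof (rule sqlim_bounded_mult_seq[OF \<phi>(3)])
    show "AE x in M. (\<lambda>k. F' (\<phi> k x)) \<longlonglongrightarrow> F' (y x)"
      using \<phi>(4)
    proof eventually_elim
      case (elim x)
      have "isCont F' (y x)" using F(2) by (simp add: continuous_on_eq_continuous_at)
      from isCont_tendsto_compose[OF this elim] show ?case .
    qed
    show "\<bar>F' (\<phi> k x)\<bar> \<le> L" for k x by (rule F(3))
  qed measurable
  ultimately show "sqlim M (\<lambda>k. grad (\<lambda>x. F (\<phi> k x))) (\<lambda>x. F' (y x) *\<^sub>R g x)" by simp
qed

text \<open>The smooth function \<open>s \<mapsto> sqrt (s\<^sup>2 + e\<^sup>2)\<close> and its derivative \<open>s / sqrt (s\<^sup>2 + e\<^sup>2)\<close> carry both the absolute value and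
  the test function of the positivity proof.\<close>

lemma H0_sqrt:
  assumes "H0 y g" "0 < e"
  shows "H0 (\<lambda>x. sqrt ((y x)\<^sup>2 + e\<^sup>2) - e) (\<lambda>x. (y x / sqrt ((y x)\<^sup>2 + e\<^sup>2)) *\<^sub>R g x)"
proof -
  obtain \<phi> where \<phi>: "\<And>k. \<phi> k \<in> test_functions \<Omega>" "sqlim M \<phi> y" "sqlim M (\<lambda>k. grad (\<phi> k)) g"
    "AE x in M. (\<lambda>k. \<phi> k x) \<longlonglongrightarrow> y x" using H0_AE_approx[OF assms(1)] by blast
  have d: "((\<lambda>s. sqrt (s\<^sup>2 + e\<^sup>2) - e) has_real_derivative s / sqrt (s\<^sup>2 + e\<^sup>2)) (at s)" for s
    using DERIV_diff[OF sqrt_regularisation(1)[OF assms(2)] DERIV_const] by simp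
  show ?thesis
    by (rule H0I[OF test_sqrt[OF \<phi>(1) assms(2)]
      chain_rule_limit[OF \<phi> d sqrt_regularisation(3)[OF assms(2)] sqrt_regularisation(2)[OF assms(2)]]])
qed

text \<open>As \<open>e \<rightarrow> 0\<close>, the functions \<open>sqrt (y\<^sup>2 + e\<^sup>2) - e\<close> tend to \<open>\<bar>y\<bar>\<close>, dominated by \<open>\<bar>y\<bar>\<close>, and their gradients to \<open>sgn y g\<close>,
  dominated by \<open>g\<close>.\<close>

lemma H0_abs:
  assumes "H0 y g" shows "H0 (\<lambda>x. \<bar>y x\<bar>) (\<lambda>x. sgn (y x) *\<^sub>R g x)"
proof -
  define e where "e k = 1 / real (Suc k)" for k
  have e: "0 < e k" for k by (simp add: e_def)
  have e0: "e \<longlonglongrightarrow> 0" unfolding e_def[abs_def] by (rule LIMSEQ_Suc[OF lim_1_over_n])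
  note [measurable] = H0_sqint[OF assms, THEN sqint_measurable]
  show ?thesis
  proof (rule H0_closed[OF H0_sqrt[OF assms e]])
    have b: "\<bar>sqrt (s\<^sup>2 + (e k)\<^sup>2) - e k\<bar> \<le> \<bar>s\<bar>" for s k
      using real_sqrt_sum_squares_triangle_ineq[of s 0 0 "e k"] real_sqrt_sum_squares_ge2[of "e k" s] e[of k] by simp
    show "sqlim M (\<lambda>k x. sqrt ((y x)\<^sup>2 + (e k)\<^sup>2) - e k) (\<lambda>x. \<bar>y x\<bar>)"
    proof (rule sqlim_dominated_convergence[OF _ _ H0_sqint(1)[OF assms]])
      show "AE x in M. (\<lambda>k. sqrt ((y x)\<^sup>2 + (e k)\<^sup>2) - e k) \<longlonglongrightarrow> \<bar>y x\<bar>"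
      proof (intro AE_I2)
        fix x
        have "(\<lambda>k. sqrt ((y x)\<^sup>2 + (e k)\<^sup>2) - e k) \<longlonglongrightarrow> sqrt ((y x)\<^sup>2 + 0\<^sup>2) - 0"
          by (intro tendsto_intros e0)
        then show "(\<lambda>k. sqrt ((y x)\<^sup>2 + (e k)\<^sup>2) - e k) \<longlonglongrightarrow> \<bar>y x\<bar>" by simp
      qed
    qed (use b in \<open>auto\<close>)
    show "sqlim M (\<lambda>k x. (y x / sqrt ((y x)\<^sup>2 + (e k)\<^sup>2)) *\<^sub>R g x) (\<lambda>x. sgn (y x) *\<^sub>R g x)"
    proof (rule sqlim_bounded_mult_seq[OF sqlim_const[OF H0_sqint(2)[OF assms]]])
      show "AE x in M. (\<lambda>k. y x / sqrt ((y x)\<^sup>2 + (e k)\<^sup>2)) \<longlonglongrightarrow> sgn (y x)"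
      proof (intro AE_I2)
        fix x
        show "(\<lambda>k. y x / sqrt ((y x)\<^sup>2 + (e k)\<^sup>2)) \<longlonglongrightarrow> sgn (y x)"
        proof (cases "y x = 0")
          case False
          have "(\<lambda>k. y x / sqrt ((y x)\<^sup>2 + (e k)\<^sup>2)) \<longlonglongrightarrow> y x / sqrt ((y x)\<^sup>2 + 0\<^sup>2)"
            using False by (intro tendsto_intros e0) simp
          then show ?thesis by (simp add: real_sgn_eq)
        qed simp
      qed
      show "\<bar>y x / sqrt ((y x)\<^sup>2 + (e k)\<^sup>2)\<bar> \<le> 1" for k x by (rule sqrt_regularisation(2)[OF e])
    qed measurable
  qed
qed

text \<open>With \<open>y \<ge> 0\<close> this function is \<open>e\<^sup>2 \<psi>\<^sup>2 / (sqrt (y\<^sup>2 + e\<^sup>2) + y)\<close>, comparable to \<open>e\<^sup>2 \<psi>\<^sup>2 / (y + e)\<close>: it is the test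
  function of the logarithmic Caccioppoli inequality.\<close>

lemma H0_log_test:
  assumes "H0 y g" "\<psi> \<in> test_functions \<Omega>" "0 < e"
  shows "H0 (\<lambda>x. (\<psi> x)\<^sup>2 * (sqrt ((y x)\<^sup>2 + e\<^sup>2) - y x))
    (\<lambda>x. (\<psi> x)\<^sup>2 *\<^sub>R ((y x / sqrt ((y x)\<^sup>2 + e\<^sup>2) - 1) *\<^sub>R g x) + (sqrt ((y x)\<^sup>2 + e\<^sup>2) - y x) *\<^sub>R ((2 * \<psi> x) *\<^sub>R grad \<psi> x))"
proof -
  let ?F = "\<lambda>s. sqrt (s\<^sup>2 + e\<^sup>2) - s"
  obtain \<phi> where \<phi>: "\<And>k. \<phi> k \<in> test_functions \<Omega>" "sqlim M \<phi> y" "sqlim M (\<lambda>k. grad (\<phi> k)) g"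
    "AE x in M. (\<lambda>k. \<phi> k x) \<longlonglongrightarrow> y x" using H0_AE_approx[OF assms(1)] by blast
  have d: "(?F has_real_derivative s / sqrt (s\<^sup>2 + e\<^sup>2) - 1) (at s)" for s
    using DERIV_diff[OF sqrt_regularisation(1)[OF assms(3)] DERIV_ident] by simp
  have b: "\<bar>s / sqrt (s\<^sup>2 + e\<^sup>2) - 1\<bar> \<le> 2" for s using sqrt_regularisation(2)[OF assms(3), of s] by linarith
  have c: "continuous_on UNIV (\<lambda>s. s / sqrt (s\<^sup>2 + e\<^sup>2) - 1)"
    by (intro continuous_on_diff sqrt_regularisation(3) assms(3)) simp
  note l = chain_rule_limit[OF \<phi> d c b]
  obtain B where B: "\<And>x. \<bar>\<psi> x\<bar> \<le> B" "\<And>x. norm (grad \<psi> x) \<le> B" "0 \<le> B" using test_bounded[OF assms(2)] by metis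
  note C\<psi> = test_C1[OF assms(2)]
  note [measurable] = C1_measurable_M[OF C\<psi>]
  have smooth\<psi>: "smooth \<psi>" using assms(2) by (simp add: test_functions_def)
  have sm: "smooth (\<lambda>x. ?F (\<phi> k x))" for k
  proof -
    have "smooth (\<phi> k)" using \<phi>(1)[of k] by (simp add: test_functions_def)
    then show ?thesis using smooth_sqrt[OF _ assms(3), of "\<phi> k"] by (intro allI Ck_diff) blast+
  qed
  have t: "(\<lambda>x. (\<psi> x)\<^sup>2 * ?F (\<phi> k x)) \<in> test_functions \<Omega>" for k
    unfolding power2_eq_square by (intro test_mult assms(2) smooth\<psi> sm[unfolded power2_eq_square])
  have g2: "grad (\<lambda>x. (\<psi> x)\<^sup>2) x = (2 * \<psi> x) *\<^sub>R grad \<psi> x" for x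
    unfolding power2_eq_square using grad_mult[OF C\<psi> C\<psi>, of x] by (simp add: scaleR_add_left[symmetric])
  have gr: "grad (\<lambda>x. (\<psi> x)\<^sup>2 * ?F (\<phi> k x)) =
     (\<lambda>x. (\<psi> x)\<^sup>2 *\<^sub>R grad (\<lambda>x. ?F (\<phi> k x)) x + ?F (\<phi> k x) *\<^sub>R ((2 * \<psi> x) *\<^sub>R grad \<psi> x))" for k
  proof
    fix x
    have "C1 (\<lambda>x. (\<psi> x)\<^sup>2)" unfolding power2_eq_square by (rule test_C1[OF test_mult[OF assms(2) smooth\<psi>]])
    from grad_mult[OF this smooth_C1[OF sm[of k]], of x]
    show "grad (\<lambda>x. (\<psi> x)\<^sup>2 * ?F (\<phi> k x)) x =
       (\<psi> x)\<^sup>2 *\<^sub>R grad (\<lambda>x. ?F (\<phi> k x)) x + ?F (\<phi> k x) *\<^sub>R ((2 * \<psi> x) *\<^sub>R grad \<psi> x)" by (simp only: g2)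
  qed
  have \<psi>2: "\<bar>(\<psi> x)\<^sup>2\<bar> \<le> B\<^sup>2" for x using power_mono[OF B(1)[of x] abs_ge_zero, of 2] by simp
  have l1: "sqlim M (\<lambda>k x. (\<psi> x)\<^sup>2 *\<^sub>R ?F (\<phi> k x)) (\<lambda>x. (\<psi> x)\<^sup>2 *\<^sub>R ?F (y x))"
    by (rule sqlim_bounded_mult[OF l(1), of _ "B\<^sup>2"]) (use \<psi>2 in auto)
  have l2: "sqlim M (\<lambda>k x. (\<psi> x)\<^sup>2 *\<^sub>R grad (\<lambda>x. ?F (\<phi> k x)) x) (\<lambda>x. (\<psi> x)\<^sup>2 *\<^sub>R ((y x / sqrt ((y x)\<^sup>2 + e\<^sup>2) - 1) *\<^sub>R g x))"
    by (rule sqlim_bounded_mult[OF l(2), of _ "B\<^sup>2"]) (use \<psi>2 in auto)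
  have p: "norm ((2 * \<psi> x) *\<^sub>R grad \<psi> x) \<le> 2 * B * B" for x
    using mult_mono[OF B(1)[of x] B(2)[of x] B(3)] by (simp add: abs_mult)
  have l3: "sqlim M (\<lambda>k x. ?F (\<phi> k x) *\<^sub>R ((2 * \<psi> x) *\<^sub>R grad \<psi> x)) (\<lambda>x. ?F (y x) *\<^sub>R ((2 * \<psi> x) *\<^sub>R grad \<psi> x))"
  proof (rule sqlim_dominated_diff[OF l(1), of _ _ "2 * B * B"])
    note m = sqlimD(1,2)[OF l(1), THEN sqint_measurable]
    show "(\<lambda>x. ?F (\<phi> k x) *\<^sub>R ((2 * \<psi> x) *\<^sub>R grad \<psi> x)) \<in> borel_measurable M" for k
      by (intro borel_measurable_scaleR m) measurable
    show "sqint M (\<lambda>x. ?F (y x) *\<^sub>R ((2 * \<psi> x) *\<^sub>R grad \<psi> x))"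
    proof (rule sqint_dominated[OF sqint_scale[OF sqlimD(2)[OF l(1)], of "2 * B * B"]])
      show "(\<lambda>x. ?F (y x) *\<^sub>R ((2 * \<psi> x) *\<^sub>R grad \<psi> x)) \<in> borel_measurable M"
        by (intro borel_measurable_scaleR m) measurable
      have "norm (?F (y x) *\<^sub>R ((2 * \<psi> x) *\<^sub>R grad \<psi> x)) \<le> norm ((2 * B * B) *\<^sub>R ?F (y x))" for x
        using mult_left_mono[OF p[of x] abs_ge_zero[of "?F (y x)"]] B(3) by (simp only: norm_scaleR real_norm_def abs_mult) (simp add: mult_ac)
      then show "AE x in M. norm (?F (y x) *\<^sub>R ((2 * \<psi> x) *\<^sub>R grad \<psi> x)) \<le> norm ((2 * B * B) *\<^sub>R ?F (y x))" by simp
    qed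
    have "norm (?F (\<phi> k x) *\<^sub>R ((2 * \<psi> x) *\<^sub>R grad \<psi> x) - ?F (y x) *\<^sub>R ((2 * \<psi> x) *\<^sub>R grad \<psi> x)) \<le> 2 * B * B * norm (?F (\<phi> k x) - ?F (y x))" for k x
      unfolding scaleR_diff_left[symmetric] norm_scaleR[of "?F (\<phi> k x) - ?F (y x)"]
      using mult_left_mono[OF p[of x] abs_ge_zero[of "?F (\<phi> k x) - ?F (y x)"]] by (simp only: real_norm_def mult.commute)
    then show "AE x in M. norm (?F (\<phi> k x) *\<^sub>R ((2 * \<psi> x) *\<^sub>R grad \<psi> x) - ?F (y x) *\<^sub>R ((2 * \<psi> x) *\<^sub>R grad \<psi> x)) \<le> 2 * B * B * norm (?F (\<phi> k x) - ?F (y x))" for k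
      by simp
  qed
  show ?thesis
  proof (rule H0I[OF t])
    show "sqlim M (\<lambda>k x. (\<psi> x)\<^sup>2 * ?F (\<phi> k x)) (\<lambda>x. (\<psi> x)\<^sup>2 * ?F (y x))" using l1 by simp
  qed (unfold gr, rule sqlim_add[OF l2 l3])
qed

end


section \<open>The Poincare inequality on convex sets\<close>


lemma nn_integral_lborel_affine:
  fixes f :: "'a::euclidean_space \<Rightarrow> ennreal"
  assumes [measurable]: "f \<in> borel_measurable borel" and c: "c \<noteq> 0"
  shows "(\<integral>\<^sup>+x. f x \<partial>lborel) = ennreal (\<bar>c\<bar> ^ DIM('a)) * (\<integral>\<^sup>+x. f (t + c *\<^sub>R x) \<partial>lborel)"
  by (subst lborel_affine[OF c, of t]) (simp add: nn_integral_density nn_integral_distr nn_integral_cmult)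

text \<open>Integrate the derivative of \<open>t \<mapsto> u (y + t v)\<close> over \<open>[0, 1]\<close> and apply the Cauchy-Schwarz inequality.\<close>

lemma C1_increment_sq_le:
  assumes u: "C1 u"
  shows "ennreal ((u (y + v) - u y)\<^sup>2)
    \<le> (\<integral>\<^sup>+t. indicator {0..1} t * ennreal ((norm v)\<^sup>2 * (norm (grad u (y + t *\<^sub>R v)))\<^sup>2) \<partial>lborel)"
proof -
  define h where "h t = grad u (y + t *\<^sub>R v) \<bullet> v" for t
  have cg: "continuous_on UNIV (grad u)" using u by (simp add: C1_def)
  have ch: "continuous_on A h" for A
    unfolding h_def by (intro continuous_intros continuous_on_compose2[OF cg]) auto
  have [measurable]: "h \<in> borel_measurable borel" by (rule borel_measurable_continuous_onI[OF ch])
  have [measurable]: "grad u \<in> borel_measurable borel" by (rule C1_measurable[OF u])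
  have ftc: "(LINT t|lborel. indicator {0..1} t *\<^sub>R h t) = u (y + v) - u y"
    using integral_FTC_Icc[of 0 1 "\<lambda>t. u (y + t *\<^sub>R v)" h] C1_line[OF u, of y v] ch
    by (simp add: h_def has_real_derivative_iff_has_vector_derivative has_vector_derivative_at_within)
  have ind: "(indicator {0..1::real} t :: real)\<^sup>2 = indicator {0..1} t" for t :: real
    by (simp add: indicator_def)
  have s1: "sqint lborel (\<lambda>t. indicator {0..1::real} t :: real)"
    by (simp add: sqint_def ind)
  have i2: "integrable lborel (\<lambda>t. indicator {0..1} t *\<^sub>R (h t)\<^sup>2)"
    by (rule borel_integrable_compact) (auto intro!: continuous_intros ch)
  have s2: "sqint lborel (\<lambda>t. indicator {0..1} t *\<^sub>R h t)"
    unfolding sqint_def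
  proof (intro conjI)
    show "integrable lborel (\<lambda>t. (norm (indicator {0..1} t *\<^sub>R h t))\<^sup>2)"
      by (rule Bochner_Integration.integrable_cong[THEN iffD1, OF refl _ i2]) (auto simp: indicator_def)
  qed measurable
  have "(u (y + v) - u y)\<^sup>2 = (LINT t|lborel. indicator {0..1::real} t \<bullet> (indicator {0..1} t *\<^sub>R h t))\<^sup>2"
    unfolding ftc[symmetric] by (intro arg_cong[where f = "\<lambda>x. x\<^sup>2"] Bochner_Integration.integral_cong) (auto simp: indicator_def)
  also have "\<dots> \<le> (LINT t|lborel. (norm (indicator {0..1::real} t :: real))\<^sup>2) * (LINT t|lborel. (norm (indicator {0..1} t *\<^sub>R h t))\<^sup>2)"
    by (rule L2_Cauchy_Schwarz[OF s1 s2])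
  also have "(LINT t|lborel. (norm (indicator {0..1::real} t :: real))\<^sup>2) = 1"
    by (simp add: ind)
  finally have "ennreal ((u (y + v) - u y)\<^sup>2) \<le> ennreal (LINT t|lborel. (norm (indicator {0..1} t *\<^sub>R h t))\<^sup>2)"
    by (simp add: ennreal_leI)
  also have "\<dots> = (\<integral>\<^sup>+t. ennreal ((norm (indicator {0..1} t *\<^sub>R h t))\<^sup>2) \<partial>lborel)"
    by (rule nn_integral_eq_integral[symmetric]) (use sqint_integrable[OF s2] in auto)
  also have "\<dots> \<le> (\<integral>\<^sup>+t. indicator {0..1} t * ennreal ((norm v)\<^sup>2 * (norm (grad u (y + t *\<^sub>R v)))\<^sup>2) \<partial>lborel)"
  proof (rule nn_integral_mono)
    fix t :: real
    have "(h t)\<^sup>2 \<le> (norm v)\<^sup>2 * (norm (grad u (y + t *\<^sub>R v)))\<^sup>2"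
      unfolding h_def by (simp add: power_mult_distrib[symmetric] abs_le_square_iff[symmetric] mult.commute[of "norm v"] Cauchy_Schwarz_ineq2)
    then show "ennreal ((norm (indicator {0..1} t *\<^sub>R h t))\<^sup>2) \<le> indicator {0..1} t * ennreal ((norm v)\<^sup>2 * (norm (grad u (y + t *\<^sub>R v)))\<^sup>2)"
      by (auto simp: indicator_def intro: ennreal_leI)
  qed
  finally show ?thesis .
qed

text \<open>For fixed \<open>y\<close> the map \<open>x \<mapsto> (1 - t) y + t x\<close> sends \<open>K\<close> into itself and scales volumes by \<open>t\<close> to the power of the dimension,
  which is bounded below for \<open>t \<ge> 1 / 2\<close>.\<close>

lemma convex_average_bound_half:
  fixes G :: "'a::euclidean_space \<Rightarrow> ennreal"
  assumes [measurable]: "G \<in> borel_measurable borel" "K \<in> sets borel" and K: "convex K" and t: "1/2 \<le> t" "t \<le> 1"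
  shows "(\<integral>\<^sup>+y. \<integral>\<^sup>+x. indicator K x * indicator K y * G (y + t *\<^sub>R (x - y)) \<partial>lborel \<partial>lborel)
    \<le> 2 ^ DIM('a) * emeasure lborel K * (\<integral>\<^sup>+z. indicator K z * G z \<partial>lborel)"
proof -
  let ?I = "\<integral>\<^sup>+z. indicator K z * G z \<partial>lborel"
  have "(\<integral>\<^sup>+x. indicator K x * indicator K y * G (y + t *\<^sub>R (x - y)) \<partial>lborel) \<le> indicator K y * (2 ^ DIM('a) * ?I)" for y
  proof (cases "y \<in> K")
    case True
    have "(\<integral>\<^sup>+x. indicator K x * indicator K y * G (y + t *\<^sub>R (x - y)) \<partial>lborel)
        \<le> (\<integral>\<^sup>+x. indicator K ((1 - t) *\<^sub>R y + t *\<^sub>R x) * G ((1 - t) *\<^sub>R y + t *\<^sub>R x) \<partial>lborel)"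
    proof (rule nn_integral_mono)
      fix x
      have "y + t *\<^sub>R (x - y) = (1 - t) *\<^sub>R y + t *\<^sub>R x" by (simp add: algebra_simps)
      moreover have "(1 - t) *\<^sub>R y + t *\<^sub>R x \<in> K" if "x \<in> K"
        using convexD[OF K True that, of "1 - t" t] t by simp
      ultimately show "indicator K x * indicator K y * G (y + t *\<^sub>R (x - y))
          \<le> indicator K ((1 - t) *\<^sub>R y + t *\<^sub>R x) * G ((1 - t) *\<^sub>R y + t *\<^sub>R x)"
        by (auto simp: indicator_def)
    qed
    also have "\<dots> = ennreal ((1/t) ^ DIM('a)) * ?I"
    proof -
      have "?I = ennreal (\<bar>t\<bar> ^ DIM('a)) * (\<integral>\<^sup>+x. indicator K ((1 - t) *\<^sub>R y + t *\<^sub>R x) * G ((1 - t) *\<^sub>R y + t *\<^sub>R x) \<partial>lborel)"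
        by (rule nn_integral_lborel_affine) (use t in auto)
      moreover have "ennreal ((1/t) ^ DIM('a)) * ennreal (\<bar>t\<bar> ^ DIM('a)) = 1"
        using t by (simp add: ennreal_mult[symmetric] power_mult_distrib[symmetric])
      ultimately show ?thesis by (simp add: mult.assoc[symmetric])
    qed
    also have "\<dots> \<le> 2 ^ DIM('a) * ?I"
    proof (rule mult_right_mono)
      have "(1/t) ^ DIM('a) \<le> 2 ^ DIM('a)" by (rule power_mono) (use t in \<open>auto simp: field_simps\<close>)
      then have "ennreal ((1/t) ^ DIM('a)) \<le> ennreal (2 ^ DIM('a))" by (rule ennreal_leI)
      then show "ennreal ((1/t) ^ DIM('a)) \<le> 2 ^ DIM('a)" by (simp add: ennreal_power[symmetric])
    qed simp
    finally show ?thesis using True by simp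
  qed simp
  then have "(\<integral>\<^sup>+y. \<integral>\<^sup>+x. indicator K x * indicator K y * G (y + t *\<^sub>R (x - y)) \<partial>lborel \<partial>lborel)
      \<le> (\<integral>\<^sup>+y. indicator K y * (2 ^ DIM('a) * ?I) \<partial>lborel)"
    by (intro nn_integral_mono)
  also have "\<dots> = 2 ^ DIM('a) * emeasure lborel K * ?I"
    by (subst nn_integral_multc) (auto simp: mult_ac)
  finally show ?thesis .
qed

text \<open>For \<open>t < 1 / 2\<close> the roles of \<open>x\<close> and \<open>y\<close> are exchanged, which replaces \<open>t\<close> by \<open>1 - t\<close>.\<close>

lemma convex_average_bound:
  fixes G :: "'a::euclidean_space \<Rightarrow> ennreal"
  assumes [measurable]: "G \<in> borel_measurable borel" "K \<in> sets borel" and K: "convex K" and t: "0 \<le> t" "t \<le> 1"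
  shows "(\<integral>\<^sup>+y. \<integral>\<^sup>+x. indicator K x * indicator K y * G (y + t *\<^sub>R (x - y)) \<partial>lborel \<partial>lborel)
    \<le> 2 ^ DIM('a) * emeasure lborel K * (\<integral>\<^sup>+z. indicator K z * G z \<partial>lborel)"
proof (cases "1/2 \<le> t")
  case True then show ?thesis using convex_average_bound_half assms by blast
next
  case False
  have "(\<integral>\<^sup>+y. \<integral>\<^sup>+x. indicator K x * indicator K y * G (y + t *\<^sub>R (x - y)) \<partial>lborel \<partial>lborel)
      = (\<integral>\<^sup>+x. \<integral>\<^sup>+y. indicator K x * indicator K y * G (y + t *\<^sub>R (x - y)) \<partial>lborel \<partial>lborel)"
    by (rule lborel_pair.Fubini') measurable
  also have "\<dots> = (\<integral>\<^sup>+x. \<integral>\<^sup>+y. indicator K y * indicator K x * G (x + (1 - t) *\<^sub>R (y - x)) \<partial>lborel \<partial>lborel)"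
    by (intro nn_integral_cong) (simp add: algebra_simps)
  also have "\<dots> \<le> 2 ^ DIM('a) * emeasure lborel K * (\<integral>\<^sup>+z. indicator K z * G z \<partial>lborel)"
    by (rule convex_average_bound_half) (use False t K in auto)
  finally show ?thesis .
qed

text \<open>Integrate the mean value estimate along the segments joining all pairs of points of \<open>K\<close>; by Tonelli's theorem the parameter
  \<open>t\<close> of the segment can be fixed, and the inner integrals are then bounded uniformly in \<open>t\<close>.\<close>

lemma poincare_double_integral:
  fixes u :: "real^'n \<Rightarrow> real"
  assumes u: "C1 u" and K [measurable]: "K \<in> sets borel" and "convex K"
    and d: "\<And>x y. x \<in> K \<Longrightarrow> y \<in> K \<Longrightarrow> norm (x - y) \<le> d"
  shows "(\<integral>\<^sup>+y. \<integral>\<^sup>+x. indicator K x * indicator K y * ennreal ((u x - u y)\<^sup>2) \<partial>lborel \<partial>lborel)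
    \<le> ennreal (d\<^sup>2) * (2 ^ CARD('n) * emeasure lborel K * (\<integral>\<^sup>+z. indicator K z * ennreal ((norm (grad u z))\<^sup>2) \<partial>lborel))"
proof -
  define G where "G z = ennreal ((norm (grad u z))\<^sup>2)" for z
  note [measurable] = C1_measurable[OF u]
  have [measurable]: "G \<in> borel_measurable borel" unfolding G_def[abs_def] by measurable
  let ?i = "indicator K :: _ \<Rightarrow> ennreal" and ?j = "indicator {0..1::real} :: _ \<Rightarrow> ennreal"
  let ?f = "\<lambda>x y t. ?j t * (ennreal (d\<^sup>2) * (?i x * ?i y * G (y + t *\<^sub>R (x - y))))"
  let ?A = "2 ^ CARD('n) * emeasure lborel K * (\<integral>\<^sup>+z. ?i z * G z \<partial>lborel)"
  have "?i x * ?i y * ennreal ((u x - u y)\<^sup>2) \<le> (\<integral>\<^sup>+t. ?f x y t \<partial>lborel)" for x y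
  proof (cases "x \<in> K \<and> y \<in> K")
    case True
    have "ennreal ((u (y + (x - y)) - u y)\<^sup>2)
        \<le> (\<integral>\<^sup>+t. ?j t * ennreal ((norm (x - y))\<^sup>2 * (norm (grad u (y + t *\<^sub>R (x - y))))\<^sup>2) \<partial>lborel)"
      by (rule C1_increment_sq_le[OF u])
    also have "\<dots> \<le> (\<integral>\<^sup>+t. ?f x y t \<partial>lborel)"
    proof (rule nn_integral_mono)
      fix t :: real
      have "(norm (x - y))\<^sup>2 * (norm (grad u (y + t *\<^sub>R (x - y))))\<^sup>2 \<le> d\<^sup>2 * (norm (grad u (y + t *\<^sub>R (x - y))))\<^sup>2"
        using True by (intro mult_right_mono power_mono d) auto
      then have "ennreal ((norm (x - y))\<^sup>2 * (norm (grad u (y + t *\<^sub>R (x - y))))\<^sup>2) \<le> ennreal (d\<^sup>2) * G (y + t *\<^sub>R (x - y))"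
        unfolding G_def by (subst ennreal_mult[symmetric]) (auto intro: ennreal_leI)
      then show "?j t * ennreal ((norm (x - y))\<^sup>2 * (norm (grad u (y + t *\<^sub>R (x - y))))\<^sup>2) \<le> ?f x y t"
        using True by (auto intro: mult_left_mono)
    qed
    finally show ?thesis using True by simp
  qed auto
  then have "(\<integral>\<^sup>+y. \<integral>\<^sup>+x. ?i x * ?i y * ennreal ((u x - u y)\<^sup>2) \<partial>lborel \<partial>lborel)
      \<le> (\<integral>\<^sup>+y. \<integral>\<^sup>+x. \<integral>\<^sup>+t. ?f x y t \<partial>lborel \<partial>lborel \<partial>lborel)"
    by (intro nn_integral_mono)
  also have "\<dots> = (\<integral>\<^sup>+y. \<integral>\<^sup>+t. \<integral>\<^sup>+x. ?f x y t \<partial>lborel \<partial>lborel \<partial>lborel)"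
    by (intro nn_integral_cong lborel_pair.Fubini') measurable
  also have "\<dots> = (\<integral>\<^sup>+t. \<integral>\<^sup>+y. \<integral>\<^sup>+x. ?f x y t \<partial>lborel \<partial>lborel \<partial>lborel)"
    by (intro lborel_pair.Fubini') measurable
  also have "\<dots> \<le> (\<integral>\<^sup>+t. ?j t * (ennreal (d\<^sup>2) * ?A) \<partial>lborel)"
  proof (rule nn_integral_mono)
    fix t :: real
    have "(\<integral>\<^sup>+y. \<integral>\<^sup>+x. ?f x y t \<partial>lborel \<partial>lborel) =
       ?j t * (ennreal (d\<^sup>2) * (\<integral>\<^sup>+y. \<integral>\<^sup>+x. ?i x * ?i y * G (y + t *\<^sub>R (x - y)) \<partial>lborel \<partial>lborel))"
      by (simp add: nn_integral_cmult)
    also have "\<dots> \<le> ?j t * (ennreal (d\<^sup>2) * ?A)"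
    proof (cases "t \<in> {0..1}")
      case True
      have "(\<integral>\<^sup>+y. \<integral>\<^sup>+x. ?i x * ?i y * G (y + t *\<^sub>R (x - y)) \<partial>lborel \<partial>lborel) \<le> ?A"
        using convex_average_bound[of G K t] True \<open>convex K\<close> by simp
      then show ?thesis by (intro mult_left_mono) auto
    qed simp
    finally show "(\<integral>\<^sup>+y. \<integral>\<^sup>+x. ?f x y t \<partial>lborel \<partial>lborel) \<le> ?j t * (ennreal (d\<^sup>2) * ?A)" .
  qed
  also have "\<dots> = ennreal (d\<^sup>2) * ?A" by (simp add: nn_integral_multc)
  finally show ?thesis by (simp add: G_def)
qed

text \<open>Expanding the square turns the double integral into the variance of \<open>u\<close>; in this form
  the inequality is preserved under limits in \<open>W\<^sup>1\<^sup>,\<^sup>2\<close>.\<close>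

lemma poincare_C1:
  fixes u :: "real^'n \<Rightarrow> real"
  assumes u: "C1 u" and K: "K \<in> sets borel" "bounded K" "convex K"
    and d: "\<And>x y. x \<in> K \<Longrightarrow> y \<in> K \<Longrightarrow> norm (x - y) \<le> d"
  shows "measure lebesgue K * (LINT x|lebesgue_on K. (u x)\<^sup>2) - (LINT x|lebesgue_on K. u x)\<^sup>2
    \<le> d\<^sup>2 * 2 ^ CARD('n) * measure lebesgue K * (LINT x|lebesgue_on K. (norm (grad u x))\<^sup>2)"
proof -
  define N where "N = restrict_space lborel K"
  note [measurable] = C1_measurable[OF u] K(1)
  have sp: "K \<inter> space lborel \<in> sets lborel" using K(1) by simp
  have eN: "emeasure N (space N) = emeasure lborel K" unfolding N_def by (simp add: emeasure_restrict_space space_restrict_space)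
  have fin: "emeasure lborel K < \<infinity>" by (rule emeasure_bounded_finite[OF K(2)])
  interpret N: finite_measure N by (rule finite_measureI) (use eN fin in auto)
  have mN: "f \<in> borel_measurable N" if "f \<in> borel_measurable borel" for f :: "real^'n \<Rightarrow> real"
    unfolding N_def by (rule measurable_restrict_space1) (use that in simp)
  obtain R where "\<And>x. x \<in> K \<Longrightarrow> norm x \<le> R" using K(2) bounded_iff by metis
  then have R: "K \<subseteq> cball 0 R" by auto
  have bd: "\<exists>B. \<forall>x\<in>K. norm (f x) \<le> B" if "continuous_on UNIV f" for f :: "real^'n \<Rightarrow> real"
  proof -
    have "bounded (f ` cball 0 R)"
      by (intro compact_imp_bounded compact_continuous_image continuous_on_subset[OF that]) auto
    then show ?thesis using R unfolding bounded_iff by blast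
  qed
  have sq: "sqint N f" if cf: "continuous_on UNIV f" for f :: "real^'n \<Rightarrow> real"
  proof -
    obtain B where "\<forall>x\<in>K. norm (f x) \<le> B" using bd[OF cf] by blast
    then show ?thesis
      by (intro N.sqint_bounded[of _ B] mN borel_measurable_continuous_onI cf AE_I2) (simp add: N_def space_restrict_space)
  qed
  have su: "sqint N u" by (rule sq[OF C1_continuous[OF u]])
  have sg: "sqint N (\<lambda>x. norm (grad u x))" using u by (intro sq continuous_on_norm) (simp add: C1_def)
  have iu2: "integrable N (\<lambda>x. (u x)\<^sup>2)" using sqint_integrable[OF su] by simp
  have "sqint N (\<lambda>x. 1::real)" by (rule sq) simp
  from sqint_mult_integrable[OF su this] have iu: "integrable N u" by simp
  define m where "m = measure N (space N)"
  define I1 where "I1 = (LINT x|N. u x)"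
  define I2 where "I2 = (LINT x|N. (u x)\<^sup>2)"
  define J where "J = (LINT x|N. (norm (grad u x))\<^sup>2)"
  have nnN: "(\<integral>\<^sup>+x. indicator K x * f x \<partial>lborel) = (\<integral>\<^sup>+x. f x \<partial>N)" for f :: "real^'n \<Rightarrow> ennreal"
    unfolding N_def by (subst nn_integral_restrict_space[OF sp]) (simp add: mult.commute)
  have in1: "(\<integral>\<^sup>+x. ennreal ((u x - u y)\<^sup>2) \<partial>N) = ennreal (I2 - 2 * u y * I1 + m * (u y)\<^sup>2)" for y
  proof -
    have e: "(u x - u y)\<^sup>2 = (u x)\<^sup>2 - 2 * u y * u x + (u y)\<^sup>2" for x by (simp add: power2_diff)
    have "integrable N (\<lambda>x. (u x - u y)\<^sup>2)" unfolding e using iu iu2 by simp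
    then have "(\<integral>\<^sup>+x. ennreal ((u x - u y)\<^sup>2) \<partial>N) = ennreal (LINT x|N. (u x - u y)\<^sup>2)" by (rule nn_integral_eq_integral) simp
    also have "(LINT x|N. (u x - u y)\<^sup>2) = I2 - 2 * u y * I1 + m * (u y)\<^sup>2"
      unfolding e using iu iu2 by (simp add: I1_def I2_def m_def)
    finally show ?thesis .
  qed
  have pos: "0 \<le> I2 - 2 * u y * I1 + m * (u y)\<^sup>2" for y
  proof -
    have e: "(u x - u y)\<^sup>2 = (u x)\<^sup>2 - 2 * u y * u x + (u y)\<^sup>2" for x by (simp add: power2_diff)
    have "0 \<le> (LINT x|N. (u x - u y)\<^sup>2)" by simp
    also have "(LINT x|N. (u x - u y)\<^sup>2) = I2 - 2 * u y * I1 + m * (u y)\<^sup>2"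
      unfolding e using iu iu2 by (simp add: I1_def I2_def m_def)
    finally show ?thesis .
  qed
  have "(\<integral>\<^sup>+y. \<integral>\<^sup>+x. indicator K x * indicator K y * ennreal ((u x - u y)\<^sup>2) \<partial>lborel \<partial>lborel)
     = (\<integral>\<^sup>+y. (\<integral>\<^sup>+x. ennreal ((u x - u y)\<^sup>2) \<partial>N) \<partial>N)"
    by (simp add: nnN[symmetric] nn_integral_cmult[symmetric] mult_ac)
  also have "\<dots> = (\<integral>\<^sup>+y. ennreal (I2 - 2 * u y * I1 + m * (u y)\<^sup>2) \<partial>N)" by (simp only: in1)
  also have "\<dots> = ennreal (LINT y|N. (I2 - 2 * u y * I1 + m * (u y)\<^sup>2))"
    by (rule nn_integral_eq_integral) (use iu iu2 pos in auto)
  also have "(LINT y|N. (I2 - 2 * u y * I1 + m * (u y)\<^sup>2)) = 2 * (m * I2 - I1\<^sup>2)"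
  proof -
    have "(LINT y|N. (I2 - 2 * u y * I1 + m * (u y)\<^sup>2)) = m * I2 - 2 * I1 * I1 + m * I2"
      using iu iu2 by (simp add: I1_def[symmetric] I2_def[symmetric] m_def[symmetric])
    then show ?thesis by (simp add: power2_eq_square)
  qed
  finally have L: "(\<integral>\<^sup>+y. \<integral>\<^sup>+x. indicator K x * indicator K y * ennreal ((u x - u y)\<^sup>2) \<partial>lborel \<partial>lborel) = ennreal (2 * (m * I2 - I1\<^sup>2))" .
  have m: "emeasure lborel K = ennreal m" "0 \<le> m"
    unfolding m_def eN[symmetric] by (simp_all add: N.emeasure_eq_measure)
  have J: "(\<integral>\<^sup>+z. indicator K z * ennreal ((norm (grad u z))\<^sup>2) \<partial>lborel) = ennreal J" "0 \<le> J"
    unfolding nnN J_def by (rule nn_integral_eq_integral) (use sqint_integrable[OF sg] in auto)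
  have "ennreal (2 * (m * I2 - I1\<^sup>2)) \<le> ennreal (d\<^sup>2) * (2 ^ CARD('n) * ennreal m * ennreal J)"
    unfolding L[symmetric] m(1)[symmetric] J(1)[symmetric] by (rule poincare_double_integral[OF u K(1,3) d])
  also have "\<dots> = ennreal (d\<^sup>2 * (2 ^ CARD('n) * m * J))"
    using m(2) J(2) by (simp add: ennreal_mult ennreal_power[symmetric])
  finally have "2 * (m * I2 - I1\<^sup>2) \<le> d\<^sup>2 * (2 ^ CARD('n) * m * J)"
    using m(2) J(2) by (subst (asm) ennreal_le_iff) auto
  moreover have "0 \<le> d\<^sup>2 * (2 ^ CARD('n) * m * J)" using m(2) J(2) by simp
  ultimately have fin: "m * I2 - I1\<^sup>2 \<le> d\<^sup>2 * 2 ^ CARD('n) * m * J" by (simp add: mult.assoc)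
  have conv: "(LINT x|lebesgue_on K. f x) = (LINT x|N. f x)" if [measurable]: "f \<in> borel_measurable borel" for f :: "real^'n \<Rightarrow> real"
  proof -
    have "(LINT x|lebesgue_on K. f x) = (LINT x|lebesgue. indicator K x *\<^sub>R f x)"
      by (rule integral_restrict_space) (use K(1) in auto)
    also have "\<dots> = (LINT x|lborel. indicator K x *\<^sub>R f x)" by (rule integral_completion) measurable
    also have "\<dots> = (LINT x|N. f x)" unfolding N_def by (rule integral_restrict_space[OF sp, symmetric])
    finally show ?thesis .
  qed
  have "m = measure lebesgue K" using eN K(1) by (simp add: m_def measure_def)
  then show ?thesis using fin by (simp add: conv I1_def I2_def J_def)
qed


section \<open>The Rellich compactness theorem\<close>


lemma fine_box_division:
  fixes a b :: "'a::euclidean_space"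
  assumes "0 < \<delta>"
  shows "\<exists>\<D>. \<D> division_of (cbox a b) \<and> (\<forall>K\<in>\<D>. \<forall>x\<in>K. \<forall>y\<in>K. norm (x - y) \<le> 2 * \<delta>)"
proof -
  obtain p where p: "p tagged_division_of (cbox a b)" "(\<lambda>x. ball x \<delta>) fine p"
    using fine_division_exists[OF gauge_ball[OF assms], of a b] by metis
  have "norm (x - y) \<le> 2 * \<delta>" if K: "K \<in> snd ` p" "x \<in> K" "y \<in> K" for K x y
  proof -
    obtain z where "(z, K) \<in> p" using K(1) by auto
    then have "K \<subseteq> ball z \<delta>" using p(2) by (auto simp: fine_def)
    then have "dist x z < \<delta>" "dist y z < \<delta>" using K by (auto simp: dist_commute)
    then show ?thesis unfolding dist_norm[symmetric] using dist_triangle2[of x y z] by linarith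
  qed
  then show ?thesis using division_of_tagged_division[OF p(1)] by blast
qed

lemma simultaneous_convergent_subseq:
  fixes c :: "'i \<Rightarrow> nat \<Rightarrow> real"
  assumes "finite I" "\<And>i. i \<in> I \<Longrightarrow> bounded (range (c i))"
  shows "\<exists>r. strict_mono r \<and> (\<forall>i\<in>I. convergent (\<lambda>k. c i (r k)))"
  using assms
proof (induction I rule: finite_induct)
  case empty
  then show ?case by (auto intro: exI[of _ id] simp: strict_mono_id)
next
  case (insert j I)
  then obtain r where r: "strict_mono r" "\<forall>i\<in>I. convergent (\<lambda>k. c i (r k))" by auto
  have "bounded (range (\<lambda>k. c j (r k)))"
    by (rule bounded_subset[of "range (c j)"]) (use insert in auto)
  then obtain l s where s: "strict_mono s" "((\<lambda>k. c j (r k)) \<circ> s) \<longlonglongrightarrow> l"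
    using bounded_imp_convergent_subsequence by blast
  have "convergent (\<lambda>k. c i (r (s k)))" if "i \<in> insert j I" for i
  proof (cases "i = j")
    case True then show ?thesis using s(2) by (auto simp: convergent_def o_def)
  next
    case False
    then have "convergent (\<lambda>k. c i (r k))" using r(2) that by auto
    from convergent_subseq_convergent[OF this s(1)] show ?thesis by (simp add: o_def)
  qed
  then show ?case using strict_mono_o[OF r(1) s(1)] by (intro exI[of _ "\<lambda>k. r (s k)"]) (simp add: o_def)
qed

context bounded_domain
begin

lemma integrable_compact_support:
  assumes "continuous_on UNIV f" "\<And>x. x \<notin> K \<Longrightarrow> f x = 0" "compact K"
  shows "integrable lborel (f :: real^'n \<Rightarrow> real)"
proof -
  have "continuous_on K f" using assms(1) continuous_on_subset by blast
  from borel_integrable_compact[OF assms(3) this] show ?thesis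
    by (rule Bochner_Integration.integrable_cong[THEN iffD1, rotated -1]) (use assms(2) in \<open>auto simp: indicator_def\<close>)
qed

lemma integral_box_division:
  fixes f :: "real^'n \<Rightarrow> real"
  assumes f: "continuous_on UNIV f" "\<And>x. x \<notin> \<Omega> \<Longrightarrow> f x = 0" and box: "\<Omega> \<subseteq> cbox a b" and D: "\<D> division_of (cbox a b)"
  shows "(LINT x|M. f x) = (\<Sum>K\<in>\<D>. LINT x|lebesgue_on K. f x)"
proof -
  have i: "integrable (lebesgue_on (cbox c d)) f" for c d
    by (rule continuous_imp_integrable) (rule continuous_on_subset[OF f(1)], simp)
  have e: "(LINT x|lebesgue_on (cbox c d). f x) = integral (cbox c d) f" for c d
    by (rule lebesgue_integral_eq_integral[OF i]) simp
  have "(LINT x|M. f x) = (LINT x|lebesgue_on (cbox a b). (if x \<in> \<Omega> then f x else 0))"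
    by (rule integral_restrict[OF box, symmetric]) auto
  also have "\<dots> = (LINT x|lebesgue_on (cbox a b). f x)"
    by (intro Bochner_Integration.integral_cong) (use f(2) in auto)
  also have "\<dots> = (\<Sum>K\<in>\<D>. integral K f)"
    unfolding e by (rule integral_combine_division_topdown[OF _ D]) (metis i integrable_on_lebesgue_on lmeasurable_cbox fmeasurableD)
  also have "\<dots> = (\<Sum>K\<in>\<D>. LINT x|lebesgue_on K. f x)"
  proof (rule sum.cong[OF refl])
    fix K assume "K \<in> \<D>"
    then obtain c d where "K = cbox c d" using division_ofD(4)[OF D] by blast
    then show "integral K f = (LINT x|lebesgue_on K. f x)" using e by simp
  qed
  finally show ?thesis .
qed

text \<open>Poincare's inequality on each box of a division. On a box of measure \<open>0\<close> the left-hand side vanishes and the quotient on the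
  right is \<open>0\<close> by convention.\<close>

lemma test_poincare_boxes:
  assumes \<psi>: "\<psi> \<in> test_functions \<Omega>" and box: "\<Omega> \<subseteq> cbox a b" and D: "\<D> division_of (cbox a b)"
    and d: "\<And>K x y. K \<in> \<D> \<Longrightarrow> x \<in> K \<Longrightarrow> y \<in> K \<Longrightarrow> norm (x - y) \<le> d"
  shows "(LINT x|M. (norm (\<psi> x))\<^sup>2) \<le> (\<Sum>K\<in>\<D>. (LINT x|lebesgue_on K. \<psi> x)\<^sup>2 / measure lebesgue K)
    + d\<^sup>2 * 2 ^ CARD('n) * (LINT x|M. (norm (grad \<psi> x))\<^sup>2)"
proof -
  note C = test_C1[OF \<psi>]
  have cg: "continuous_on UNIV (\<lambda>x. (norm (grad \<psi> x))\<^sup>2)" using C by (auto simp: C1_def intro!: continuous_intros)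
  have cp: "continuous_on UNIV (\<lambda>x. (\<psi> x)\<^sup>2)" using C1_continuous[OF C] by (intro continuous_intros)
  obtain S where S: "S \<subseteq> \<Omega>" "\<And>x. x \<notin> S \<Longrightarrow> \<psi> x = 0" "\<And>x. x \<notin> S \<Longrightarrow> grad \<psi> x = 0"
    using test_grad_support[OF \<psi>] by metis
  have z: "\<psi> x = 0" "grad \<psi> x = 0" if "x \<notin> \<Omega>" for x using S that by blast+
  have "(LINT x|M. (norm (\<psi> x))\<^sup>2) = (\<Sum>K\<in>\<D>. LINT x|lebesgue_on K. (\<psi> x)\<^sup>2)"
    using integral_box_division[OF cp _ box D] z by simp
  also have "\<dots> \<le> (\<Sum>K\<in>\<D>. (LINT x|lebesgue_on K. \<psi> x)\<^sup>2 / measure lebesgue K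
      + d\<^sup>2 * 2 ^ CARD('n) * (LINT x|lebesgue_on K. (norm (grad \<psi> x))\<^sup>2))"
  proof (rule sum_mono)
    fix K assume K: "K \<in> \<D>"
    then obtain u v where uv: "K = cbox u v" using division_ofD(4)[OF D] by blast
    have p: "measure lebesgue K * (LINT x|lebesgue_on K. (\<psi> x)\<^sup>2) - (LINT x|lebesgue_on K. \<psi> x)\<^sup>2
        \<le> d\<^sup>2 * 2 ^ CARD('n) * measure lebesgue K * (LINT x|lebesgue_on K. (norm (grad \<psi> x))\<^sup>2)"
      by (rule poincare_C1[OF C]) (use uv d[OF K] in auto)
    show "(LINT x|lebesgue_on K. (\<psi> x)\<^sup>2) \<le> (LINT x|lebesgue_on K. \<psi> x)\<^sup>2 / measure lebesgue K
      + d\<^sup>2 * 2 ^ CARD('n) * (LINT x|lebesgue_on K. (norm (grad \<psi> x))\<^sup>2)"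
    proof (cases "measure lebesgue K = 0")
      case True
      have "K \<in> lmeasurable" using uv by simp
      with True have "K \<in> null_sets lebesgue" by (simp add: negligible_iff_measure negligible_iff_null_sets[symmetric])
      then have "AE x in lebesgue_on K. (\<psi> x)\<^sup>2 = 0"
        using AE_not_in[of K lebesgue] by (subst AE_restrict_space_iff) (auto simp: uv elim!: eventually_mono)
      then have "(LINT x|lebesgue_on K. (\<psi> x)\<^sup>2) = 0" by (simp add: integral_eq_zero_AE)
      then show ?thesis by simp
    next
      case False
      then have m: "0 < measure lebesgue K" by (simp add: zero_less_measure_iff)
      from p have "measure lebesgue K * (LINT x|lebesgue_on K. (\<psi> x)\<^sup>2)
         \<le> measure lebesgue K * ((LINT x|lebesgue_on K. \<psi> x)\<^sup>2 / measure lebesgue K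
             + d\<^sup>2 * 2 ^ CARD('n) * (LINT x|lebesgue_on K. (norm (grad \<psi> x))\<^sup>2))"
        using m by (simp add: distrib_left mult_ac)
      then show ?thesis using m by (simp only: mult_le_cancel_left_pos)
    qed
  qed
  also have "\<dots> = (\<Sum>K\<in>\<D>. (LINT x|lebesgue_on K. \<psi> x)\<^sup>2 / measure lebesgue K)
      + d\<^sup>2 * 2 ^ CARD('n) * (\<Sum>K\<in>\<D>. LINT x|lebesgue_on K. (norm (grad \<psi> x))\<^sup>2)"
    by (simp add: sum.distrib sum_distrib_left)
  also have "(\<Sum>K\<in>\<D>. LINT x|lebesgue_on K. (norm (grad \<psi> x))\<^sup>2) = (LINT x|M. (norm (grad \<psi> x))\<^sup>2)"
    by (rule integral_box_division[OF cg _ box D, symmetric]) (simp add: z)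
  finally show ?thesis .
qed

lemma box_average_bounded:
  assumes \<psi>: "\<psi> \<in> test_functions \<Omega>" 
  shows "(LINT x|lebesgue_on (cbox u v). \<psi> x)\<^sup>2 \<le> measure lebesgue (cbox u v) * (LINT x|M. (norm (\<psi> x))\<^sup>2)"
proof -
  note C = test_C1[OF \<psi>]
  have c: "continuous_on A \<psi>" for A using C1_continuous[OF C] continuous_on_subset by blast
  let ?N = "lebesgue_on (cbox u v)"
  have "integrable ?N (\<lambda>x. (\<psi> x)\<^sup>2)" by (intro continuous_imp_integrable continuous_intros c)
  moreover have "\<psi> \<in> borel_measurable ?N" by (rule continuous_imp_measurable_on_sets_lebesgue[OF c]) simp
  ultimately have s: "sqint ?N \<psi>" by (simp add: sqint_def)
  have 1: "sqint ?N (\<lambda>x. 1::real)"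
    by (rule finite_measure.sqint_bounded[OF finite_measure_lebesgue_on, of _ _ 1]) auto
  obtain S where S: "compact S" "S \<subseteq> \<Omega>" "\<And>x. x \<notin> S \<Longrightarrow> \<psi> x = 0" using test_grad_support[OF \<psi>] by metis
  have "(LINT x|?N. \<psi> x)\<^sup>2 \<le> (LINT x|?N. (norm (1::real))\<^sup>2) * (LINT x|?N. (norm (\<psi> x))\<^sup>2)"
    using L2_Cauchy_Schwarz[OF 1 s] by simp
  also have "\<dots> = measure lebesgue (cbox u v) * (LINT x|?N. (\<psi> x)\<^sup>2)"
    by (simp add: measure_restrict_space)
  also have "(LINT x|?N. (\<psi> x)\<^sup>2) \<le> (LINT x|M. (norm (\<psi> x))\<^sup>2)"
  proof -
    have [measurable]: "\<psi> \<in> borel_measurable borel" by (rule C1_measurable[OF C])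
    have i: "integrable lborel (\<lambda>x. (\<psi> x)\<^sup>2)"
      by (rule integrable_compact_support[OF _ _ S(1)]) (auto intro!: continuous_intros c simp: S)
    have "(LINT x|?N. (\<psi> x)\<^sup>2) = (LINT x|lborel. indicator (cbox u v) x *\<^sub>R (\<psi> x)\<^sup>2)"
      by (subst integral_restrict_space) (auto intro!: integral_completion)
    also have "\<dots> \<le> (LINT x|lborel. (\<psi> x)\<^sup>2)"
      by (rule integral_mono[OF integrable_mult_indicator[OF _ i] i]) (auto simp: indicator_def)
    also have "\<dots> = (LINT x|M. (\<psi> x)\<^sup>2)"
      by (rule lebesgue_on_eq_lborel[symmetric]) (use S in auto)
    finally show ?thesis by simp
  qed
  finally show ?thesis by (simp add: mult_left_mono)
qed

text \<open>On a fine division a bounded sequence is determined up to a small error by its averages over the finitely many boxes,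
  and these are bounded, hence converge along a subsequence.\<close>

lemma rellich_step:
  fixes \<phi> :: "nat \<Rightarrow> real^'n \<Rightarrow> real"
  assumes \<phi>: "\<And>k. \<phi> k \<in> test_functions \<Omega>"
    and A: "\<And>k. (LINT x|M. (norm (\<phi> k x))\<^sup>2) \<le> A" "\<And>k. (LINT x|M. (norm (grad (\<phi> k) x))\<^sup>2) \<le> A"
    and e: "0 < e"
  shows "\<exists>r :: nat \<Rightarrow> nat. strict_mono r \<and> (\<forall>i j. (LINT x|M. (norm (\<phi> (r i) x - \<phi> (r j) x))\<^sup>2) < e)"
proof -
  have A0: "0 \<le> A" using integral_norm_sq_nonneg A(1) order_trans by blast
  obtain a b where box: "\<Omega> \<subseteq> cbox a b" using bounded_subset_cbox_symmetric[OF bounded_dom] by blast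
  \<comment> \<open>The error terms add up to \<open>e / 2\<close> from the averages and \<open>\<delta>\<^sup>2 Q = e / 2\<close> from the gradients; \<open>A + 1\<close> keeps \<open>Q\<close> positive.\<close>
  define Q where "Q = 16 * 2 ^ CARD('n) * (A + 1)"
  have Q: "0 < Q" using A0 by (simp add: Q_def)
  define \<delta> where "\<delta> = sqrt (e / (2 * Q))"
  have \<delta>: "0 < \<delta>" "\<delta>\<^sup>2 = e / (2 * Q)" using e Q by (auto simp: \<delta>_def)
  obtain \<D> where D': "\<D> division_of (cbox a b)" "\<forall>K\<in>\<D>. \<forall>x\<in>K. \<forall>y\<in>K. norm (x - y) \<le> 2 * \<delta>"
    using fine_box_division[OF \<delta>(1), of a b] by blast
  have D: "\<D> division_of (cbox a b)" "\<And>K x y. K \<in> \<D> \<Longrightarrow> x \<in> K \<Longrightarrow> y \<in> K \<Longrightarrow> norm (x - y) \<le> 2 * \<delta>"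
    using D' by auto
  define c where "c K k = (LINT x|lebesgue_on K. \<phi> k x)" for K and k :: nat
  have "bounded (range (c K))" if K: "K \<in> \<D>" for K
  proof -
    obtain u v where uv: "K = cbox u v" using division_ofD(4)[OF D(1) K] by blast
    have "\<bar>c K k\<bar> \<le> sqrt (measure lebesgue K * A)" for k
    proof (rule real_le_rsqrt)
      have "(c K k)\<^sup>2 \<le> measure lebesgue K * (LINT x|M. (norm (\<phi> k x))\<^sup>2)"
        unfolding c_def uv by (rule box_average_bounded[OF \<phi>])
      also have "\<dots> \<le> measure lebesgue K * A" by (intro mult_left_mono A) simp
      finally show "\<bar>c K k\<bar>\<^sup>2 \<le> measure lebesgue K * A" by simp
    qed
    then show ?thesis by (auto simp: bounded_iff)
  qed
  then obtain s where s: "strict_mono s" "\<And>K. K \<in> \<D> \<Longrightarrow> convergent (\<lambda>k. c K (s k))"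
    using simultaneous_convergent_subseq[OF division_of_finite[OF D(1)], of c] by blast
  define l where "l K = lim (\<lambda>k. c K (s k))" for K
  have l: "(\<lambda>k. c K (s k)) \<longlonglongrightarrow> l K" if "K \<in> \<D>" for K
    unfolding l_def using s(2)[OF that] by (simp add: convergent_LIMSEQ_iff)
  have "(\<lambda>k. \<Sum>K\<in>\<D>. (c K (s k) - l K)\<^sup>2 / measure lebesgue K) \<longlonglongrightarrow> (\<Sum>K\<in>\<D>. (l K - l K)\<^sup>2 / measure lebesgue K)"
    unfolding divide_inverse by (intro tendsto_intros l)
  then have "(\<lambda>k. \<Sum>K\<in>\<D>. (c K (s k) - l K)\<^sup>2 / measure lebesgue K) \<longlonglongrightarrow> 0" by simp
  then have "eventually (\<lambda>k. (\<Sum>K\<in>\<D>. (c K (s k) - l K)\<^sup>2 / measure lebesgue K) < e / 8) sequentially"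
    by (rule order_tendstoD) (use e in simp)
  then obtain N where N: "\<And>k. N \<le> k \<Longrightarrow> (\<Sum>K\<in>\<D>. (c K (s k) - l K)\<^sup>2 / measure lebesgue K) < e / 8"
    by (auto simp: eventually_sequentially)
  define r where "r k = s (k + N)" for k
  have "(LINT x|M. (norm (\<phi> (r i) x - \<phi> (r j) x))\<^sup>2) < e" for i j
  proof -
    let ?\<psi> = "\<lambda>x. \<phi> (r i) x - \<phi> (r j) x"
    have t: "?\<psi> \<in> test_functions \<Omega>" by (rule test_diff[OF \<phi> \<phi>])
    have g: "(LINT x|M. (norm (grad ?\<psi> x))\<^sup>2) \<le> 4 * A"
    proof -
      have "grad ?\<psi> x = grad (\<phi> (r i)) x + (-1) *\<^sub>R grad (\<phi> (r j)) x" for x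
        using grad_diff[OF test_C1[OF \<phi>] test_C1[OF \<phi>]] by simp
      then have "(LINT x|M. (norm (grad ?\<psi> x))\<^sup>2) \<le> 2 * (LINT x|M. (norm (grad (\<phi> (r i)) x))\<^sup>2)
          + 2 * (LINT x|M. (norm ((-1) *\<^sub>R grad (\<phi> (r j)) x))\<^sup>2)"
        using integral_norm_sq_le[OF test_sqint(2)[OF \<phi>] sqint_scale[OF test_sqint(2)[OF \<phi>], of "-1"], of "r i" "r j"] by simp
      then show ?thesis using A(2)[of "r i"] A(2)[of "r j"] by simp
    qed
    have cd: "(LINT x|lebesgue_on K. ?\<psi> x) = c K (r i) - c K (r j)" if K: "K \<in> \<D>" for K
    proof -
      obtain u v where uv: "K = cbox u v" using division_ofD(4)[OF D(1) K] by blast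
      have "integrable (lebesgue_on K) (\<phi> k)" for k
        unfolding uv by (rule continuous_imp_integrable) (rule continuous_on_subset[OF C1_continuous[OF test_C1[OF \<phi>]]], simp)
      then show ?thesis by (simp add: c_def)
    qed
    have "(LINT x|M. (norm (?\<psi> x))\<^sup>2) \<le> (\<Sum>K\<in>\<D>. (LINT x|lebesgue_on K. ?\<psi> x)\<^sup>2 / measure lebesgue K)
       + (2 * \<delta>)\<^sup>2 * 2 ^ CARD('n) * (LINT x|M. (norm (grad ?\<psi> x))\<^sup>2)"
      by (rule test_poincare_boxes[OF t box D])
    also have "(\<Sum>K\<in>\<D>. (LINT x|lebesgue_on K. ?\<psi> x)\<^sup>2 / measure lebesgue K)
        \<le> (\<Sum>K\<in>\<D>. 2 * ((c K (r i) - l K)\<^sup>2 / measure lebesgue K) + 2 * ((c K (r j) - l K)\<^sup>2 / measure lebesgue K))"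
    proof (rule sum_mono)
      fix K assume K: "K \<in> \<D>"
      have "(c K (r i) - c K (r j))\<^sup>2 \<le> 2 * (c K (r i) - l K)\<^sup>2 + 2 * (c K (r j) - l K)\<^sup>2"
        using norm_add_sq_le[of "c K (r i) - l K" "l K - c K (r j)"] by (simp add: power2_commute)
      from divide_right_mono[OF this, of "measure lebesgue K"]
      show "(LINT x|lebesgue_on K. ?\<psi> x)\<^sup>2 / measure lebesgue K
         \<le> 2 * ((c K (r i) - l K)\<^sup>2 / measure lebesgue K) + 2 * ((c K (r j) - l K)\<^sup>2 / measure lebesgue K)"
        unfolding cd[OF K] by (simp add: add_divide_distrib)
    qed
    also have "\<dots> = 2 * (\<Sum>K\<in>\<D>. (c K (r i) - l K)\<^sup>2 / measure lebesgue K) + 2 * (\<Sum>K\<in>\<D>. (c K (r j) - l K)\<^sup>2 / measure lebesgue K)"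
      by (simp add: sum.distrib sum_distrib_left)
    also have "\<dots> < 2 * (e / 8) + 2 * (e / 8)"
      using N[of "i + N"] N[of "j + N"] by (simp add: r_def)
    also have "(2 * \<delta>)\<^sup>2 * 2 ^ CARD('n) * (LINT x|M. (norm (grad ?\<psi> x))\<^sup>2) \<le> (2 * \<delta>)\<^sup>2 * 2 ^ CARD('n) * (4 * (A + 1))"
      by (intro mult_left_mono) (use g in auto)
    also have "\<dots> = \<delta>\<^sup>2 * Q" by (simp add: Q_def power_mult_distrib)
    also have "\<dots> = e / 2" using \<delta>(2) Q by simp
    finally show ?thesis by simp
  qed
  then show ?thesis
    by (intro exI[of _ r] conjI allI) (use s(1) in \<open>simp add: r_def strict_mono_def\<close>)
qed

text \<open>The smallness \<open>1 / (n + 1)\<close> for all \<open>n\<close> is achieved by a diagonal sequence, which is therefore Cauchy.\<close>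

lemma rellich_test:
  fixes \<phi> :: "nat \<Rightarrow> real^'n \<Rightarrow> real"
  assumes \<phi>: "\<And>k. \<phi> k \<in> test_functions \<Omega>"
    and A: "\<And>k. (LINT x|M. (norm (\<phi> k x))\<^sup>2) \<le> A" "\<And>k. (LINT x|M. (norm (grad (\<phi> k) x))\<^sup>2) \<le> A"
  shows "\<exists>r y. strict_mono r \<and> sqlim M (\<lambda>k. \<phi> (r k)) y"
proof -
  define P where "P n s \<longleftrightarrow> (\<forall>i j. (LINT x|M. (norm (\<phi> (s i) x - \<phi> (s j) x))\<^sup>2) < 1 / real (Suc n))" for n and s :: "nat \<Rightarrow> nat"
  interpret subseqs P
  proof
    fix n s assume "strict_mono (s :: nat \<Rightarrow> nat)"
    show "\<exists>r'. strict_mono r' \<and> P n (s \<circ> r')"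
      using rellich_step[of "\<lambda>k. \<phi> (s k)" A "1 / real (Suc n)"] \<phi> A by (auto simp: P_def)
  qed
  have h: "P n (diagseq \<circ> ((+) (Suc n)))" for n by (rule diagseq_holds) (auto simp: P_def)
  have C: "\<exists>N. \<forall>i\<ge>N. \<forall>j\<ge>N. (LINT x|M. (norm (\<phi> (diagseq i) x - \<phi> (diagseq j) x))\<^sup>2) < e" if e: "0 < e" for e
  proof -
    obtain n where n: "1 / real (Suc n) < e" using nat_approx_posE[OF e] by blast
    have "(LINT x|M. (norm (\<phi> (diagseq i) x - \<phi> (diagseq j) x))\<^sup>2) < e" if "Suc n \<le> i" "Suc n \<le> j" for i j
    proof -
      have "(LINT x|M. (norm (\<phi> (diagseq (Suc n + (i - Suc n))) x - \<phi> (diagseq (Suc n + (j - Suc n))) x))\<^sup>2) < 1 / real (Suc n)"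
        using h[of n] unfolding P_def o_def by blast
      then show ?thesis using that n by simp
    qed
    then show ?thesis by blast
  qed
  have s: "\<And>k. sqint M (\<phi> (diagseq k))" by (rule test_sqint(1)[OF \<phi>])
  obtain y where "sqlim M (\<lambda>k. \<phi> (diagseq k)) y" by (rule sqint_complete[OF s C])
  then show ?thesis using subseq_diagseq by blast
qed

lemma rellich:
  fixes y :: "nat \<Rightarrow> real^'n \<Rightarrow> real"
  assumes H: "\<And>k. H0 (y k) (g k)"
    and A: "\<And>k. (LINT x|M. (norm (y k x))\<^sup>2) \<le> A" "\<And>k. (LINT x|M. (norm (g k x))\<^sup>2) \<le> A"
  shows "\<exists>r y'. strict_mono r \<and> sqlim M (\<lambda>k. y (r k)) y'"
proof -
  obtain \<phi> where \<phi>: "\<And>k. \<phi> k \<in> test_functions \<Omega>" "\<And>k. (LINT x|M. (norm (\<phi> k x - y k x))\<^sup>2) < 1 / real (Suc k)"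
     "\<And>k. (LINT x|M. (norm (grad (\<phi> k) x - g k x))\<^sup>2) < 1 / real (Suc k)"
    using H0_approx_sequence[of y g, OF H] by blast
  have le1: "1 / real (Suc k) \<le> 1" for k by simp
  have b1: "(LINT x|M. (norm (\<phi> k x))\<^sup>2) \<le> 2 + 2 * A" for k
    using integral_norm_sq_le[OF sqint_diff[OF test_sqint(1)[OF \<phi>(1)[of k]] H0_sqint(1)[OF H[of k]]] H0_sqint(1)[OF H[of k]], unfolded diff_add_cancel]
      A(1)[of k] less_imp_le[OF \<phi>(2)[of k]] le1[of k] by linarith
  have b2: "(LINT x|M. (norm (grad (\<phi> k) x))\<^sup>2) \<le> 2 + 2 * A" for k
    using integral_norm_sq_le[OF sqint_diff[OF test_sqint(2)[OF \<phi>(1)[of k]] H0_sqint(2)[OF H[of k]]] H0_sqint(2)[OF H[of k]], unfolded diff_add_cancel]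
      A(2)[of k] less_imp_le[OF \<phi>(3)[of k]] le1[of k] by linarith
  obtain r y' where r: "strict_mono r" "sqlim M (\<lambda>k. \<phi> (r k)) y'" using rellich_test[of \<phi>, OF \<phi>(1) b1 b2] by blast
  have "sqlim M (\<lambda>k. y (r k)) y'"
  proof (rule sqlim_close[OF r(2) H0_sqint(1)[OF H]])
    show "(LINT x|M. (norm (y (r k) x - \<phi> (r k) x))\<^sup>2) \<le> 1 / real (Suc (r k))" for k
      using less_imp_le[OF \<phi>(2)[of "r k"]] by (simp add: power2_commute)
    have "(\<lambda>k. 1 / real (Suc k)) \<longlonglongrightarrow> 0" by (rule LIMSEQ_Suc[OF lim_1_over_n])
    from LIMSEQ_subseq_LIMSEQ[OF this r(1)] show "(\<lambda>k. 1 / real (Suc (r k))) \<longlonglongrightarrow> 0" by (simp add: o_def)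
  qed
  with r(1) show ?thesis by blast
qed

end


section \<open>The Dirichlet form and its minimizers\<close>


lemma mat_mult_vec: "mat c *v v = c *\<^sub>R (v :: real^'n)"
  by (simp add: vec_eq_iff matrix_vector_mult_def mat_def if_distrib[where f = "\<lambda>x. x * _"] cong: if_cong)

lemma
  assumes A: "A \<in> matrix_interval \<mu>0 \<mu>1"
  shows matrix_interval_sym: "(A *v u) \<bullet> v = u \<bullet> (A *v v)"
    and matrix_interval_lower: "\<mu>0 * (norm u)\<^sup>2 \<le> (A *v u) \<bullet> u"
    and matrix_interval_upper: "(A *v u) \<bullet> u \<le> \<mu>1 * (norm u)\<^sup>2"
proof -
  have "transpose A = A" using A by (simp add: matrix_interval_def sym_matrices_def)
  then show "(A *v u) \<bullet> v = u \<bullet> (A *v v)" by (metis dot_lmul_matrix transpose_matrix_vector)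
  have "0 \<le> ((A - mat \<mu>0) *v u) \<bullet> u" "0 \<le> ((mat \<mu>1 - A) *v u) \<bullet> u"
    using A by (simp_all add: matrix_interval_def loewner_le_def pos_semidef_def)
  then show "\<mu>0 * (norm u)\<^sup>2 \<le> (A *v u) \<bullet> u" "(A *v u) \<bullet> u \<le> \<mu>1 * (norm u)\<^sup>2"
    by (simp_all add: matrix_vector_mult_diff_rdistrib mat_mult_vec inner_diff_left power2_norm_eq_inner)
qed

text \<open>Young's inequality: the quadratic form of \<open>A\<close> is nonnegative at \<open>s u - v\<close>.\<close>

lemma matrix_interval_young:
  assumes A: "A \<in> matrix_interval \<mu>0 \<mu>1" and "0 \<le> \<mu>0" "0 < s"
  shows "2 * ((A *v u) \<bullet> v) \<le> s * ((A *v u) \<bullet> u) + ((A *v v) \<bullet> v) / s"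
proof -
  have "0 \<le> \<mu>0 * (norm (s *\<^sub>R u - v))\<^sup>2" using assms by simp
  also have "\<dots> \<le> (A *v (s *\<^sub>R u - v)) \<bullet> (s *\<^sub>R u - v)" by (rule matrix_interval_lower[OF A])
  also have "\<dots> = s * (s * ((A *v u) \<bullet> u) + ((A *v v) \<bullet> v) / s - 2 * ((A *v u) \<bullet> v))"
  proof -
    have "(A *v v) \<bullet> u = (A *v u) \<bullet> v" using matrix_interval_sym[OF A, of v u] by (simp add: inner_commute)
    then show ?thesis
      using \<open>0 < s\<close> by (simp add: matrix_vector_mult_diff_distrib matrix_vector_mult_scaleR inner_simps algebra_simps)
  qed
  finally show ?thesis using \<open>0 < s\<close> by (simp add: zero_le_mult_iff)
qed

text \<open>Young's inequality with \<open>v = A u\<close> and \<open>s = \<mu>1\<close> turns the bound on the quadratic form into one on the operator norm.\<close>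

lemma matrix_interval_norm:
  assumes A: "A \<in> matrix_interval \<mu>0 \<mu>1" and "0 < \<mu>0" "\<mu>0 \<le> \<mu>1"
  shows "norm (A *v u) \<le> \<mu>1 * norm u"
proof -
  let ?w = "A *v u"
  have m: "0 < \<mu>1" using assms by simp
  have "2 * (?w \<bullet> ?w) \<le> \<mu>1 * (?w \<bullet> u) + ((A *v ?w) \<bullet> ?w) / \<mu>1"
    by (rule matrix_interval_young[OF A]) (use assms in auto)
  also have "\<dots> \<le> \<mu>1 * (\<mu>1 * (norm u)\<^sup>2) + (\<mu>1 * (norm ?w)\<^sup>2) / \<mu>1"
    using m by (intro add_mono mult_left_mono divide_right_mono matrix_interval_upper[OF A]) auto
  also have "\<dots> = (\<mu>1 * norm u)\<^sup>2 + (norm ?w)\<^sup>2" using m by (simp add: power2_eq_square)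
  finally have "(norm ?w)\<^sup>2 \<le> (\<mu>1 * norm u)\<^sup>2" by (simp add: power2_norm_eq_inner)
  then show ?thesis by (rule power2_le_imp_le) (use m in simp)
qed

lemma continuous_matrix_vector_mult:
  "continuous_on UNIV (\<lambda>p :: (real^'n^'m) \<times> (real^'n). fst p *v snd p)"
  unfolding matrix_vector_mult_def by (intro continuous_intros)

lemma borel_measurable_matrix_vector_mult:
  assumes "(a :: 'a \<Rightarrow> real^'n^'m) \<in> borel_measurable N" "g \<in> borel_measurable N"
  shows "(\<lambda>x. a x *v g x) \<in> borel_measurable N"
  by (rule borel_measurable_continuous_Pair[OF assms]) (rule continuous_matrix_vector_mult)

lemma exists_bump:
  assumes "open \<Omega>" "p \<in> \<Omega>"
  obtains r where "0 < r" "cball p r \<subseteq> \<Omega>" "bump p r \<in> test_functions \<Omega>"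
proof -
  obtain r where r: "0 < r" "cball p r \<subseteq> \<Omega>" using assms open_contains_cball by blast
  have "bump p r \<in> test_functions \<Omega>"
    by (rule test_functionsI[OF smooth_bump compact_cball r(2)]) (rule bump_zero[OF r(1)], auto)
  with r that show ?thesis by blast
qed

locale elliptic = bounded_domain \<Omega> for \<Omega> :: "(real^'n) set" +
  fixes \<mu>0 \<mu>1 :: real
  assumes \<mu>: "0 < \<mu>0" "\<mu>0 \<le> \<mu>1"
begin

abbreviation coefs :: "(real^'n \<Rightarrow> real^'n^'n) set" where "coefs \<equiv> coefficients \<Omega> \<mu>0 \<mu>1"

abbreviation lam :: "(real^'n \<Rightarrow> real^'n^'n) \<Rightarrow> real" where "lam \<equiv> principal_eigenvalue \<Omega>"

text \<open>The Dirichlet form of the coefficient \<open>a\<close>, as a function of gradients.\<close>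

definition E :: "(real^'n \<Rightarrow> real^'n^'n) \<Rightarrow> (real^'n \<Rightarrow> real^'n) \<Rightarrow> (real^'n \<Rightarrow> real^'n) \<Rightarrow> real" where
  "E a g h = (LINT x|M. (a x *v g x) \<bullet> h x)"

lemma coefsD: "a \<in> coefs \<Longrightarrow> x \<in> \<Omega> \<Longrightarrow> a x \<in> matrix_interval \<mu>0 \<mu>1"
  and coefs_measurable: "a \<in> coefs \<Longrightarrow> a \<in> borel_measurable M"
  by (auto simp: coefficients_def)

lemma \<mu>1_pos: "0 < \<mu>1" using \<mu> by simp

lemma sqint_apply:
  assumes a: "a \<in> coefs" and g: "sqint M g" shows "sqint M (\<lambda>x. a x *v g x)"
proof (rule sqint_dominated[OF sqint_scale[OF g, of \<mu>1]])
  show "(\<lambda>x. a x *v g x) \<in> borel_measurable M"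
    by (rule borel_measurable_matrix_vector_mult[OF coefs_measurable[OF a] sqint_measurable[OF g]])
  show "AE x in M. norm (a x *v g x) \<le> norm (\<mu>1 *\<^sub>R g x)"
    using matrix_interval_norm[OF coefsD[OF a] \<mu>] \<mu>1_pos by (intro AE_I2) simp
qed

lemma sqlim_apply:
  assumes a: "a \<in> coefs" and g: "sqlim M g g'" shows "sqlim M (\<lambda>k x. a x *v g k x) (\<lambda>x. a x *v g' x)"
proof (rule sqlim_dominated_diff[OF g])
  show "(\<lambda>x. a x *v g k x) \<in> borel_measurable M" for k
    by (rule sqint_measurable[OF sqint_apply[OF a sqlimD(1)[OF g]]])
  show "AE x in M. norm (a x *v g k x - a x *v g' x) \<le> \<mu>1 * norm (g k x - g' x)" for k
    using matrix_interval_norm[OF coefsD[OF a] \<mu>]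
    by (intro AE_I2) (simp add: matrix_vector_mult_diff_distrib[symmetric])
qed (rule sqint_apply[OF a sqlimD(2)[OF g]])

lemma E_integrable: "a \<in> coefs \<Longrightarrow> sqint M g \<Longrightarrow> sqint M h \<Longrightarrow> integrable M (\<lambda>x. (a x *v g x) \<bullet> h x)"
  by (intro sqint_inner_integrable sqint_apply)

lemma E_tendsto: "a \<in> coefs \<Longrightarrow> sqlim M g g' \<Longrightarrow> sqlim M h h' \<Longrightarrow> (\<lambda>k. E a (g k) (h k)) \<longlonglongrightarrow> E a g' h'"
  unfolding E_def by (intro sqlim_inner sqlim_apply)

lemma E_sym:
  assumes "a \<in> coefs" shows "E a g h = E a h g"
  unfolding E_def
proof (intro Bochner_Integration.integral_cong refl)
  fix x assume "x \<in> space M"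
  then show "(a x *v g x) \<bullet> h x = (a x *v h x) \<bullet> g x"
    using matrix_interval_sym[OF coefsD[OF assms], of x "g x" "h x"] by (simp add: inner_commute)
qed

lemma E_add_scale_left:
  assumes "a \<in> coefs" "sqint M g" "sqint M h" "sqint M f"
  shows "E a (\<lambda>x. g x + t *\<^sub>R h x) f = E a g f + t * E a h f"
  using E_integrable[OF assms(1,2,4)] E_integrable[OF assms(1,3,4)]
  by (simp add: E_def matrix_vector_right_distrib matrix_vector_mult_scaleR inner_add_left)

lemma E_add_scale_right:
  assumes "a \<in> coefs" "sqint M g" "sqint M h" "sqint M f"
  shows "E a f (\<lambda>x. g x + t *\<^sub>R h x) = E a f g + t * E a f h"
  using E_add_scale_left[OF assms] E_sym[OF assms(1)] by simp

lemma E_quadratic: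
  assumes "a \<in> coefs" "sqint M g" "sqint M h"
  shows "E a (\<lambda>x. g x + t *\<^sub>R h x) (\<lambda>x. g x + t *\<^sub>R h x) = E a g g + 2 * t * E a g h + t\<^sup>2 * E a h h"
proof -
  have s: "sqint M (\<lambda>x. g x + t *\<^sub>R h x)" by (intro sqint_add sqint_scale assms)
  show ?thesis
    by (simp add: E_add_scale_left[OF assms s] E_add_scale_right[OF assms assms(2)] E_add_scale_right[OF assms assms(3)]
      E_sym[OF assms(1), of h g] power2_eq_square algebra_simps)
qed

lemma E_bounds:
  assumes "a \<in> coefs" "sqint M g"
  shows "\<mu>0 * (LINT x|M. (norm (g x))\<^sup>2) \<le> E a g g" "E a g g \<le> \<mu>1 * (LINT x|M. (norm (g x))\<^sup>2)"
proof -
  have i: "integrable M (\<lambda>x. c * (norm (g x))\<^sup>2)" for c by (simp add: sqint_integrable[OF assms(2)])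
  have "(LINT x|M. \<mu>0 * (norm (g x))\<^sup>2) \<le> E a g g"
    unfolding E_def by (rule integral_mono[OF i E_integrable[OF assms assms(2)]]) (simp add: matrix_interval_lower[OF coefsD[OF assms(1)]])
  then show "\<mu>0 * (LINT x|M. (norm (g x))\<^sup>2) \<le> E a g g" by simp
  have "E a g g \<le> (LINT x|M. \<mu>1 * (norm (g x))\<^sup>2)"
    unfolding E_def by (rule integral_mono[OF E_integrable[OF assms assms(2)] i]) (simp add: matrix_interval_upper[OF coefsD[OF assms(1)]])
  then show "E a g g \<le> \<mu>1 * (LINT x|M. (norm (g x))\<^sup>2)" by simp
qed

lemma E_nonneg: "a \<in> coefs \<Longrightarrow> sqint M g \<Longrightarrow> 0 \<le> E a g g"
  by (rule order_trans[OF mult_nonneg_nonneg[OF less_imp_le[OF \<mu>(1)] integral_norm_sq_nonneg] E_bounds(1)])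

lemma E_cong_AE:
  assumes "a \<in> coefs" "b \<in> coefs" "AE x in M. a x = b x" "AE x in M. g x = g' x" "AE x in M. h x = h' x"
    "sqint M g" "sqint M g'" "sqint M h" "sqint M h'"
  shows "E a g h = E b g' h'"
  unfolding E_def
proof (rule integral_cong_AE)
  show "AE x in M. (a x *v g x) \<bullet> h x = (b x *v g' x) \<bullet> h' x"
    using assms(3-5) by eventually_elim simp
qed (rule borel_measurable_integrable[OF E_integrable[OF assms(1,6,8)]]
    borel_measurable_integrable[OF E_integrable[OF assms(2,7,9)]])+

definition rayleigh_set :: "(real^'n \<Rightarrow> real) set" where
  "rayleigh_set = {y \<in> W12_0 \<Omega>. \<not> (AE x in M. y x = 0)}"

lemma lam_eq: "lam a = (INF y\<in>rayleigh_set. E a (weak_grad \<Omega> y) (weak_grad \<Omega> y) / (L2_norm \<Omega> y)\<^sup>2)"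
  by (simp add: principal_eigenvalue_def rayleigh_set_def E_def)

lemma L2_norm_sq: "(L2_norm \<Omega> f)\<^sup>2 = (LINT x|M. (norm (f x))\<^sup>2)"
  by (simp add: L2_norm_def integral_norm_sq_nonneg)

lemma rayleigh_bdd:
  assumes "a \<in> coefs"
  shows "bdd_below ((\<lambda>y. E a (weak_grad \<Omega> y) (weak_grad \<Omega> y) / (L2_norm \<Omega> y)\<^sup>2) ` rayleigh_set)"
proof (rule bdd_belowI2[where m = 0])
  fix y assume "y \<in> rayleigh_set"
  then have "H0 y (weak_grad \<Omega> y)" by (intro W12_0_imp_H0) (simp add: rayleigh_set_def)
  then show "0 \<le> E a (weak_grad \<Omega> y) (weak_grad \<Omega> y) / (L2_norm \<Omega> y)\<^sup>2"
    using E_nonneg[OF assms H0_sqint(2)] by simp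
qed

lemma H0_nontrivial: "\<exists>y g. H0 y g \<and> \<not> (AE x in M. y x = 0)"
proof -
  obtain p where p: "p \<in> \<Omega>" using nonempty_dom by blast
  obtain r where r: "0 < r" "cball p r \<subseteq> \<Omega>" "bump p r \<in> test_functions \<Omega>" using exists_bump[OF open_dom p] by metis
  have "\<not> (AE x in M. bump p r x = 0)"
  proof
    assume "AE x in M. bump p r x = 0"
    then have "AE x in lebesgue. x \<in> \<Omega> \<longrightarrow> bump p r x = 0" by (simp add: AE_restrict_space_iff)
    then have "AE x in lebesgue. x \<notin> ball p r"
    proof (rule eventually_mono)
      fix x assume x: "x \<in> \<Omega> \<longrightarrow> bump p r x = 0"
      show "x \<notin> ball p r"
      proof
        assume b: "x \<in> ball p r"
        then have "x \<in> \<Omega>" using r(2) ball_subset_cball by blast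
        with x b bump_pos_iff[OF r(1), of p x] show False by simp
      qed
    qed
    then have "ball p r \<in> null_sets lebesgue" by (simp add: AE_iff_null_sets)
    then have "negligible (ball p r)" by (simp add: negligible_iff_null_sets)
    then show False using open_not_negligible[of "ball p r"] r(1) by simp
  qed
  then show ?thesis using H0_test[OF r(3)] by blast
qed

lemma rayleigh_nonempty: "rayleigh_set \<noteq> {}"
  using H0_nontrivial H0_imp_W12_0(1) by (auto simp: rayleigh_set_def)

lemma lam_le:
  assumes a: "a \<in> coefs" and H: "H0 y g"
  shows "lam a * (LINT x|M. (norm (y x))\<^sup>2) \<le> E a g g"
proof (cases "AE x in M. y x = 0")
  case True
  then have "(LINT x|M. (norm (y x))\<^sup>2) = 0" using sqint_zero_iff[OF H0_sqint(1)[OF H]] by simp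
  then show ?thesis using E_nonneg[OF a H0_sqint(2)[OF H]] by simp
next
  case False
  have y: "y \<in> W12_0 \<Omega>" and g: "AE x in M. weak_grad \<Omega> y x = g x" using H0_imp_W12_0[OF H] by auto
  have n: "(LINT x|M. (norm (y x))\<^sup>2) \<noteq> 0" using False sqint_zero_iff[OF H0_sqint(1)[OF H]] by simp
  then have n: "0 < (LINT x|M. (norm (y x))\<^sup>2)" using integral_norm_sq_nonneg[of M y] by linarith
  have e: "E a (weak_grad \<Omega> y) (weak_grad \<Omega> y) = E a g g"
    using H0_sqint(2)[OF W12_0_imp_H0[OF y]] H0_sqint(2)[OF H] g a by (intro E_cong_AE) auto
  have "lam a \<le> E a (weak_grad \<Omega> y) (weak_grad \<Omega> y) / (L2_norm \<Omega> y)\<^sup>2"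
    unfolding lam_eq by (rule cINF_lower[OF rayleigh_bdd[OF a]]) (use y False in \<open>simp add: rayleigh_set_def\<close>)
  then show ?thesis unfolding e L2_norm_sq using n by (simp add: pos_le_divide_eq)
qed

text \<open>The Rayleigh quotient is invariant under scaling, so normalized functions suffice for lower bounds.\<close>

lemma lam_greatest:
  assumes a: "a \<in> coefs" and c: "\<And>y g. H0 y g \<Longrightarrow> (LINT x|M. (norm (y x))\<^sup>2) = 1 \<Longrightarrow> c \<le> E a g g"
  shows "c \<le> lam a"
  unfolding lam_eq
proof (rule cINF_greatest[OF rayleigh_nonempty])
  fix y assume y: "y \<in> rayleigh_set"
  let ?g = "weak_grad \<Omega> y" and ?n = "LINT x|M. (norm (y x))\<^sup>2"
  have H: "H0 y ?g" using y by (intro W12_0_imp_H0) (simp add: rayleigh_set_def)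
  have "?n \<noteq> 0" using y sqint_zero_iff[OF H0_sqint(1)[OF H]] by (simp add: rayleigh_set_def)
  then have n: "0 < ?n" using integral_norm_sq_nonneg[of M y] by linarith
  define s where "s = 1 / sqrt ?n"
  have s: "s\<^sup>2 = 1 / ?n" using n by (simp add: s_def power_divide)
  have "(LINT x|M. (norm (s * y x))\<^sup>2) = 1" using n s by (simp add: norm_mult power_mult_distrib)
  then have "c \<le> E a (\<lambda>x. s *\<^sub>R ?g x) (\<lambda>x. s *\<^sub>R ?g x)" by (rule c[OF H0_scale[OF H]])
  also have "\<dots> = s\<^sup>2 * E a ?g ?g"
    using E_quadratic[OF a sqint_zero H0_sqint(2)[OF H], of s] by (simp add: E_def)
  finally show "c \<le> E a ?g ?g / (L2_norm \<Omega> y)\<^sup>2" unfolding L2_norm_sq using s by simp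
qed

lemma lam_nonneg: "a \<in> coefs \<Longrightarrow> 0 \<le> lam a"
  by (rule lam_greatest, assumption) (rule E_nonneg[OF _ H0_sqint(2)])

lemma minimizing_sequence_exists:
  assumes a: "a \<in> coefs"
  shows "\<exists>y g. (\<forall>k. H0 (y k) (g k)) \<and> (\<forall>k. (LINT x|M. (norm (y k x))\<^sup>2) = 1) \<and> (\<lambda>k. E a (g k) (g k)) \<longlonglongrightarrow> lam a"
proof -
  define P where "P k z \<longleftrightarrow> H0 (fst z) (snd z) \<and> (LINT x|M. (norm (fst z x))\<^sup>2) = 1 \<and> E a (snd z) (snd z) < lam a + 1 / real (Suc k)"
    for k :: nat and z
  have "\<exists>z. P k z" for k
  proof (rule ccontr)
    assume "\<nexists>z. P k z"
    then have "lam a + 1 / real (Suc k) \<le> E a g g" if "H0 y g" "(LINT x|M. (norm (y x))\<^sup>2) = 1" for y g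
      using that unfolding P_def by (metis fst_conv not_le snd_conv)
    then have "lam a + 1 / real (Suc k) \<le> lam a" by (rule lam_greatest[OF a])
    then show False by simp
  qed
  then obtain z where z: "\<And>k. P k (z k)" by metis
  have H: "H0 (fst (z k)) (snd (z k))" and n: "(LINT x|M. (norm (fst (z k) x))\<^sup>2) = 1"
    and u: "E a (snd (z k)) (snd (z k)) < lam a + 1 / real (Suc k)" for k
    using z[of k] unfolding P_def by auto
  have lo: "lam a \<le> E a (snd (z k)) (snd (z k))" for k using lam_le[OF a H[of k]] n by simp
  have "(\<lambda>k. lam a + 1 / real (Suc k)) \<longlonglongrightarrow> lam a + 0" by (intro tendsto_intros LIMSEQ_Suc[OF lim_1_over_n])
  then have up: "(\<lambda>k. lam a + 1 / real (Suc k)) \<longlonglongrightarrow> lam a" by simp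
  have "(\<lambda>k. E a (snd (z k)) (snd (z k))) \<longlonglongrightarrow> lam a"
    by (rule tendsto_sandwich[OF always_eventually[OF allI[OF lo]]
      always_eventually[OF allI[OF less_imp_le[OF u]]] tendsto_const up])
  then show ?thesis using H n by (intro exI[of _ "\<lambda>k. fst (z k)"] exI[of _ "\<lambda>k. snd (z k)"]) simp
qed

text \<open>By the Rellich theorem a subsequence converges in \<open>L\<^sup>2\<close>. It is then Cauchy in energy by the parallelogram law, since the mean of
  two late members has norm close to \<open>1\<close> and hence energy at least almost \<open>lam a\<close>.\<close>

lemma minimizing_sequence_compact:
  fixes y :: "nat \<Rightarrow> real^'n \<Rightarrow> real"
  assumes a: "a \<in> coefs" and H: "\<And>k. H0 (y k) (g k)" and n: "\<And>k. (LINT x|M. (norm (y k x))\<^sup>2) = 1"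
    and lim: "(\<lambda>k. E a (g k) (g k)) \<longlonglongrightarrow> lam a"
  shows "\<exists>r y' g'. strict_mono r \<and> sqlim M (\<lambda>k. y (r k)) y' \<and> sqlim M (\<lambda>k. g (r k)) g' \<and> H0 y' g'
    \<and> (LINT x|M. (norm (y' x))\<^sup>2) = 1 \<and> E a g' g' = lam a"
proof -
  note sy = H0_sqint(1)[OF H] and sg = H0_sqint(2)[OF H]
  have "Bseq (\<lambda>k. E a (g k) (g k))" using lim by (rule convergentI[THEN convergent_imp_Bseq])
  then obtain B where B: "\<And>k. norm (E a (g k) (g k)) \<le> B" unfolding Bseq_def by blast
  have "(LINT x|M. (norm (g k x))\<^sup>2) \<le> B / \<mu>0" for k
    using E_bounds(1)[OF a sg[of k]] B[of k] \<mu>(1) by (simp add: pos_le_divide_eq mult.commute)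
  then have b: "(LINT x|M. (norm (g k x))\<^sup>2) \<le> max 1 (B / \<mu>0)" for k by (simp add: le_max_iff_disj)
  have b': "(LINT x|M. (norm (y k x))\<^sup>2) \<le> max 1 (B / \<mu>0)" for k unfolding n by simp
  obtain r y' where r: "strict_mono r" "sqlim M (\<lambda>k. y (r k)) y'" using rellich[of y g, OF H b' b] by blast
  define \<epsilon> where "\<epsilon> k = E a (g (r k)) (g (r k)) - lam a" for k
  have \<epsilon>0: "\<epsilon> \<longlonglongrightarrow> 0"
    using LIMSEQ_subseq_LIMSEQ[OF lim r(1)] by (simp add: \<epsilon>_def[abs_def] o_def LIM_zero_iff)
  define D where "D k = (LINT x|M. (norm (y (r k) x - y' x))\<^sup>2)" for k
  have D0: "D \<longlonglongrightarrow> 0" unfolding D_def[abs_def] by (rule sqlimD(3)[OF r(2)])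
  have key: "(LINT x|M. (norm (g (r i) x - g (r j) x))\<^sup>2) \<le> (2 * \<epsilon> i + 2 * \<epsilon> j + lam a * (2 * D i + 2 * D j)) / \<mu>0" for i j
  proof -
    let ?d = "\<lambda>x. g (r i) x + (-1) *\<^sub>R g (r j) x" and ?s = "\<lambda>x. g (r i) x + 1 *\<^sub>R g (r j) x"
    have sd: "sqint M ?d" by (intro sqint_add sqint_scale sg)
    have par: "E a ?d ?d + E a ?s ?s = 2 * E a (g (r i)) (g (r i)) + 2 * E a (g (r j)) (g (r j))"
      unfolding E_quadratic[OF a sg sg] by simp
    have Hs: "H0 (\<lambda>x. y (r i) x + y (r j) x) ?s" using H0_add[OF H H] by simp
    have pary: "(LINT x|M. (norm (y (r i) x + (-1) *\<^sub>R y (r j) x))\<^sup>2) + (LINT x|M. (norm (y (r i) x + 1 *\<^sub>R y (r j) x))\<^sup>2) = 4"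
      unfolding integral_norm_sq_add[OF sy sy] n by simp
    have "(LINT x|M. (norm ((y (r i) x - y' x) + (-1) *\<^sub>R (y (r j) x - y' x)))\<^sup>2) \<le> 2 * D i + 2 * D j"
      using integral_norm_sq_le[OF sqint_diff[OF sy sqlimD(2)[OF r(2)]] sqint_scale[OF sqint_diff[OF sy sqlimD(2)[OF r(2)]], of "-1"], of "r i" "r j"]
      by (simp add: D_def power2_commute)
    moreover have "(y (r i) x - y' x) + (-1) *\<^sub>R (y (r j) x - y' x) = y (r i) x + (-1) *\<^sub>R y (r j) x" for x by simp
    ultimately have dy: "(LINT x|M. (norm (y (r i) x + (-1) *\<^sub>R y (r j) x))\<^sup>2) \<le> 2 * D i + 2 * D j" by simp
    have "lam a * (LINT x|M. (norm (y (r i) x + y (r j) x))\<^sup>2) \<le> E a ?s ?s" by (rule lam_le[OF a Hs])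
    moreover have "(LINT x|M. (norm (y (r i) x + y (r j) x))\<^sup>2) = 4 - (LINT x|M. (norm (y (r i) x + (-1) *\<^sub>R y (r j) x))\<^sup>2)"
      using pary by simp
    ultimately have "E a ?d ?d \<le> 2 * E a (g (r i)) (g (r i)) + 2 * E a (g (r j)) (g (r j))
        - lam a * (4 - (LINT x|M. (norm (y (r i) x + (-1) *\<^sub>R y (r j) x))\<^sup>2))"
      using par by simp
    also have "\<dots> = 2 * \<epsilon> i + 2 * \<epsilon> j + lam a * (LINT x|M. (norm (y (r i) x + (-1) *\<^sub>R y (r j) x))\<^sup>2)"
      by (simp add: \<epsilon>_def algebra_simps)
    also have "\<dots> \<le> 2 * \<epsilon> i + 2 * \<epsilon> j + lam a * (2 * D i + 2 * D j)"
      by (intro add_left_mono mult_left_mono dy lam_nonneg a)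
    finally have "\<mu>0 * (LINT x|M. (norm (?d x))\<^sup>2) \<le> 2 * \<epsilon> i + 2 * \<epsilon> j + lam a * (2 * D i + 2 * D j)"
      using E_bounds(1)[OF a sd] by linarith
    then show ?thesis using \<mu>(1) by (simp add: pos_le_divide_eq mult.commute)
  qed
  define \<eta> where "\<eta> k = (2 * \<epsilon> k + lam a * (2 * D k)) / \<mu>0" for k
  have "\<eta> \<longlonglongrightarrow> (2 * 0 + lam a * (2 * 0)) / \<mu>0"
    unfolding \<eta>_def[abs_def] by (intro tendsto_intros \<epsilon>0 D0) (use \<mu> in simp)
  then have \<eta>0: "\<eta> \<longlonglongrightarrow> 0" by simp
  have key': "(LINT x|M. (norm (g (r i) x - g (r j) x))\<^sup>2) \<le> \<eta> i + \<eta> j" for i j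
    using key[of i j] by (simp add: \<eta>_def add_divide_distrib algebra_simps)
  have C: "\<exists>N. \<forall>i\<ge>N. \<forall>j\<ge>N. (LINT x|M. (norm (g (r i) x - g (r j) x))\<^sup>2) < e" if e: "0 < e" for e
  proof -
    have "eventually (\<lambda>k. \<eta> k < e / 2) sequentially" by (rule order_tendstoD(2)[OF \<eta>0]) (use e in simp)
    then obtain N where N: "\<And>k. N \<le> k \<Longrightarrow> \<eta> k < e / 2" by (auto simp: eventually_sequentially)
    have "(LINT x|M. (norm (g (r i) x - g (r j) x))\<^sup>2) < e" if "N \<le> i" "N \<le> j" for i j
      using key'[of i j] N[OF that(1)] N[OF that(2)] by linarith
    then show ?thesis by blast
  qed
  obtain g' where g': "sqlim M (\<lambda>k. g (r k)) g'" by (rule sqint_complete[OF sg C])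
  have "H0 y' g'" by (rule H0_closed[OF H r(2) g'])
  moreover have "(LINT x|M. (norm (y' x))\<^sup>2) = 1"
    using sqlim_norm_sq[OF r(2)] n by (simp add: LIMSEQ_const_iff)
  moreover have "E a g' g' = lam a"
    using LIMSEQ_unique[OF E_tendsto[OF a g' g']] LIMSEQ_subseq_LIMSEQ[OF lim r(1)] by (simp add: o_def)
  ultimately show ?thesis using r g' by blast
qed

lemma minimizer_exists:
  assumes a: "a \<in> coefs"
  shows "\<exists>y g. H0 y g \<and> (LINT x|M. (norm (y x))\<^sup>2) = 1 \<and> E a g g = lam a"
proof -
  obtain y g where "\<And>k. H0 (y k) (g k)" "\<And>k. (LINT x|M. (norm (y k x))\<^sup>2) = 1" "(\<lambda>k. E a (g k) (g k)) \<longlonglongrightarrow> lam a"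
    using minimizing_sequence_exists[OF a] by blast
  from minimizing_sequence_compact[of a y g, OF a this] show ?thesis by blast
qed

text \<open>A weak solution of the eigenvalue equation with its gradient, without sign and norm conditions: this way the eigenpairs
  form a linear space, and the zero function belongs to it.\<close>

definition eigenpair :: "(real^'n \<Rightarrow> real^'n^'n) \<Rightarrow> (real^'n \<Rightarrow> real) \<Rightarrow> (real^'n \<Rightarrow> real^'n) \<Rightarrow> bool" where
  "eigenpair a y g \<longleftrightarrow> H0 y g \<and> (\<forall>z h. H0 z h \<longrightarrow> E a g h = lam a * (LINT x|M. y x * z x))"

lemma eigenpairD: "eigenpair a y g \<Longrightarrow> H0 y g" "eigenpair a y g \<Longrightarrow> H0 z h \<Longrightarrow> E a g h = lam a * (LINT x|M. y x * z x)"
  by (auto simp: eigenpair_def)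

lemma eigenpair_energy:
  assumes "eigenpair a y g" shows "E a g g = lam a * (LINT x|M. (norm (y x))\<^sup>2)"
  using eigenpairD(2)[OF assms eigenpairD(1)[OF assms]] by (simp add: power2_eq_square)

text \<open>The function \<open>t \<mapsto> E (y + t z) - lam \<parallel>y + t z\<parallel>\<^sup>2\<close> is a nonnegative quadratic polynomial that vanishes at \<open>0\<close>,
  so its linear coefficient is \<open>0\<close>.\<close>

lemma minimizer_eigenpair:
  assumes a: "a \<in> coefs" and H: "H0 y g" and m: "E a g g = lam a * (LINT x|M. (norm (y x))\<^sup>2)"
  shows "eigenpair a y g"
  unfolding eigenpair_def
proof (intro conjI allI impI H)
  fix z h assume Z: "H0 z h"
  note s = H0_sqint[OF H] H0_sqint[OF Z]
  have "(E a g h - lam a * (LINT x|M. y x \<bullet> z x))\<^sup>2 \<le> 0 * (E a h h - lam a * (LINT x|M. (norm (z x))\<^sup>2))"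
  proof (rule nonneg_quadratic_discriminant)
    show "0 \<le> E a h h - lam a * (LINT x|M. (norm (z x))\<^sup>2)" using lam_le[OF a Z] by simp
    fix t
    have "H0 (\<lambda>x. y x + t *\<^sub>R z x) (\<lambda>x. g x + t *\<^sub>R h x)" using H0_add[OF H H0_scale[OF Z]] by simp
    from lam_le[OF a this] show "0 \<le> 0 + 2 * t * (E a g h - lam a * (LINT x|M. y x \<bullet> z x)) + t\<^sup>2 * (E a h h - lam a * (LINT x|M. (norm (z x))\<^sup>2))"
      unfolding E_quadratic[OF a s(2,4)] integral_norm_sq_add[OF s(1,3)] m by (simp add: algebra_simps)
  qed
  then have "(E a g h - lam a * (LINT x|M. y x \<bullet> z x))\<^sup>2 \<le> 0" by simp
  then show "E a g h = lam a * (LINT x|M. y x * z x)" by simp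
qed

lemma eigenpair_lincomb:
  assumes a: "a \<in> coefs" and y: "eigenpair a y g" and z: "eigenpair a z h"
  shows "eigenpair a (\<lambda>x. y x + t * z x) (\<lambda>x. g x + t *\<^sub>R h x)"
  unfolding eigenpair_def
proof (intro conjI allI impI)
  note H = eigenpairD(1)[OF y] eigenpairD(1)[OF z]
  show "H0 (\<lambda>x. y x + t * z x) (\<lambda>x. g x + t *\<^sub>R h x)" by (intro H0_add H0_scale H)
  fix w f assume W: "H0 w f"
  note s = H0_sqint[OF H(1)] H0_sqint[OF H(2)] H0_sqint[OF W]
  have "(LINT x|M. (y x + t * z x) * w x) = (LINT x|M. y x * w x) + t * (LINT x|M. z x * w x)"
    using sqint_mult_integrable[OF s(1,5)] sqint_mult_integrable[OF s(3,5)] by (simp add: distrib_right mult.assoc)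
  then show "E a (\<lambda>x. g x + t *\<^sub>R h x) f = lam a * (LINT x|M. (y x + t * z x) * w x)"
    unfolding E_add_scale_left[OF a s(2,4,6)] eigenpairD(2)[OF y W] eigenpairD(2)[OF z W] by (simp add: algebra_simps)
qed

text \<open>The energy of \<open>\<bar>y\<bar>\<close> is at most that of \<open>y\<close>, so \<open>\<bar>y\<bar>\<close> minimizes the Rayleigh quotient as well.\<close>

lemma eigenpair_abs:
  assumes a: "a \<in> coefs" and y: "eigenpair a y g"
  shows "eigenpair a (\<lambda>x. \<bar>y x\<bar>) (\<lambda>x. sgn (y x) *\<^sub>R g x)"
proof (rule minimizer_eigenpair[OF a])
  note H = eigenpairD(1)[OF y]
  show A: "H0 (\<lambda>x. \<bar>y x\<bar>) (\<lambda>x. sgn (y x) *\<^sub>R g x)" by (rule H0_abs[OF H])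
  have "E a (\<lambda>x. sgn (y x) *\<^sub>R g x) (\<lambda>x. sgn (y x) *\<^sub>R g x) \<le> E a g g"
    unfolding E_def
  proof (rule integral_mono[OF E_integrable[OF a H0_sqint(2)[OF A] H0_sqint(2)[OF A]] E_integrable[OF a H0_sqint(2)[OF H] H0_sqint(2)[OF H]]])
    fix x assume "x \<in> space M"
    then have "0 \<le> (a x *v g x) \<bullet> g x"
      using matrix_interval_lower[OF coefsD[OF a], of x "g x"] mult_nonneg_nonneg[OF less_imp_le[OF \<mu>(1)] zero_le_power2, of "norm (g x)"] by simp
    then show "(a x *v sgn (y x) *\<^sub>R g x) \<bullet> (sgn (y x) *\<^sub>R g x) \<le> (a x *v g x) \<bullet> g x"
      by (simp add: matrix_vector_mult_scaleR sgn_real_def)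
  qed
  moreover have "lam a * (LINT x|M. (norm \<bar>y x\<bar>)\<^sup>2) \<le> E a (\<lambda>x. sgn (y x) *\<^sub>R g x) (\<lambda>x. sgn (y x) *\<^sub>R g x)"
    by (rule lam_le[OF a A])
  ultimately show "E a (\<lambda>x. sgn (y x) *\<^sub>R g x) (\<lambda>x. sgn (y x) *\<^sub>R g x) = lam a * (LINT x|M. (norm \<bar>y x\<bar>)\<^sup>2)"
    using eigenpair_energy[OF y] by simp
qed

end


section \<open>The logarithmic estimate on balls\<close>

text \<open>Pointwise form of the logarithmic Caccioppoli inequality: \<open>g\<close> stands for the gradient of \<open>w\<close>, and \<open>s\<close>, \<open>d\<close> for the cutoff
  function and its gradient. The first term of the test function gives a negative definite contribution, half of which
  absorbs the mixed term by Young's inequality.\<close>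

lemma log_caccioppoli_pointwise:
  fixes g d :: "real^'n"
  assumes A: "A \<in> matrix_interval \<mu>0 \<mu>1" and \<mu>: "0 < \<mu>0" and w: "0 \<le> w" and e: "0 < e"
  defines "R \<equiv> sqrt (w\<^sup>2 + e\<^sup>2)"
  shows "(A *v g) \<bullet> (s\<^sup>2 *\<^sub>R ((w / R - 1) *\<^sub>R g) + (R - w) *\<^sub>R ((2 * s) *\<^sub>R d))
    \<le> 2 * e\<^sup>2 * \<mu>1 * (norm d)\<^sup>2 - \<mu>0 * e\<^sup>2 / 4 * (norm ((s / R) *\<^sub>R g))\<^sup>2"
proof -
  have R2: "R\<^sup>2 = w\<^sup>2 + e\<^sup>2" by (simp add: R_def)
  have R0: "0 < R" using sqrt_regularisation(4)[OF e] by (simp add: R_def)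
  have "sqrt (w\<^sup>2) < R" unfolding R_def by (rule real_sqrt_less_mono) (use e in simp)
  then have wR: "w < R" using w by simp
  define \<kappa> where "\<kappa> = (R - w) / R"
  have \<kappa>: "0 < \<kappa>" using wR R0 by (simp add: \<kappa>_def)
  have RR: "(R - w) * (R + w) = e\<^sup>2" using R2 by (simp add: algebra_simps power2_eq_square)
  have k1: "(R - w) * R \<le> e\<^sup>2" using mult_left_mono[of R "R + w" "R - w"] RR w wR by simp
  have k2: "e\<^sup>2 / (2 * R\<^sup>2) \<le> \<kappa>"
  proof -
    have "e\<^sup>2 \<le> (R - w) * (2 * R)" unfolding RR[symmetric] using wR by (intro mult_left_mono) auto
    then show ?thesis using R0 by (simp add: \<kappa>_def field_simps power2_eq_square)
  qed
  let ?p = "(A *v g) \<bullet> g" and ?q = "(A *v d) \<bullet> d"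
  have p: "\<mu>0 * (norm g)\<^sup>2 \<le> ?p" by (rule matrix_interval_lower[OF A])
  have q: "?q \<le> \<mu>1 * (norm d)\<^sup>2" by (rule matrix_interval_upper[OF A])
  have q0: "0 \<le> ?q" using matrix_interval_lower[OF A, of d] \<mu> by (meson less_imp_le mult_nonneg_nonneg order_trans zero_le_power2)
  have Y: "2 * ((A *v (s *\<^sub>R g)) \<bullet> ((R - w) *\<^sub>R d))
     \<le> (\<kappa> / 2) * ((A *v (s *\<^sub>R g)) \<bullet> (s *\<^sub>R g)) + ((A *v ((R - w) *\<^sub>R d)) \<bullet> ((R - w) *\<^sub>R d)) / (\<kappa> / 2)"
    by (rule matrix_interval_young[OF A]) (use \<mu> \<kappa> in auto)
  have y1: "2 * ((A *v (s *\<^sub>R g)) \<bullet> ((R - w) *\<^sub>R d)) = 2 * s * (R - w) * ((A *v g) \<bullet> d)"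
    and y2: "(A *v (s *\<^sub>R g)) \<bullet> (s *\<^sub>R g) = s\<^sup>2 * ?p"
    and y3: "(A *v ((R - w) *\<^sub>R d)) \<bullet> ((R - w) *\<^sub>R d) = (R - w)\<^sup>2 * ?q"
    by (simp_all add: matrix_vector_mult_scaleR power2_eq_square)
  have y4: "(R - w)\<^sup>2 * ?q / (\<kappa> / 2) = 2 * ((R - w) * R) * ?q"
    using wR R0 by (simp add: \<kappa>_def power2_eq_square field_simps)
  have "(A *v g) \<bullet> (s\<^sup>2 *\<^sub>R ((w / R - 1) *\<^sub>R g) + (R - w) *\<^sub>R ((2 * s) *\<^sub>R d))
      = - \<kappa> * s\<^sup>2 * ?p + 2 * s * (R - w) * ((A *v g) \<bullet> d)"
  proof -
    have "w / R - 1 = - \<kappa>" using R0 by (simp add: \<kappa>_def field_simps)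
    then show ?thesis by (simp only: inner_add_right inner_scaleR_right) (simp add: algebra_simps)
  qed
  also have "\<dots> \<le> - (\<kappa> / 2) * s\<^sup>2 * ?p + 2 * ((R - w) * R) * ?q"
    using Y unfolding y1 y2 y3 y4 by (simp add: algebra_simps)
  also have "2 * ((R - w) * R) * ?q \<le> 2 * e\<^sup>2 * ?q"
    by (intro mult_right_mono mult_left_mono k1 q0) simp
  also have "2 * e\<^sup>2 * ?q \<le> 2 * e\<^sup>2 * (\<mu>1 * (norm d)\<^sup>2)" by (intro mult_left_mono q) simp
  also have "- (\<kappa> / 2) * s\<^sup>2 * ?p \<le> - (\<mu>0 * e\<^sup>2 / 4 * (norm ((s / R) *\<^sub>R g))\<^sup>2)"
  proof -
    have "(norm ((s / R) *\<^sub>R g))\<^sup>2 = s\<^sup>2 * (norm g)\<^sup>2 / R\<^sup>2" by (simp add: power_mult_distrib power_divide)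
    then have "\<mu>0 * e\<^sup>2 / 4 * (norm ((s / R) *\<^sub>R g))\<^sup>2 = (e\<^sup>2 / (2 * R\<^sup>2) / 2) * s\<^sup>2 * (\<mu>0 * (norm g)\<^sup>2)" by simp
    also have "\<dots> \<le> (\<kappa> / 2) * s\<^sup>2 * ?p"
      by (intro mult_mono divide_right_mono k2 p) (use \<kappa> \<mu> in auto)
    finally show ?thesis by simp
  qed
  finally show ?thesis by (simp add: mult.assoc)
qed

lemma (in bounded_domain) restrict_integral:
  fixes f :: "real^'n \<Rightarrow> real"
  assumes B: "B \<subseteq> \<Omega>" "B \<in> sets lebesgue" and f: "integrable M f"
  shows "integrable (lebesgue_on B) f" "(LINT x|lebesgue_on B. f x) = (LINT x|M. indicator B x * f x)"
proof -
  have BM: "B \<inter> space M \<in> sets M" using B by (auto simp: sets_restrict_space_iff Int_absorb2)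
  have e: "lebesgue_on B = restrict_space M B"
    using B by (subst restrict_restrict_space) (auto simp: Int_absorb1 sets_restrict_space_iff)
  show "integrable (lebesgue_on B) f"
    unfolding e using integrable_mult_indicator[OF _ f, of B] BM B(1)
    by (simp add: integrable_restrict_space[OF BM] Int_absorb2)
  show "(LINT x|lebesgue_on B. f x) = (LINT x|M. indicator B x * f x)"
    unfolding e by (simp add: integral_restrict_space[OF BM])
qed

lemma (in bounded_domain) restrict_integral_le:
  fixes f :: "real^'n \<Rightarrow> real"
  assumes B: "B \<subseteq> \<Omega>" "B \<in> sets lebesgue" and f: "integrable M f" and "\<And>x. 0 \<le> f x"
  shows "(LINT x|lebesgue_on B. f x) \<le> (LINT x|M. f x)"
proof -
  have "B \<in> sets M" using B by (auto simp: sets_restrict_space_iff)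
  from integrable_mult_indicator[OF this f] show ?thesis
    unfolding restrict_integral(2)[OF B f]
    by (intro integral_mono f) (auto simp: indicator_def assms)
qed

lemma (in bounded_domain) sqint_restrict:
  assumes B: "B \<subseteq> \<Omega>" "B \<in> sets lebesgue" and f: "sqint M f"
  shows "sqint (lebesgue_on B) f"
  unfolding sqint_def
proof (intro conjI)
  have e: "lebesgue_on B = restrict_space M B"
    using B by (subst restrict_restrict_space) (auto simp: Int_absorb1 sets_restrict_space_iff)
  show "f \<in> borel_measurable (lebesgue_on B)"
    unfolding e by (rule measurable_restrict_space1[OF sqint_measurable[OF f]])
qed (rule restrict_integral(1)[OF B sqint_integrable[OF f]])

lemma (in bounded_domain) sqlim_restrict:
  assumes B: "B \<subseteq> \<Omega>" "B \<in> sets lebesgue" and f: "sqlim M f g"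
  shows "sqlim (lebesgue_on B) f g"
proof (rule sqlimI_le)
  note s = sqlimD[OF f]
  show "sqint (lebesgue_on B) (f k)" for k by (rule sqint_restrict[OF B s(1)])
  show "sqint (lebesgue_on B) g" by (rule sqint_restrict[OF B s(2)])
  show "(LINT x|lebesgue_on B. (norm (f k x - g x))\<^sup>2) \<le> (LINT x|M. (norm (f k x - g x))\<^sup>2)" for k
    by (rule restrict_integral_le[OF B sqint_integrable[OF sqint_diff[OF s(1,2)]]]) simp
qed (rule sqlimD(3)[OF f])

lemma arsinh_scaled_derivative:
  assumes e: "0 < (e::real)"
  shows "((\<lambda>s. arsinh (s / e)) has_real_derivative 1 / sqrt (s\<^sup>2 + e\<^sup>2)) (at s)"
    "continuous_on UNIV (\<lambda>s. 1 / sqrt (s\<^sup>2 + e\<^sup>2))" "\<bar>1 / sqrt (s\<^sup>2 + e\<^sup>2)\<bar> \<le> 1 / e"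
proof -
  have p: "0 < sqrt (t\<^sup>2 + e\<^sup>2)" for t by (rule sqrt_regularisation(4)[OF e])
  have "sqrt ((s / e)\<^sup>2 + 1) = sqrt ((s\<^sup>2 + e\<^sup>2) / e\<^sup>2)" using e by (simp add: power_divide add_divide_distrib)
  also have "\<dots> = sqrt (s\<^sup>2 + e\<^sup>2) / e" using e by (simp add: real_sqrt_divide)
  finally have q: "1 / sqrt ((s / e)\<^sup>2 + 1) * (1 / e) = 1 / sqrt (s\<^sup>2 + e\<^sup>2)" using e by simp
  have "((\<lambda>s. arsinh (s / e)) has_real_derivative 1 / sqrt ((s / e)\<^sup>2 + 1) * (1 / e)) (at s)"
    by (rule DERIV_chain2[OF arsinh_real_has_field_derivative]) (use e in \<open>auto intro!: derivative_eq_intros\<close>)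
  then show "((\<lambda>s. arsinh (s / e)) has_real_derivative 1 / sqrt (s\<^sup>2 + e\<^sup>2)) (at s)" unfolding q .
  show "continuous_on UNIV (\<lambda>s. 1 / sqrt (s\<^sup>2 + e\<^sup>2))"
    using e by (intro continuous_intros) (simp add: sum_power2_eq_zero_iff)
  have "sqrt (e\<^sup>2) \<le> sqrt (s\<^sup>2 + e\<^sup>2)" by (rule real_sqrt_le_mono) simp
  then show "\<bar>1 / sqrt (s\<^sup>2 + e\<^sup>2)\<bar> \<le> 1 / e" using e p[of s] by (simp add: frac_le)
qed

text \<open>The function \<open>arsinh (w / e)\<close> behaves like \<open>ln (w / e)\<close> where \<open>w\<close> is large compared to \<open>e\<close>, vanishes with \<open>w\<close>, and has
  the gradient \<open>g / sqrt (w\<^sup>2 + e\<^sup>2)\<close> that the logarithmic Caccioppoli inequality controls.\<close>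

lemma (in bounded_domain) log_poincare:
  assumes H: "H0 w g" and e: "0 < e" and B: "B \<subseteq> \<Omega>" "B \<in> sets borel" "convex B"
    and d: "\<And>x y. x \<in> B \<Longrightarrow> y \<in> B \<Longrightarrow> norm (x - y) \<le> d"
  shows "sqint (lebesgue_on B) (\<lambda>x. arsinh (w x / e))"
    "measure lebesgue B * (LINT x|lebesgue_on B. (arsinh (w x / e))\<^sup>2) - (LINT x|lebesgue_on B. arsinh (w x / e))\<^sup>2
    \<le> d\<^sup>2 * 2 ^ CARD('n) * measure lebesgue B * (LINT x|lebesgue_on B. (norm ((1 / sqrt ((w x)\<^sup>2 + e\<^sup>2)) *\<^sub>R g x))\<^sup>2)"
proof -
  have Bl: "B \<in> sets lebesgue" using B(2) by simp
  have bB: "bounded B" using bounded_subset[OF bounded_dom B(1)] .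
  have "B \<in> lmeasurable" using bB Bl by (rule bounded_set_imp_lmeasurable)
  then interpret N: finite_measure "lebesgue_on B" by (rule finite_measure_lebesgue_on)
  obtain \<phi> where \<phi>: "\<And>k. \<phi> k \<in> test_functions \<Omega>" "sqlim M \<phi> w" "sqlim M (\<lambda>k. grad (\<phi> k)) g"
    "AE x in M. (\<lambda>k. \<phi> k x) \<longlonglongrightarrow> w x" using H0_AE_approx[OF H] by blast
  note F = arsinh_scaled_derivative[OF e]
  let ?u = "\<lambda>k x. arsinh (\<phi> k x / e)" and ?G = "\<lambda>x. (1 / sqrt ((w x)\<^sup>2 + e\<^sup>2)) *\<^sub>R g x"
  note l = chain_rule_limit[OF \<phi> F]
  have l1: "sqlim (lebesgue_on B) ?u (\<lambda>x. arsinh (w x / e))" by (rule sqlim_restrict[OF B(1) Bl l(1)])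
  have l2: "sqlim (lebesgue_on B) (\<lambda>k. grad (?u k)) ?G" by (rule sqlim_restrict[OF B(1) Bl l(2)])
  show "sqint (lebesgue_on B) (\<lambda>x. arsinh (w x / e))" by (rule sqlimD(2)[OF l1])
  have P: "measure lebesgue B * (LINT x|lebesgue_on B. (norm (?u k x))\<^sup>2) - (LINT x|lebesgue_on B. ?u k x)\<^sup>2
      \<le> d\<^sup>2 * 2 ^ CARD('n) * measure lebesgue B * (LINT x|lebesgue_on B. (norm (grad (?u k) x))\<^sup>2)" for k
    using poincare_C1[OF C1_compose(1)[OF test_C1[OF \<phi>(1)] F(1,2)] B(2) bB B(3) d] by simp
  have "measure lebesgue B * (LINT x|lebesgue_on B. (norm (arsinh (w x / e)))\<^sup>2) - (LINT x|lebesgue_on B. arsinh (w x / e))\<^sup>2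
    \<le> d\<^sup>2 * 2 ^ CARD('n) * measure lebesgue B * (LINT x|lebesgue_on B. (norm (?G x))\<^sup>2)"
  proof (rule LIMSEQ_le)
    show "(\<lambda>k. measure lebesgue B * (LINT x|lebesgue_on B. (norm (?u k x))\<^sup>2) - (LINT x|lebesgue_on B. ?u k x)\<^sup>2)
      \<longlonglongrightarrow> measure lebesgue B * (LINT x|lebesgue_on B. (norm (arsinh (w x / e)))\<^sup>2) - (LINT x|lebesgue_on B. arsinh (w x / e))\<^sup>2"
      by (intro tendsto_diff tendsto_mult tendsto_const tendsto_power sqlim_norm_sq[OF l1] N.sqlim_integral[OF l1])
    show "(\<lambda>k. d\<^sup>2 * 2 ^ CARD('n) * measure lebesgue B * (LINT x|lebesgue_on B. (norm (grad (?u k) x))\<^sup>2))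
      \<longlonglongrightarrow> d\<^sup>2 * 2 ^ CARD('n) * measure lebesgue B * (LINT x|lebesgue_on B. (norm (?G x))\<^sup>2)"
      by (intro tendsto_mult tendsto_const sqlim_norm_sq[OF l2])
  qed (use P in blast)
  then show "measure lebesgue B * (LINT x|lebesgue_on B. (arsinh (w x / e))\<^sup>2) - (LINT x|lebesgue_on B. arsinh (w x / e))\<^sup>2
    \<le> d\<^sup>2 * 2 ^ CARD('n) * measure lebesgue B * (LINT x|lebesgue_on B. (norm (?G x))\<^sup>2)" by simp
qed

lemma bump_lower:
  assumes "0 < r" "x \<in> ball p r"
  shows "exp (- inverse (3 * r\<^sup>2)) \<le> bump p (2 * r) x"
proof -
  have "(x - p) \<bullet> (x - p) \<le> r\<^sup>2"
  proof -
    have "norm (x - p) \<le> r" using assms by (simp add: dist_norm norm_minus_commute)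
    then have "(norm (x - p))\<^sup>2 \<le> r\<^sup>2" by (rule power_mono) simp
    then show ?thesis by (simp only: power2_norm_eq_inner)
  qed
  then have t: "3 * r\<^sup>2 \<le> (2 * r)\<^sup>2 - (x - p) \<bullet> (x - p)" by (simp add: power_mult_distrib)
  have r: "0 < 3 * r\<^sup>2" using assms by simp
  have "inverse ((2 * r)\<^sup>2 - (x - p) \<bullet> (x - p)) \<le> inverse (3 * r\<^sup>2)" by (rule le_imp_inverse_le[OF t r])
  moreover have "0 < (2 * r)\<^sup>2 - (x - p) \<bullet> (x - p)" using t r by linarith
  ultimately show ?thesis by (simp only: bump_def flat_0 if_True exp_le_cancel_iff neg_le_iff_le)
qed

context elliptic
begin

text \<open>Test the equation with \<open>\<psi>\<^sup>2 (sqrt (w\<^sup>2 + e\<^sup>2) - w)\<close>; the right-hand side is nonnegative. The resulting bound does not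
  depend on \<open>e\<close>.\<close>

lemma log_caccioppoli:
  assumes a: "a \<in> coefs" and w: "eigenpair a w g" "AE x in M. 0 \<le> w x" and \<psi>: "\<psi> \<in> test_functions \<Omega>" and e: "0 < e"
  shows "sqint M (\<lambda>x. (\<psi> x / sqrt ((w x)\<^sup>2 + e\<^sup>2)) *\<^sub>R g x)"
    "(LINT x|M. (norm ((\<psi> x / sqrt ((w x)\<^sup>2 + e\<^sup>2)) *\<^sub>R g x))\<^sup>2) \<le> 8 * \<mu>1 / \<mu>0 * (LINT x|M. (norm (grad \<psi> x))\<^sup>2)"
proof -
  let ?R = "\<lambda>x. sqrt ((w x)\<^sup>2 + e\<^sup>2)" and ?k = "\<lambda>x. (\<psi> x / sqrt ((w x)\<^sup>2 + e\<^sup>2)) *\<^sub>R g x"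
  let ?z = "\<lambda>x. (\<psi> x)\<^sup>2 * (?R x - w x)"
  let ?h = "\<lambda>x. (\<psi> x)\<^sup>2 *\<^sub>R ((w x / ?R x - 1) *\<^sub>R g x) + (?R x - w x) *\<^sub>R ((2 * \<psi> x) *\<^sub>R grad \<psi> x)"
  note Hw = eigenpairD(1)[OF w(1)]
  note sw = H0_sqint[OF Hw]
  have Hz: "H0 ?z ?h" by (rule H0_log_test[OF Hw \<psi> e])
  obtain B where B: "\<And>x. \<bar>\<psi> x\<bar> \<le> B" using test_bounded[OF \<psi>] by metis
  note [measurable] = C1_measurable_M(1)[OF test_C1[OF \<psi>]] sw(1)[THEN sqint_measurable]
  show sk: "sqint M ?k"
  proof (rule sqint_bounded_mult[OF sw(2)])
    show "(\<lambda>x. \<psi> x / ?R x) \<in> borel_measurable M" by measurable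
    have "\<bar>\<psi> x / ?R x\<bar> \<le> B * (1 / e)" for x
      using mult_mono[OF B[of x] arsinh_scaled_derivative(3)[OF e, of "w x"]] B[of x] by (simp add: abs_mult)
    then show "AE x in M. \<bar>\<psi> x / ?R x\<bar> \<le> B * (1 / e)" by simp
  qed
  have "0 \<le> lam a * (LINT x|M. w x * ?z x)"
  proof (intro mult_nonneg_nonneg lam_nonneg a integral_nonneg_AE)
    show "AE x in M. 0 \<le> w x * ?z x"
      using w(2) by eventually_elim (use sqrt_regularisation(5)[OF e] in \<open>simp add: abs_le_D1\<close>)
  qed
  also have "\<dots> = E a g ?h" by (rule eigenpairD(2)[OF w(1) Hz, symmetric])
  also have "\<dots> \<le> (LINT x|M. 2 * e\<^sup>2 * \<mu>1 * (norm (grad \<psi> x))\<^sup>2 - \<mu>0 * e\<^sup>2 / 4 * (norm (?k x))\<^sup>2)"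
    unfolding E_def
  proof (rule integral_mono_AE[OF E_integrable[OF a sw(2) H0_sqint(2)[OF Hz]]])
    show "integrable M (\<lambda>x. 2 * e\<^sup>2 * \<mu>1 * (norm (grad \<psi> x))\<^sup>2 - \<mu>0 * e\<^sup>2 / 4 * (norm (?k x))\<^sup>2)"
      using sqint_integrable[OF sk] sqint_integrable[OF test_sqint(2)[OF \<psi>]] by (intro Bochner_Integration.integrable_diff integrable_mult_right)
    have "AE x in M. x \<in> \<Omega>" by (rule AE_I2) simp
    then show "AE x in M. (a x *v g x) \<bullet> ?h x \<le> 2 * e\<^sup>2 * \<mu>1 * (norm (grad \<psi> x))\<^sup>2 - \<mu>0 * e\<^sup>2 / 4 * (norm (?k x))\<^sup>2"
      using w(2) by eventually_elim (rule log_caccioppoli_pointwise[OF coefsD[OF a] \<mu>(1) _ e])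
  qed
  also have "\<dots> = 2 * e\<^sup>2 * \<mu>1 * (LINT x|M. (norm (grad \<psi> x))\<^sup>2) - \<mu>0 * e\<^sup>2 / 4 * (LINT x|M. (norm (?k x))\<^sup>2)"
    using sqint_integrable[OF sk] sqint_integrable[OF test_sqint(2)[OF \<psi>]]
    by (subst Bochner_Integration.integral_diff) (simp_all only: integrable_mult_right integral_mult_right_zero)
  finally have "e\<^sup>2 * (\<mu>0 / 4 * (LINT x|M. (norm (?k x))\<^sup>2)) \<le> e\<^sup>2 * (2 * \<mu>1 * (LINT x|M. (norm (grad \<psi> x))\<^sup>2))"
    by (simp only: mult_ac) (simp add: algebra_simps)
  then have "\<mu>0 / 4 * (LINT x|M. (norm (?k x))\<^sup>2) \<le> 2 * \<mu>1 * (LINT x|M. (norm (grad \<psi> x))\<^sup>2)"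
    by (rule mult_left_le_imp_le) (use e in simp)
  then show "(LINT x|M. (norm (?k x))\<^sup>2) \<le> 8 * \<mu>1 / \<mu>0 * (LINT x|M. (norm (grad \<psi> x))\<^sup>2)"
    using \<mu>(1) by (simp only: times_divide_eq_left pos_le_divide_eq) (simp add: algebra_simps)
qed

text \<open>On a ball a nonnegative eigenfunction \<open>w\<close> cannot vanish on a set \<open>Z\<close> of positive measure without
  vanishing altogether: \<open>v = arsinh (w / e)\<close> vanishes on \<open>Z\<close>, so the Poincare inequality bounds the square integral
  of \<open>v\<close> independently of \<open>e\<close>, while \<open>v\<close> tends to infinity with \<open>e \<rightarrow> 0\<close> wherever \<open>w > 0\<close>.\<close>

lemma local_dichotomy:
  assumes a: "a \<in> coefs" and w: "eigenpair a w g" "AE x in M. 0 \<le> w x"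
    and r: "0 < r" "cball p (2 * r) \<subseteq> \<Omega>"
  shows "(AE x in lebesgue_on (ball p r). w x = 0) \<or> (AE x in lebesgue_on (ball p r). 0 < w x)"
proof (rule disjCI)
  define B where "B = ball p r"
  let ?N = "lebesgue_on B"
  assume "\<not> (AE x in lebesgue_on (ball p r). 0 < w x)"
  then have npos: "\<not> (AE x in ?N. 0 < w x)" unfolding B_def .
  have B: "B \<subseteq> \<Omega>" "B \<in> sets borel" "convex B" "B \<in> sets lebesgue" using r by (auto simp: B_def dest!: subsetD)
  have BL: "B \<in> lmeasurable" unfolding B_def by simp
  interpret N: finite_measure ?N by (rule finite_measure_lebesgue_on[OF BL])
  have d: "norm (x - y) \<le> 2 * r" if "x \<in> B" "y \<in> B" for x y
    using that dist_triangle2[of x y p] unfolding dist_norm[symmetric] B_def by (simp add: dist_commute)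
  note sw = H0_sqint[OF eigenpairD(1)[OF w(1)]]
  have [measurable]: "w \<in> borel_measurable ?N" by (rule sqint_measurable[OF sqint_restrict[OF B(1,4) sw(1)]])
  have AEN: "AE x in ?N. P x" if "AE x in M. P x" for P
  proof -
    have "AE x in lebesgue. x \<in> \<Omega> \<longrightarrow> P x" using that by (simp add: AE_restrict_space_iff)
    then have "AE x in lebesgue. x \<in> B \<longrightarrow> P x" by eventually_elim (use B(1) in blast)
    then show ?thesis using B(4) by (simp add: AE_restrict_space_iff)
  qed
  have w0: "AE x in ?N. 0 \<le> w x" by (rule AEN[OF w(2)])
  define Z where "Z = {x \<in> B. w x = 0}"
  have Zm [measurable]: "Z \<in> sets ?N"
  proof -
    have "{x \<in> space ?N. w x = 0} \<in> sets ?N" by measurable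
    then show ?thesis by (simp add: Z_def)
  qed
  have Zpos: "0 < measure ?N Z"
  proof (rule ccontr)
    assume "\<not> 0 < measure ?N Z"
    then have "measure ?N Z = 0" by (simp add: zero_less_measure_iff)
    then have "Z \<in> null_sets ?N" using Zm by (simp add: null_sets_def N.emeasure_eq_measure)
    from AE_not_in[OF this] have "AE x in ?N. x \<notin> Z" .
    moreover have "AE x in ?N. x \<in> B" by (rule AE_I2) simp
    ultimately have "AE x in ?N. 0 < w x" using w0 by eventually_elim (auto simp: Z_def)
    with npos show False by simp
  qed
  define m where "m = measure lebesgue B"
  have mN: "measure ?N B = m" using BL by (simp add: m_def measure_restrict_space fmeasurableD)
  let ?\<psi> = "bump p (2 * r)"
  define c where "c = exp (- inverse (3 * r\<^sup>2))"
  have c: "0 < c" by (simp add: c_def)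
  have \<psi>: "?\<psi> \<in> test_functions \<Omega>"
    by (rule test_functionsI[OF smooth_bump compact_cball r(2)]) (rule bump_zero, use r in auto)
  define C2 where "C2 = (2 * r)\<^sup>2 * 2 ^ CARD('n) * m * (8 * \<mu>1 / \<mu>0 * (LINT x|M. (norm (grad ?\<psi> x))\<^sup>2) / c\<^sup>2)"
  have key: "measure ?N Z * (LINT x|?N. (norm (arsinh (w x / e)))\<^sup>2) \<le> C2"
    and sv: "sqint ?N (\<lambda>x. arsinh (w x / e))" if e: "0 < e" for e
  proof -
    let ?v = "\<lambda>x. arsinh (w x / e)" and ?G = "\<lambda>x. (1 / sqrt ((w x)\<^sup>2 + e\<^sup>2)) *\<^sub>R g x"
      and ?k = "\<lambda>x. (?\<psi> x / sqrt ((w x)\<^sup>2 + e\<^sup>2)) *\<^sub>R g x"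
    note P = log_poincare[OF eigenpairD(1)[OF w(1)] e B(1-3) d]
    show sv: "sqint ?N ?v" by (rule P(1))
    note cac = log_caccioppoli[OF a w \<psi> e]
    have sG: "sqint M ?G"
    proof (rule sqint_bounded_mult[OF sw(2)])
      note [measurable] = sw(1)[THEN sqint_measurable]
      show "(\<lambda>x. 1 / sqrt ((w x)\<^sup>2 + e\<^sup>2)) \<in> borel_measurable M" by measurable
      show "AE x in M. \<bar>1 / sqrt ((w x)\<^sup>2 + e\<^sup>2)\<bar> \<le> 1 / e" by (intro AE_I2 arsinh_scaled_derivative(3)[OF e])
    qed
    have "(LINT x|?N. (norm (?G x))\<^sup>2) \<le> (LINT x|?N. (norm (?k x))\<^sup>2 / c\<^sup>2)"
    proof (rule integral_mono)
      show "integrable ?N (\<lambda>x. (norm (?G x))\<^sup>2)" by (rule sqint_integrable[OF sqint_restrict[OF B(1,4) sG]])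
      show "integrable ?N (\<lambda>x. (norm (?k x))\<^sup>2 / c\<^sup>2)"
        by (intro integrable_divide sqint_integrable[OF sqint_restrict[OF B(1,4) cac(1)]])
      fix x assume "x \<in> space ?N"
      then have "c \<le> ?\<psi> x" unfolding c_def by (intro bump_lower r) (simp add: B_def)
      then have "c\<^sup>2 \<le> (?\<psi> x)\<^sup>2" using c by (intro power_mono) auto
      then have "c\<^sup>2 * (norm (?G x))\<^sup>2 \<le> (?\<psi> x)\<^sup>2 * (norm (?G x))\<^sup>2" by (rule mult_right_mono) simp
      also have "\<dots> = (norm (?k x))\<^sup>2" by (simp add: power_mult_distrib power_divide)
      finally show "(norm (?G x))\<^sup>2 \<le> (norm (?k x))\<^sup>2 / c\<^sup>2" using c by (simp only: pos_le_divide_eq zero_less_power mult.commute)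
    qed
    also have "\<dots> = (LINT x|?N. (norm (?k x))\<^sup>2) / c\<^sup>2" by simp
    also have "\<dots> \<le> (LINT x|M. (norm (?k x))\<^sup>2) / c\<^sup>2"
      by (intro divide_right_mono restrict_integral_le[OF B(1,4) sqint_integrable[OF cac(1)]]) auto
    also have "\<dots> \<le> 8 * \<mu>1 / \<mu>0 * (LINT x|M. (norm (grad ?\<psi> x))\<^sup>2) / c\<^sup>2"
      by (intro divide_right_mono cac(2)) simp
    finally have "(2 * r)\<^sup>2 * 2 ^ CARD('n) * m * (LINT x|?N. (norm (?G x))\<^sup>2) \<le> C2"
      unfolding C2_def by (rule mult_left_mono) (simp add: m_def)
    with P(2) have pv: "m * (LINT x|?N. (?v x)\<^sup>2) - (LINT x|?N. ?v x)\<^sup>2 \<le> C2" by (simp add: m_def)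
    \<comment> \<open>The mean of \<open>v\<close> only sees \<open>B - Z\<close>, so by Cauchy-Schwarz the variance of \<open>v\<close> is at least a multiple of its square norm.\<close>
    have "(LINT x|?N. ?v x) = (LINT x|?N. indicator (B - Z) x \<bullet> ?v x)"
      by (intro Bochner_Integration.integral_cong) (auto simp: Z_def indicator_def)
    moreover have si: "sqint ?N (\<lambda>x. indicator (B - Z) x :: real)"
    proof (rule N.sqint_bounded[of _ 1])
      have "B - Z \<in> sets ?N" by (rule sets.Diff[OF _ Zm]) (simp add: sets_restrict_space_iff B(4))
      then show "(\<lambda>x. indicator (B - Z) x :: real) \<in> borel_measurable ?N" by simp
    qed (auto simp: indicator_def)
    ultimately have "(LINT x|?N. ?v x)\<^sup>2 \<le> (LINT x|?N. (norm (indicator (B - Z) x :: real))\<^sup>2) * (LINT x|?N. (norm (?v x))\<^sup>2)"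
      using L2_Cauchy_Schwarz[OF si sv] by simp
    also have "(LINT x|?N. (norm (indicator (B - Z) x :: real))\<^sup>2) = m - measure ?N Z"
    proof -
      have "(norm (indicator (B - Z) x :: real))\<^sup>2 = indicator (B - Z) x" for x by (simp add: indicator_def)
      then have "(LINT x|?N. (norm (indicator (B - Z) x :: real))\<^sup>2) = measure ?N (B - Z)"
        by (simp add: Int_absorb2)
      also have "\<dots> = measure ?N B - measure ?N Z"
        by (rule N.finite_measure_Diff[OF _ Zm]) (auto simp: Z_def sets_restrict_space_iff B(4))
      finally show ?thesis by (simp add: mN)
    qed
    finally show "measure ?N Z * (LINT x|?N. (norm (?v x))\<^sup>2) \<le> C2" using pv by (simp add: algebra_simps)
  qed
  have small: "AE x in ?N. w x \<le> \<delta>" if \<delta>: "0 < \<delta>" for \<delta>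
  proof -
    define S where "S = {x \<in> B. \<delta> < w x}"
    have Sm [measurable]: "S \<in> sets ?N"
    proof -
      have "{x \<in> space ?N. \<delta> < w x} \<in> sets ?N" by measurable
      then show ?thesis by (simp add: S_def)
    qed
    have bnd: "K\<^sup>2 * (measure ?N Z * measure ?N S) \<le> C2" if K: "0 < K" for K :: real
    proof -
      \<comment> \<open>With this \<open>e\<close> the function \<open>arsinh (w / e)\<close> is at least \<open>K\<close> on \<open>S\<close>.\<close>
      define e where "e = \<delta> / sinh K"
      have e: "0 < e" using \<delta> K by (simp add: e_def)
      have eK: "arsinh (\<delta> / e) = K" using \<delta> K by (simp add: e_def arsinh_sinh_real)
      have "K\<^sup>2 * measure ?N S = (LINT x|?N. K\<^sup>2 * indicator S x)"
        using Sm sets.sets_into_space[OF Sm] by (simp add: Int_absorb2)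
      also have "\<dots> \<le> (LINT x|?N. (norm (arsinh (w x / e)))\<^sup>2)"
      proof (rule integral_mono)
        show "integrable ?N (\<lambda>x. K\<^sup>2 * indicator S x)"
          by (intro integrable_mult_right integrable_real_indicator Sm) (simp add: N.emeasure_finite less_top[symmetric])
        show "integrable ?N (\<lambda>x. (norm (arsinh (w x / e)))\<^sup>2)" by (rule sqint_integrable[OF sv[OF e]])
        fix x
        show "K\<^sup>2 * indicator S x \<le> (norm (arsinh (w x / e)))\<^sup>2"
        proof (cases "x \<in> S")
          case True
          then have "\<delta> / e \<le> w x / e" using e by (intro divide_right_mono) (auto simp: S_def)
          then have "K \<le> arsinh (w x / e)" unfolding eK[symmetric] by (metis arsinh_less_iff_real not_less)
          then show ?thesis using True K by (simp add: power_mono)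
        qed simp
      qed
      finally have "measure ?N Z * (K\<^sup>2 * measure ?N S) \<le> measure ?N Z * (LINT x|?N. (norm (arsinh (w x / e)))\<^sup>2)"
        by (rule mult_left_mono) simp
      also have "\<dots> \<le> C2" by (rule key[OF e])
      finally show ?thesis by (simp add: mult_ac)
    qed
    have "measure ?N S = 0"
    proof (rule ccontr)
      assume "measure ?N S \<noteq> 0"
      then have t: "0 < measure ?N Z * measure ?N S" using Zpos by (simp add: zero_less_measure_iff)
      define q where "q = measure ?N Z * measure ?N S"
      define K where "K = sqrt ((\<bar>C2\<bar> + 1) / q)"
      have q: "0 < q" using t by (simp add: q_def)
      then have K: "0 < K" "K\<^sup>2 * q = \<bar>C2\<bar> + 1" by (simp_all add: K_def add_nonneg_pos)
      from bnd[OF K(1)] K(2) show False unfolding q_def by linarith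
    qed
    then have "S \<in> null_sets ?N" using Sm by (simp add: null_sets_def N.emeasure_eq_measure)
    from AE_not_in[OF this] have "AE x in ?N. x \<notin> S" .
    moreover have "AE x in ?N. x \<in> B" by (rule AE_I2) simp
    ultimately show ?thesis by eventually_elim (auto simp: S_def)
  qed
  have "AE x in ?N. \<forall>k. w x \<le> 1 / real (Suc k)" unfolding AE_all_countable by (intro allI small) simp
  then have "AE x in ?N. w x = 0"
    using w0
  proof eventually_elim
    case (elim x)
    have "w x \<le> 0"
    proof (rule LIMSEQ_le_const)
      show "(\<lambda>k. 1 / real (Suc k)) \<longlonglongrightarrow> 0" by (rule LIMSEQ_Suc[OF lim_1_over_n])
    qed (use elim in blast)
    with elim show ?case by simp
  qed
  then show "AE x in lebesgue_on (ball p r). w x = 0" unfolding B_def .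
qed

end


section \<open>Positivity and simplicity\<close>


context bounded_domain
begin

lemma AE_local:
  assumes "\<And>p. p \<in> \<Omega> \<Longrightarrow> \<exists>r>0. AE x in lebesgue. x \<in> ball p r \<longrightarrow> P x"
  shows "AE x in M. P x"
proof -
  define F where "F = {ball p r | p r. (0::real) < r \<and> (AE x in lebesgue. x \<in> ball p r \<longrightarrow> P x)}"
  obtain F' where F': "F' \<subseteq> F" "countable F'" "\<Union>F' = \<Union>F"
    using Lindelof[of F] by (auto simp: F_def)
  have "AE x in lebesgue. \<forall>B\<in>F'. x \<in> B \<longrightarrow> P x"
    unfolding AE_ball_countable[OF F'(2)]
  proof
    fix B assume "B \<in> F'"
    then have "B \<in> F" using F'(1) by blast
    then show "AE x in lebesgue. x \<in> B \<longrightarrow> P x" by (auto simp: F_def)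
  qed
  then have "AE x in lebesgue. x \<in> \<Omega> \<longrightarrow> P x"
  proof eventually_elim
    case (elim x)
    show ?case
    proof
      assume "x \<in> \<Omega>"
      then obtain r where r: "0 < r" "AE z in lebesgue. z \<in> ball x r \<longrightarrow> P z" using assms by blast
      then have "ball x r \<in> F" by (auto simp: F_def)
      then have "x \<in> \<Union>F'" unfolding F'(3) using r(1) centre_in_ball by blast
      with elim show "P x" by blast
    qed
  qed
  then show ?thesis by (simp add: AE_restrict_space_iff)
qed

text \<open>Connectedness: the points near which \<open>P\<close> holds almost everywhere form an open set, and so do those for \<open>Q\<close>; the two sets
  cover \<open>\<Omega>\<close>, and they are disjoint because a nonempty open set is not a null set.\<close>

lemma AE_dichotomy:
  assumes "\<And>p. p \<in> \<Omega> \<Longrightarrow> \<exists>r>0. (AE x in lebesgue. x \<in> ball p r \<longrightarrow> P x) \<or> (AE x in lebesgue. x \<in> ball p r \<longrightarrow> Q x)"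
    and ex: "\<And>x. \<not> (P x \<and> Q x)"
  shows "(AE x in M. P x) \<or> (AE x in M. Q x)"
proof -
  define U where "U R = \<Union>{ball p r | p r. (0::real) < r \<and> (AE x in lebesgue. x \<in> ball p r \<longrightarrow> R x)}" for R :: "real^'n \<Rightarrow> bool"
  have op: "open (U R)" for R unfolding U_def by (intro open_Union) auto
  have inU: "p \<in> U R" if r: "0 < r" "AE x in lebesgue. x \<in> ball p r \<longrightarrow> R x" for p r R
  proof -
    have "p \<in> ball p r" using r(1) by simp
    then show ?thesis unfolding U_def using r by blast
  qed
  have cov: "\<Omega> \<subseteq> U P \<union> U Q"
  proof
    fix p assume "p \<in> \<Omega>"
    then obtain r where "0 < r" "(AE x in lebesgue. x \<in> ball p r \<longrightarrow> P x) \<or> (AE x in lebesgue. x \<in> ball p r \<longrightarrow> Q x)"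
      using assms(1) by blast
    then show "p \<in> U P \<union> U Q" using inU by blast
  qed
  have disj: "U P \<inter> U Q = {}"
  proof (rule ccontr)
    assume "U P \<inter> U Q \<noteq> {}"
    then obtain z where "z \<in> U P" "z \<in> U Q" by blast
    then obtain p r q s where b: "z \<in> ball p r" "AE x in lebesgue. x \<in> ball p r \<longrightarrow> P x"
        "z \<in> ball q s" "AE x in lebesgue. x \<in> ball q s \<longrightarrow> Q x" unfolding U_def by blast
    have "AE x in lebesgue. x \<notin> ball p r \<inter> ball q s"
      using b(2,4) by eventually_elim (use ex in blast)
    then have "negligible (ball p r \<inter> ball q s)" by (simp add: AE_iff_null_sets negligible_iff_null_sets)
    moreover have "open (ball p r \<inter> ball q s)" "ball p r \<inter> ball q s \<noteq> {}" using b by auto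
    ultimately show False using open_not_negligible by blast
  qed
  have loc: "AE x in M. R x" if sub: "\<Omega> \<subseteq> U R" for R
  proof (rule AE_local)
    fix p assume "p \<in> \<Omega>"
    then obtain q s where b: "p \<in> ball q s" "AE x in lebesgue. x \<in> ball q s \<longrightarrow> R x" using sub unfolding U_def by blast
    then obtain r where r: "0 < r" "ball p r \<subseteq> ball q s" using openE[OF open_ball b(1)] by metis
    have "AE x in lebesgue. x \<in> ball p r \<longrightarrow> R x" using b(2) by eventually_elim (use r(2) in blast)
    with r(1) show "\<exists>r>0. AE x in lebesgue. x \<in> ball p r \<longrightarrow> R x" by blast
  qed
  have "U P \<inter> \<Omega> = {} \<or> U Q \<inter> \<Omega> = {}"
    using connectedD[OF connected_dom op op, of P Q] cov disj by blast
  then have "\<Omega> \<subseteq> U Q \<or> \<Omega> \<subseteq> U P" using cov by blast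
  then show ?thesis using loc by blast
qed

end

context elliptic
begin

lemma eigenpair_zero_or_positive:
  assumes a: "a \<in> coefs" and w: "eigenpair a w g" "AE x in M. 0 \<le> w x"
  shows "(AE x in M. w x = 0) \<or> (AE x in M. 0 < w x)"
proof (rule AE_dichotomy)
  fix p assume "p \<in> \<Omega>"
  then obtain s where s: "0 < s" "cball p s \<subseteq> \<Omega>" using open_dom open_contains_cball by blast
  define r where "r = s / 2"
  have r: "0 < r" "cball p (2 * r) \<subseteq> \<Omega>" using s by (simp_all add: r_def)
  have i: "(AE x in lebesgue. x \<in> ball p r \<longrightarrow> R x) \<longleftrightarrow> (AE x in lebesgue_on (ball p r). R x)" for R
    by (simp add: AE_restrict_space_iff)
  show "\<exists>r>0. (AE x in lebesgue. x \<in> ball p r \<longrightarrow> w x = 0) \<or> (AE x in lebesgue. x \<in> ball p r \<longrightarrow> 0 < w x)"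
    using local_dichotomy[OF a w r] r(1) unfolding i[symmetric] by blast
qed simp

text \<open>Apply the dichotomy to the eigenfunctions \<open>\<bar>u\<bar>\<close> and \<open>\<bar>u\<bar> + u\<close>.\<close>

lemma eigenpair_sign:
  assumes a: "a \<in> coefs" and u: "eigenpair a u g"
  shows "(AE x in M. u x = 0) \<or> (AE x in M. 0 < u x) \<or> (AE x in M. u x < 0)"
proof -
  have abs: "eigenpair a (\<lambda>x. \<bar>u x\<bar>) (\<lambda>x. sgn (u x) *\<^sub>R g x)" by (rule eigenpair_abs[OF a u])
  have p: "(AE x in M. \<bar>u x\<bar> + 1 * u x = 0) \<or> (AE x in M. 0 < \<bar>u x\<bar> + 1 * u x)"
    by (rule eigenpair_zero_or_positive[OF a eigenpair_lincomb[OF a abs u]]) (intro AE_I2, simp)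
  have q: "(AE x in M. \<bar>u x\<bar> = 0) \<or> (AE x in M. 0 < \<bar>u x\<bar>)"
    by (rule eigenpair_zero_or_positive[OF a abs]) (intro AE_I2, simp)
  from q show ?thesis
  proof
    assume nz: "AE x in M. 0 < \<bar>u x\<bar>"
    from p show ?thesis
    proof
      assume "AE x in M. \<bar>u x\<bar> + 1 * u x = 0"
      with nz have "AE x in M. u x < 0" by eventually_elim linarith
      then show ?thesis by blast
    next
      assume "AE x in M. 0 < \<bar>u x\<bar> + 1 * u x"
      then have "AE x in M. 0 < u x" by eventually_elim linarith
      then show ?thesis by blast
    qed
  qed simp
qed

lemma M_not_null: "\<not> (AE x in M. False)"
proof
  assume "AE x in M. False"
  then have "AE x in lebesgue. x \<notin> \<Omega>" by (simp add: AE_restrict_space_iff)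
  then have "negligible \<Omega>" by (simp add: AE_iff_null_sets negligible_iff_null_sets)
  then show False using open_not_negligible open_dom nonempty_dom by blast
qed

lemma integral_pos_AE:
  assumes "sqint M (u :: real^'n \<Rightarrow> real)" "AE x in M. 0 < u x" shows "0 < (LINT x|M. u x)"
proof -
  have i: "integrable M u" by (rule sqint_integrable_M[OF assms(1)])
  have n: "AE x in M. 0 \<le> u x" using assms(2) by eventually_elim simp
  have "(LINT x|M. u x) \<noteq> 0"
  proof
    assume "(LINT x|M. u x) = 0"
    then have "AE x in M. u x = 0" using integral_nonneg_eq_0_iff_AE[OF i n] by simp
    then have "AE x in M. False" using assms(2) by eventually_elim simp
    with M_not_null show False by blast
  qed
  moreover have "0 \<le> (LINT x|M. u x)" by (rule integral_nonneg_AE[OF n])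
  ultimately show ?thesis by simp
qed

text \<open>Simplicity: a combination of two eigenfunctions with vanishing integral has no sign, hence is zero.\<close>

lemma eigenpair_simple:
  assumes a: "a \<in> coefs" and y: "eigenpair a y g" "AE x in M. 0 < y x" and z: "eigenpair a z h"
  shows "\<exists>c. (AE x in M. z x = c * y x) \<and> (AE x in M. h x = c *\<^sub>R g x)"
proof -
  note sy = H0_sqint(1)[OF eigenpairD(1)[OF y(1)]] and sz = H0_sqint(1)[OF eigenpairD(1)[OF z]]
  have py: "0 < (LINT x|M. y x)" by (rule integral_pos_AE[OF sy y(2)])
  define c where "c = (LINT x|M. z x) / (LINT x|M. y x)"
  define u where "u x = z x + (- c) * y x" for x
  have u: "eigenpair a u (\<lambda>x. h x + (- c) *\<^sub>R g x)" unfolding u_def[abs_def] by (rule eigenpair_lincomb[OF a z y(1)])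
  have su: "sqint M u" by (rule H0_sqint(1)[OF eigenpairD(1)[OF u]])
  have u0: "(LINT x|M. u x) = 0"
    unfolding u_def using sqint_integrable_M[OF sy] sqint_integrable_M[OF sz] py by (simp add: c_def)
  have uz: "AE x in M. u x = 0"
    using eigenpair_sign[OF a u]
  proof (elim disjE)
    assume "AE x in M. 0 < u x"
    from integral_pos_AE[OF su this] u0 show ?thesis by simp
  next
    assume "AE x in M. u x < 0"
    then have "AE x in M. 0 < (-1) *\<^sub>R u x" by eventually_elim simp
    from integral_pos_AE[OF sqint_scale[OF su] this] u0 show ?thesis by simp
  qed
  have "H0 (\<lambda>x. 0) (\<lambda>x. h x + (- c) *\<^sub>R g x)"
    by (rule H0_AE_cong[OF eigenpairD(1)[OF u] uz]) (simp, rule sqint_zero, rule H0_sqint(2)[OF eigenpairD(1)[OF u]])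
  moreover have "H0 (\<lambda>x. 0) (\<lambda>x. 0)" using H0_scale[OF eigenpairD(1)[OF u], of 0] by simp
  ultimately have "AE x in M. h x + (- c) *\<^sub>R g x = 0" by (rule H0_gradient_unique)
  then have "AE x in M. h x = c *\<^sub>R g x" by eventually_elim simp
  moreover have "AE x in M. z x = c * y x" using uz by eventually_elim (simp add: u_def)
  ultimately show ?thesis by blast
qed

lemma positive_minimizer_exists:
  assumes a: "a \<in> coefs"
  shows "\<exists>y g. eigenpair a y g \<and> (AE x in M. 0 < y x) \<and> (LINT x|M. (norm (y x))\<^sup>2) = 1"
proof -
  obtain y g where m: "H0 y g" "(LINT x|M. (norm (y x))\<^sup>2) = 1" "E a g g = lam a" using minimizer_exists[OF a] by blast
  have "eigenpair a y g" by (rule minimizer_eigenpair[OF a m(1)]) (use m in simp)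
  from eigenpair_abs[OF a this] have e: "eigenpair a (\<lambda>x. \<bar>y x\<bar>) (\<lambda>x. sgn (y x) *\<^sub>R g x)" .
  have n: "(LINT x|M. (norm \<bar>y x\<bar>)\<^sup>2) = 1" using m(2) by simp
  have "\<not> (AE x in M. \<bar>y x\<bar> = 0)"
    using sqint_zero_iff[OF H0_sqint(1)[OF eigenpairD(1)[OF e]]] n by simp
  then have "AE x in M. 0 < \<bar>y x\<bar>" using eigenpair_zero_or_positive[OF a e] by simp
  with e n show ?thesis by blast
qed

lemma principal_eigenfunction_iff:
  assumes a: "a \<in> coefs"
  shows "is_principal_eigenfunction \<Omega> a y \<longleftrightarrow>
    eigenpair a y (weak_grad \<Omega> y) \<and> (AE x in M. 0 < y x) \<and> (LINT x|M. (norm (y x))\<^sup>2) = 1"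
proof -
  have n: "L2_norm \<Omega> y = 1 \<longleftrightarrow> (LINT x|M. (norm (y x))\<^sup>2) = 1" by (simp add: L2_norm_def)
  have "y \<in> W12_0 \<Omega> \<and> (\<forall>z\<in>W12_0 \<Omega>. E a (weak_grad \<Omega> y) (weak_grad \<Omega> z) = lam a * (LINT x|M. y x * z x))
     \<longleftrightarrow> eigenpair a y (weak_grad \<Omega> y)"
  proof (intro iffI conjI ballI)
    assume L: "y \<in> W12_0 \<Omega> \<and> (\<forall>z\<in>W12_0 \<Omega>. E a (weak_grad \<Omega> y) (weak_grad \<Omega> z) = lam a * (LINT x|M. y x * z x))"
    then have Hy: "H0 y (weak_grad \<Omega> y)" by (intro W12_0_imp_H0) blast
    show "eigenpair a y (weak_grad \<Omega> y)"
      unfolding eigenpair_def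
    proof (intro conjI allI impI Hy)
      fix z h assume Z: "H0 z h"
      note W = H0_imp_W12_0[OF Z]
      have "E a (weak_grad \<Omega> y) h = E a (weak_grad \<Omega> y) (weak_grad \<Omega> z)"
        using W(2) H0_sqint(2)[OF Hy] H0_sqint(2)[OF Z] H0_sqint(2)[OF W12_0_imp_H0[OF W(1)]] by (intro E_cong_AE a) auto
      also have "\<dots> = lam a * (LINT x|M. y x * z x)" using L W(1) by blast
      finally show "E a (weak_grad \<Omega> y) h = lam a * (LINT x|M. y x * z x)" .
    qed
  next
    assume R: "eigenpair a y (weak_grad \<Omega> y)"
    show "y \<in> W12_0 \<Omega>" by (rule H0_imp_W12_0(1)[OF eigenpairD(1)[OF R]])
    show "E a (weak_grad \<Omega> y) (weak_grad \<Omega> z) = lam a * (LINT x|M. y x * z x)" if "z \<in> W12_0 \<Omega>" for z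
      by (rule eigenpairD(2)[OF R W12_0_imp_H0[OF that]])
  qed
  then show ?thesis unfolding is_principal_eigenfunction_def n E_def[symmetric] by blast
qed

lemma principal_eigenfunction:
  assumes a: "a \<in> coefs"
  defines "y \<equiv> principal_eigenfunction \<Omega> a"
  shows "eigenpair a y (weak_grad \<Omega> y)" "AE x in M. 0 < y x" "(LINT x|M. (norm (y x))\<^sup>2) = 1"
proof -
  obtain z g where z: "eigenpair a z g" "AE x in M. 0 < z x" "(LINT x|M. (norm (z x))\<^sup>2) = 1"
    using positive_minimizer_exists[OF a] by blast
  note W = H0_imp_W12_0[OF eigenpairD(1)[OF z(1)]]
  note H = W12_0_imp_H0[OF W(1)]
  have "E a (weak_grad \<Omega> z) (weak_grad \<Omega> z) = E a g g"
    using W(2) H0_sqint(2)[OF H] H0_sqint(2)[OF eigenpairD(1)[OF z(1)]] by (intro E_cong_AE a) auto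
  then have "eigenpair a z (weak_grad \<Omega> z)"
    using eigenpair_energy[OF z(1)] by (intro minimizer_eigenpair a H) simp
  with z have "is_principal_eigenfunction \<Omega> a z" by (simp add: principal_eigenfunction_iff[OF a])
  then have "is_principal_eigenfunction \<Omega> a y" unfolding y_def principal_eigenfunction_def
    by (rule someI[of "is_principal_eigenfunction \<Omega> a"])
  then show "eigenpair a y (weak_grad \<Omega> y)" "AE x in M. 0 < y x" "(LINT x|M. (norm (y x))\<^sup>2) = 1"
    by (simp_all add: principal_eigenfunction_iff[OF a])
qed

end


section \<open>Optimal coefficients\<close>


lemma matrix_interval_norm_bound:
  fixes A :: "real^'n^'n" and \<mu>0 \<mu>1 :: real
  assumes A: "A \<in> matrix_interval \<mu>0 \<mu>1" and \<mu>: "0 < \<mu>0" "\<mu>0 \<le> \<mu>1"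
  shows "norm A \<le> real CARD('n) * \<mu>1"
proof -
  have s: "transpose A = A" using A by (simp add: matrix_interval_def sym_matrices_def)
  have row: "norm (A $ i) \<le> \<mu>1" for i
  proof -
    have "A $ j $ i = A $ i $ j" for j using arg_cong[OF s, of "\<lambda>B. B $ i $ j"] by (simp add: transpose_def)
    then have "A *v axis i 1 = A $ i" by (simp add: vec_eq_iff matrix_vector_mult_basis column_def)
    then show ?thesis using matrix_interval_norm[OF A \<mu>, of "axis i 1"] by simp
  qed
  have "norm A \<le> (\<Sum>i\<in>UNIV. norm (A $ i))" unfolding norm_vec_def by (rule L2_set_le_sum) simp
  also have "\<dots> \<le> (\<Sum>i\<in>(UNIV :: 'n set). \<mu>1)" by (intro sum_mono row)
  finally show ?thesis by simp
qed

lemma continuous_transpose: "continuous_on UNIV (transpose :: real^'n^'n \<Rightarrow> real^'n^'n)"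
  unfolding transpose_def by (intro continuous_intros)

context elliptic
begin

lemma coefs_sqint:
  assumes a: "a \<in> coefs" shows "sqint M a" "(LINT x|M. (norm (a x))\<^sup>2) \<le> (real CARD('n) * \<mu>1)\<^sup>2 * measure M \<Omega>"
proof -
  have b: "norm (a x) \<le> real CARD('n) * \<mu>1" if "x \<in> \<Omega>" for x by (rule matrix_interval_norm_bound[OF coefsD[OF a that] \<mu>])
  show s: "sqint M a" by (rule M.sqint_bounded[OF coefs_measurable[OF a] AE_I2[OF b]]) simp
  have "(LINT x|M. (norm (a x))\<^sup>2) \<le> (LINT x|M. (real CARD('n) * \<mu>1)\<^sup>2)"
    by (rule integral_mono[OF sqint_integrable[OF s]]) (auto intro!: power_mono b)
  then show "(LINT x|M. (norm (a x))\<^sup>2) \<le> (real CARD('n) * \<mu>1)\<^sup>2 * measure M \<Omega>" by (simp add: mult.commute)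
qed

lemma E_convex_combination:
  assumes "a \<in> coefs" "b \<in> coefs" "c \<in> coefs" "AE x in M. c x = (1 - t) *\<^sub>R a x + t *\<^sub>R b x" "sqint M g"
  shows "E c g g = (1 - t) * E a g g + t * E b g g"
proof -
  have "E c g g = (LINT x|M. (1 - t) * ((a x *v g x) \<bullet> g x) + t * ((b x *v g x) \<bullet> g x))"
    unfolding E_def
  proof (rule integral_cong_AE)
    show "AE x in M. (c x *v g x) \<bullet> g x = (1 - t) * ((a x *v g x) \<bullet> g x) + t * ((b x *v g x) \<bullet> g x)"
      using assms(4) by eventually_elim
        (simp add: matrix_vector_mult_add_rdistrib scaleR_matrix_vector_assoc[symmetric] inner_add_left)
  qed (use E_integrable[OF assms(1,5,5)] E_integrable[OF assms(2,5,5)] E_integrable[OF assms(3,5,5)] in auto)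
  also have "\<dots> = (1 - t) * E a g g + t * E b g g"
    using E_integrable[OF assms(1,5,5)] E_integrable[OF assms(2,5,5)] by (simp add: E_def)
  finally show ?thesis .
qed

lemma E_difference:
  assumes "a \<in> coefs" "b \<in> coefs" "sqint M g"
  shows "(LINT x|M. ((a x - b x) *v g x) \<bullet> g x) = E a g g - E b g g"
  using E_integrable[OF assms(1,3,3)] E_integrable[OF assms(2,3,3)]
  by (simp add: E_def matrix_vector_mult_diff_rdistrib inner_diff_left)

text \<open>The energy is affine in the coefficient, and an infimum of affine functions is concave.\<close>

lemma lam_concave:
  assumes "a \<in> coefs" "b \<in> coefs" "c \<in> coefs" "AE x in M. c x = (1 - t) *\<^sub>R a x + t *\<^sub>R b x" "0 \<le> t" "t \<le> 1"
  shows "(1 - t) * lam a + t * lam b \<le> lam c"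
proof (rule lam_greatest[OF assms(3)])
  fix y g assume H: "H0 y g" and n: "(LINT x|M. (norm (y x))\<^sup>2) = 1"
  have "lam a \<le> E a g g" "lam b \<le> E b g g" using lam_le[OF assms(1) H] lam_le[OF assms(2) H] unfolding n by simp_all
  then have "(1 - t) * lam a + t * lam b \<le> (1 - t) * E a g g + t * E b g g"
    using assms(5,6) by (intro add_mono mult_left_mono) auto
  then show "(1 - t) * lam a + t * lam b \<le> E c g g"
    by (simp only: E_convex_combination[OF assms(1-4) H0_sqint(2)[OF H]])
qed

text \<open>For each fixed function the energy converges by dominated convergence, and an infimum of continuous functions is upper
  semicontinuous.\<close>

lemma lam_upper_semicontinuous:
  assumes a: "\<And>k. a k \<in> coefs" "c \<in> coefs" and lim: "AE x in M. (\<lambda>k. a k x) \<longlonglongrightarrow> c x"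
    and s: "\<And>k. s k \<le> lam (a k)" "s \<longlonglongrightarrow> l"
  shows "l \<le> lam c"
proof (rule lam_greatest[OF a(2)])
  fix y g assume H: "H0 y g" and n: "(LINT x|M. (norm (y x))\<^sup>2) = 1"
  note sg = H0_sqint(2)[OF H]
  have "(\<lambda>k. E (a k) g g) \<longlonglongrightarrow> E c g g"
    unfolding E_def
  proof (rule integral_dominated_convergence[where w = "\<lambda>x. \<mu>1 * (norm (g x))\<^sup>2"])
    show "AE x in M. (\<lambda>k. (a k x *v g x) \<bullet> g x) \<longlonglongrightarrow> (c x *v g x) \<bullet> g x"
      using lim
    proof eventually_elim
      case (elim x)
      have "isCont (\<lambda>p. fst p *v snd p) (c x, g x)"
        using continuous_matrix_vector_mult continuous_on_eq_continuous_at[OF open_UNIV] by blast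
      from isCont_tendsto_compose[OF this tendsto_Pair[OF elim tendsto_const]]
      show ?case by (intro tendsto_intros) simp
    qed
    show "AE x in M. norm ((a k x *v g x) \<bullet> g x) \<le> \<mu>1 * (norm (g x))\<^sup>2" for k
    proof (intro AE_I2)
      fix x assume "x \<in> space M"
      then have A: "a k x \<in> matrix_interval \<mu>0 \<mu>1" using coefsD[OF a(1)] by simp
      have "\<bar>(a k x *v g x) \<bullet> g x\<bar> \<le> norm (a k x *v g x) * norm (g x)" by (rule Cauchy_Schwarz_ineq2)
      also have "\<dots> \<le> \<mu>1 * norm (g x) * norm (g x)"
        by (intro mult_right_mono matrix_interval_norm[OF A \<mu>]) simp
      finally show "norm ((a k x *v g x) \<bullet> g x) \<le> \<mu>1 * (norm (g x))\<^sup>2" by (simp add: power2_eq_square mult.assoc)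
    qed
  qed (use E_integrable[OF a(1) sg sg] E_integrable[OF a(2) sg sg] sqint_integrable[OF sg] in auto)
  moreover have "s k \<le> E (a k) g g" for k
    using s(1)[of k] lam_le[OF a(1)[of k] H] unfolding n by simp
  ultimately show "l \<le> E c g g" using LIMSEQ_le[OF s(2)] by blast
qed

lemma lam_bounded_above: "\<exists>C. \<forall>a\<in>coefs. lam a \<le> C"
proof -
  obtain y g where H: "H0 y g" and "\<not> (AE x in M. y x = 0)" using H0_nontrivial by blast
  then have "(LINT x|M. (norm (y x))\<^sup>2) \<noteq> 0" using sqint_zero_iff[OF H0_sqint(1)[OF H]] by simp
  then have n: "0 < (LINT x|M. (norm (y x))\<^sup>2)" using integral_norm_sq_nonneg[of M y] by linarith
  have "lam a \<le> \<mu>1 * (LINT x|M. (norm (g x))\<^sup>2) / (LINT x|M. (norm (y x))\<^sup>2)" if "a \<in> coefs" for a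
    unfolding pos_le_divide_eq[OF n]
    using lam_le[OF that H] E_bounds(2)[OF that H0_sqint(2)[OF H]] by linarith
  then show ?thesis by blast
qed

text \<open>On a domain of finite measure, convergence in \<open>L\<^sup>2\<close> implies convergence in \<open>L\<^sup>1\<close>, so closedness applies to the limit.\<close>

lemma L1_closed_L2_limit:
  fixes a :: "nat \<Rightarrow> real^'n \<Rightarrow> real^'n^'n"
  assumes A: "\<A> \<subseteq> coefs" "L1_closed \<Omega> \<A>" and a: "\<And>k. a k \<in> \<A>"
    and C: "\<And>e. e > 0 \<Longrightarrow> \<exists>N. \<forall>i\<ge>N. \<forall>j\<ge>N. (LINT x|M. (norm (a i x - a j x))\<^sup>2) < e"
  shows "\<exists>c\<in>\<A>. \<exists>r. strict_mono r \<and> (AE x in M. (\<lambda>k. a (r k) x) \<longlonglongrightarrow> c x)"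
proof -
  have ac: "a k \<in> coefs" for k using A(1) a by blast
  obtain f where f: "sqlim M a f" by (rule sqint_complete[OF coefs_sqint(1)[OF ac] C])
  obtain r where r: "strict_mono r" "AE x in M. (\<lambda>k. a (r k) x) \<longlonglongrightarrow> f x"
    by (rule sqlim_AE_subseq[OF f])
  \<comment> \<open>The limit is symmetric almost everywhere only; taking the symmetric part makes it symmetric everywhere.\<close>
  define f' where "f' x = (1/2) *\<^sub>R (f x + transpose (f x))" for x
  have [measurable]: "f \<in> borel_measurable M" by (rule sqint_measurable[OF sqlimD(2)[OF f]])
  have [measurable]: "(transpose :: real^'n^'n \<Rightarrow> _) \<in> borel_measurable borel"
    by (rule borel_measurable_continuous_onI[OF continuous_transpose])
  have m: "f' \<in> borel_measurable M" unfolding f'_def[abs_def] by measurable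
  have "AE x in M. x \<in> \<Omega>" by (rule AE_I2) simp
  then have ff: "AE x in M. f x = f' x"
    using r(2)
  proof eventually_elim
    case (elim x)
    have "isCont transpose (f x)" using continuous_transpose continuous_on_eq_continuous_at[OF open_UNIV] by blast
    from isCont_tendsto_compose[OF this elim(2)] have "(\<lambda>k. transpose (a (r k) x)) \<longlonglongrightarrow> transpose (f x)" .
    moreover have "transpose (a k x) = a k x" for k
      using coefsD[OF ac elim(1)] by (simp add: matrix_interval_def sym_matrices_def)
    ultimately have "(\<lambda>k. a (r k) x) \<longlonglongrightarrow> transpose (f x)" by simp
    from LIMSEQ_unique[OF this elim(2)] have "transpose (f x) = f x" .
    then show ?case unfolding f'_def by (simp only: scaleR_half_double)
  qed
  have f': "sqlim M a f'" by (rule sqlim_AE_cong[OF f ff m])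
  have "f' \<in> L1_sym \<Omega>"
    using sqint_integrable_M[OF sqlimD(2)[OF f']]
    by (auto simp: L1_sym_def sym_matrices_def f'_def transpose_def vec_eq_iff)
  moreover have "(\<lambda>k. LINT x|M. norm (a k x - f' x)) \<longlonglongrightarrow> 0"
  proof (rule tendsto_zero_of_square)
    have one: "sqint M (\<lambda>x. 1::real)" by (rule M.sqint_bounded[of _ 1]) auto
    have "(LINT x|M. norm (a k x - f' x))\<^sup>2 \<le> (LINT x|M. (norm (1::real))\<^sup>2) * (LINT x|M. (norm (a k x - f' x))\<^sup>2)" for k
      using L2_Cauchy_Schwarz[OF one sqint_norm[OF sqint_diff[OF sqlimD(1,2)[OF f']]], of k] by simp
    then show "(\<lambda>k. (LINT x|M. norm (a k x - f' x))\<^sup>2) \<longlonglongrightarrow> 0"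
      by (intro tendsto_sandwich[OF _ _ tendsto_const tendsto_mult_right_zero[OF sqlimD(3)[OF f']]] always_eventually allI) auto
  qed
  ultimately obtain c where c: "c \<in> \<A>" "AE x in M. c x = f' x" using A(2) a unfolding L1_closed_def by blast
  have "AE x in M. (\<lambda>k. a (r k) x) \<longlonglongrightarrow> c x" using r(2) ff c(2) by eventually_elim simp
  with c(1) r(1) show ?thesis by blast
qed

text \<open>The sets \<open>S k\<close> of coefficients with eigenvalue at least \<open>L - 1 / (k + 1)\<close> are convex and decreasing. Choose elements whose \<open>L\<^sup>2\<close>
  norms are almost minimal in \<open>S k\<close>. The midpoint of two of them lies in the larger of the two sets, so the parallelogram law
  makes the sequence Cauchy.\<close>

lemma maximizer_exists:
  assumes A: "\<A> \<subseteq> coefs" "\<A> \<noteq> {}" "L1_convex \<Omega> \<A>" "L1_closed \<Omega> \<A>"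
  shows "\<exists>abar\<in>\<A>. \<forall>a\<in>\<A>. lam a \<le> lam abar"
proof -
  obtain C where C: "\<And>a. a \<in> coefs \<Longrightarrow> lam a \<le> C" using lam_bounded_above by blast
  have bdd: "bdd_above (lam ` \<A>)" by (rule bdd_aboveI2[where M = C]) (use A(1) C in blast)
  define L where "L = (SUP a\<in>\<A>. lam a)"
  define S where "S k = {a \<in> \<A>. L - 1 / real (Suc k) \<le> lam a}" for k :: nat
  define N where "N a = (LINT x|M. (norm (a x))\<^sup>2)" for a :: "real^'n \<Rightarrow> real^'n^'n"
  define D where "D = (real CARD('n) * \<mu>1)\<^sup>2 * measure M \<Omega>"
  define d where "d k = (INF a\<in>S k. N a)" for k
  have Sc: "a \<in> coefs" if "a \<in> S k" for a k using that A(1) by (auto simp: S_def)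
  have Sne: "S k \<noteq> {}" for k
  proof -
    have "L - 1 / real (Suc k) < L" by simp
    then obtain a where "a \<in> \<A>" "L - 1 / real (Suc k) < lam a" unfolding L_def using less_cSUP_iff[OF A(2) bdd] by blast
    then show ?thesis by (auto simp: S_def intro: less_imp_le)
  qed
  have N0: "0 \<le> N a" for a by (simp add: N_def)
  have ND: "N a \<le> D" if "a \<in> S k" for a k unfolding N_def D_def by (rule coefs_sqint(2)[OF Sc[OF that]])
  have bS: "bdd_below (N ` S k)" for k by (rule bdd_belowI2[where m = 0]) (rule N0)
  have Smono: "S j \<subseteq> S k" if "k \<le> j" for k j
  proof -
    have "1 / real (Suc j) \<le> 1 / real (Suc k)" using that by (intro divide_left_mono) auto
    then show ?thesis by (auto simp: S_def)
  qed
  have dmono: "d k \<le> d j" if "k \<le> j" for k j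
    unfolding d_def by (rule cINF_superset_mono[OF Sne bS Smono[OF that]]) simp
  have dD: "d k \<le> D" for k
  proof -
    obtain a where a: "a \<in> S k" using Sne by blast
    have "d k \<le> N a" unfolding d_def by (rule cINF_lower[OF bS a])
    then show ?thesis using ND[OF a] by simp
  qed
  have d0: "0 \<le> d k" for k unfolding d_def by (rule cINF_greatest[OF Sne]) (rule N0)
  have "\<exists>a\<in>S k. N a < d k + 1 / real (Suc k)" for k
    using cINF_less_iff[OF Sne bS, of k "d k + 1 / real (Suc k)"] by (simp add: d_def)
  then obtain a where a: "\<And>k. a k \<in> S k" "\<And>k. N (a k) < d k + 1 / real (Suc k)" by metis
  have ac: "a k \<in> coefs" for k by (rule Sc[OF a(1)])
  have sa: "sqint M (a k)" for k by (rule coefs_sqint(1)[OF ac])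
  have dist: "(LINT x|M. (norm (a j x - a k x))\<^sup>2) \<le> 2 * (d j - d k) + 4 / real (Suc k)" if kj: "k \<le> j" for k j
  proof -
    have jk: "a j \<in> S k" using a(1) Smono[OF kj] by blast
    have "a j \<in> \<A>" "a k \<in> \<A>" "(1/2 :: real) \<in> {0..1}" using a(1) by (auto simp: S_def)
    then obtain c where c: "c \<in> \<A>" "AE x in M. c x = (1 - 1/2) *\<^sub>R a j x + (1/2) *\<^sub>R a k x"
      using A(3) unfolding L1_convex_def by blast
    have cc: "c \<in> coefs" using c(1) A(1) by blast
    have "(1 - 1/2) * lam (a j) + (1/2) * lam (a k) \<le> lam c" by (rule lam_concave[OF ac ac cc c(2)]) auto
    moreover have "L - 1 / real (Suc k) \<le> lam (a j)" "L - 1 / real (Suc k) \<le> lam (a k)" using jk a(1)[of k] by (auto simp: S_def)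
    ultimately have "c \<in> S k" using c(1) by (simp add: S_def)
    then have "d k \<le> N c" unfolding d_def by (rule cINF_lower[OF bS])
    moreover have "4 * N c = (LINT x|M. (norm (a j x + 1 *\<^sub>R a k x))\<^sup>2)"
    proof -
      have "N c = (LINT x|M. (norm (a j x + 1 *\<^sub>R a k x))\<^sup>2 / 4)"
        unfolding N_def
      proof (rule integral_cong_AE)
        show "AE x in M. (norm (c x))\<^sup>2 = (norm (a j x + 1 *\<^sub>R a k x))\<^sup>2 / 4"
          using c(2)
        proof eventually_elim
          case (elim x)
          have "c x = (1/2) *\<^sub>R (a j x + 1 *\<^sub>R a k x)" unfolding elim by (simp add: scaleR_add_right)
          then show ?case by (simp only: norm_scaleR power_mult_distrib) (simp add: power2_eq_square)
        qed
        show "(\<lambda>x. (norm (c x))\<^sup>2) \<in> borel_measurable M" 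
          by (rule borel_measurable_integrable[OF sqint_integrable[OF coefs_sqint(1)[OF cc]]])
        have "sqint M (\<lambda>x. a j x + 1 *\<^sub>R a k x)" by (intro sqint_add sqint_scale sa)
        from borel_measurable_integrable[OF sqint_integrable[OF this]]
        show "(\<lambda>x. (norm (a j x + 1 *\<^sub>R a k x))\<^sup>2 / 4) \<in> borel_measurable M" by simp
      qed
      then show ?thesis by simp
    qed
    moreover have "(LINT x|M. (norm (a j x + (-1) *\<^sub>R a k x))\<^sup>2) + (LINT x|M. (norm (a j x + 1 *\<^sub>R a k x))\<^sup>2) = 2 * N (a j) + 2 * N (a k)"
      unfolding integral_norm_sq_add[OF sa sa] N_def by simp
    moreover have "(LINT x|M. (norm (a j x + (-1) *\<^sub>R a k x))\<^sup>2) = (LINT x|M. (norm (a j x - a k x))\<^sup>2)" by simp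
    moreover have "1 / real (Suc j) \<le> 1 / real (Suc k)" using kj by (intro divide_left_mono) auto
    ultimately show ?thesis using a(2)[of j] a(2)[of k] by simp
  qed
  have "convergent d"
    by (rule Bseq_mono_convergent[OF BseqI'[of d D]]) (use dD d0 dmono in auto)
  then obtain l where l: "d \<longlonglongrightarrow> l" by (auto simp: convergent_def)
  have dl: "d k \<le> l" for k by (rule incseq_le[OF _ l]) (use dmono in \<open>auto simp: incseq_def\<close>)
  define \<eta> where "\<eta> k = 2 * (l - d k) + 4 * (1 / real (Suc k))" for k
  have "\<eta> \<longlonglongrightarrow> 2 * (l - l) + 4 * 0" unfolding \<eta>_def[abs_def] by (intro tendsto_intros l LIMSEQ_Suc[OF lim_1_over_n])
  then have \<eta>: "\<eta> \<longlonglongrightarrow> 0" by simp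
  have d\<eta>: "(LINT x|M. (norm (a j x - a k x))\<^sup>2) \<le> \<eta> k" if "k \<le> j" for k j
    using dist[OF that] dl[of j] by (simp add: \<eta>_def)
  have "\<exists>c\<in>\<A>. \<exists>r. strict_mono r \<and> (AE x in M. (\<lambda>k. a (r k) x) \<longlonglongrightarrow> c x)"
  proof (rule L1_closed_L2_limit[OF A(1,4)])
    show "a k \<in> \<A>" for k using a(1) by (auto simp: S_def)
    fix e :: real assume e: "0 < e"
    have "eventually (\<lambda>k. \<eta> k < e) sequentially" by (rule order_tendstoD(2)[OF \<eta> e])
    then obtain n where n: "\<And>k. n \<le> k \<Longrightarrow> \<eta> k < e" by (auto simp: eventually_sequentially)
    have "(LINT x|M. (norm (a i x - a j x))\<^sup>2) < e" if "n \<le> i" "n \<le> j" for i j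
    proof (cases "j \<le> i")
      case True then show ?thesis using d\<eta>[OF True] n[OF that(2)] by linarith
    next
      case False
      then have "(LINT x|M. (norm (a j x - a i x))\<^sup>2) < e" using d\<eta>[of i j] n[OF that(1)] by linarith
      then show ?thesis by (simp add: norm_minus_commute)
    qed
    then show "\<exists>N. \<forall>i\<ge>N. \<forall>j\<ge>N. (LINT x|M. (norm (a i x - a j x))\<^sup>2) < e" by blast
  qed
  then obtain c r where c: "c \<in> \<A>" "strict_mono r" "AE x in M. (\<lambda>k. a (r k) x) \<longlonglongrightarrow> c x" by blast
  have cc: "c \<in> coefs" using c(1) A(1) by blast
  have "L \<le> lam c"
  proof (rule lam_upper_semicontinuous[OF ac cc c(3)])
    show "L - 1 / real (Suc (r k)) \<le> lam (a (r k))" for k using a(1)[of "r k"] by (simp add: S_def)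
    have "(\<lambda>k. L - 1 / real (Suc k)) \<longlonglongrightarrow> L - 0" by (intro tendsto_intros LIMSEQ_Suc[OF lim_1_over_n])
    from LIMSEQ_subseq_LIMSEQ[OF this c(2)] show "(\<lambda>k. L - 1 / real (Suc (r k))) \<longlonglongrightarrow> L" by (simp add: o_def)
  qed
  then have "lam b \<le> lam c" if "b \<in> \<A>" for b using cSUP_upper[OF that bdd] by (simp add: L_def)
  with c(1) show ?thesis by blast
qed

text \<open>As \<open>t \<rightarrow> 0\<close>, minimizers for \<open>(1 - t) b + t a\<close> form a minimizing sequence for \<open>b\<close>, because these coefficients have
  eigenvalue at most \<open>lam b\<close>. A subsequence converges, by simplicity to a multiple of \<open>y\<close>, and the multiple cancels.\<close>

lemma maximizer_variation:
  assumes b: "b \<in> coefs" and a: "a \<in> coefs" and y: "eigenpair b y g" "AE x in M. 0 < y x" "(LINT x|M. (norm (y x))\<^sup>2) = 1"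
    and c: "\<And>t. 0 < t \<Longrightarrow> t < 1 \<Longrightarrow> \<exists>c\<in>coefs. (AE x in M. c x = (1 - t) *\<^sub>R b x + t *\<^sub>R a x) \<and> lam c \<le> lam b"
  shows "E a g g \<le> E b g g"
proof -
  define t where "t k = 1 / real (Suc (Suc k))" for k
  have t: "0 < t k" "t k < 1" for k by (simp_all add: t_def)
  have t0: "t \<longlonglongrightarrow> 0" unfolding t_def[abs_def] by (rule LIMSEQ_Suc[OF LIMSEQ_Suc[OF lim_1_over_n]])
  define Q where "Q k c \<longleftrightarrow> c \<in> coefs \<and> (AE x in M. c x = (1 - t k) *\<^sub>R b x + t k *\<^sub>R a x) \<and> lam c \<le> lam b" for k c
  have "\<exists>c. Q k c" for k using c[OF t] unfolding Q_def by blast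
  then obtain c where c: "\<And>k. Q k (c k)" by metis
  have cc: "c k \<in> coefs" and cx: "AE x in M. c k x = (1 - t k) *\<^sub>R b x + t k *\<^sub>R a x"
    and cl: "lam (c k) \<le> lam b" for k using c[of k] unfolding Q_def by blast+
  define P where "P k z \<longleftrightarrow> H0 (fst z) (snd z) \<and> (LINT x|M. (norm (fst z x))\<^sup>2) = 1 \<and> E (c k) (snd z) (snd z) = lam (c k)" for k z
  have "\<exists>z. P k z" for k
  proof -
    obtain y g where "H0 y g" "(LINT x|M. (norm (y x))\<^sup>2) = 1" "E (c k) g g = lam (c k)"
      using minimizer_exists[OF cc] by blast
    then have "P k (y, g)" by (simp add: P_def)
    then show ?thesis by blast
  qed
  then obtain z where z: "\<And>k. P k (z k)" by metis
  define u where "u k = fst (z k)" for k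
  define h where "h k = snd (z k)" for k
  have H: "H0 (u k) (h k)" and n: "(LINT x|M. (norm (u k x))\<^sup>2) = 1" and En: "E (c k) (h k) (h k) = lam (c k)" for k
    using z[of k] unfolding P_def u_def h_def by auto
  note sh = H0_sqint(2)[OF H]
  have split: "(1 - t k) * E b (h k) (h k) + t k * E a (h k) (h k) \<le> lam b" for k
    using E_convex_combination[OF b a cc cx sh, of k k] En[of k] cl[of k] by simp
  have low: "lam b \<le> E b (h k) (h k)" for k using lam_le[OF b H[of k]] unfolding n by simp
  have cmp: "E a (h k) (h k) \<le> E b (h k) (h k)" for k
  proof -
    have "t k * E a (h k) (h k) \<le> t k * E b (h k) (h k)" using split[of k] low[of k] by (simp add: algebra_simps)
    then show ?thesis using t(1)[of k] by simp
  qed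
  have up: "E b (h k) (h k) \<le> lam b / (1 - t k)" for k
  proof -
    have "0 \<le> t k * E a (h k) (h k)" by (intro mult_nonneg_nonneg less_imp_le[OF t(1)] E_nonneg a sh)
    then have "(1 - t k) * E b (h k) (h k) \<le> lam b" using split[of k] by simp
    then show ?thesis using t(2)[of k] by (simp add: pos_le_divide_eq mult.commute)
  qed
  have "(\<lambda>k. lam b / (1 - t k)) \<longlonglongrightarrow> lam b / (1 - 0)" by (intro tendsto_intros t0) simp
  then have "(\<lambda>k. lam b / (1 - t k)) \<longlonglongrightarrow> lam b" by simp
  then have lim: "(\<lambda>k. E b (h k) (h k)) \<longlonglongrightarrow> lam b"
    by (rule tendsto_sandwich[OF always_eventually[OF allI[OF low]] always_eventually[OF allI[OF up]] tendsto_const])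
  obtain r u' h' where r: "strict_mono r" "sqlim M (\<lambda>k. u (r k)) u'" "sqlim M (\<lambda>k. h (r k)) h'" "H0 u' h'"
    "(LINT x|M. (norm (u' x))\<^sup>2) = 1" "E b h' h' = lam b"
    using minimizing_sequence_compact[of b u h, OF b H n lim] by blast
  have "E a h' h' \<le> E b h' h'"
    using LIMSEQ_le[OF E_tendsto[OF a r(3,3)] E_tendsto[OF b r(3,3)]] cmp by blast
  have "eigenpair b u' h'" by (rule minimizer_eigenpair[OF b r(4)]) (simp only: r(5,6) mult_1_right)
  then obtain s where s: "AE x in M. u' x = s * y x" "AE x in M. h' x = s *\<^sub>R g x"
    using eigenpair_simple[OF b y(1,2)] by blast
  note sg = H0_sqint[OF eigenpairD(1)[OF y(1)]]
  have Es: "E e h' h' = s\<^sup>2 * E e g g" if e: "e \<in> coefs" for e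
  proof -
    have "E e h' h' = E e (\<lambda>x. s *\<^sub>R g x) (\<lambda>x. s *\<^sub>R g x)"
      by (rule E_cong_AE[OF e e _ s(2) s(2)]) (auto intro: H0_sqint(2)[OF r(4)] sqint_scale[OF sg(2)])
    also have "\<dots> = s\<^sup>2 * E e g g" using E_quadratic[OF e sqint_zero sg(2), of s] by (simp add: E_def)
    finally show ?thesis .
  qed
  have "s \<noteq> 0"
  proof
    assume "s = 0"
    then have "AE x in M. u' x = 0" using s(1) by simp
    then show False using sqint_zero_iff[OF H0_sqint(1)[OF r(4)]] r(5) by simp
  qed
  then have "0 < s\<^sup>2" by simp
  with \<open>E a h' h' \<le> E b h' h'\<close> show ?thesis unfolding Es[OF a] Es[OF b] by simp
qed

end

theorem corollary2p6:
  fixes \<Omega> :: "(real^'n) set"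
    and \<mu>0 \<mu>1 :: real
    and \<A> :: "(real^'n \<Rightarrow> real^'n^'n) set"
  assumes "bounded_lipschitz_domain \<Omega>"
    and "0 < \<mu>0" and "\<mu>0 \<le> \<mu>1"
    and "\<A> \<subseteq> coefficients \<Omega> \<mu>0 \<mu>1"
    and "\<A> \<noteq> {}"
    and "L1_convex \<Omega> \<A>"
    and "L1_closed \<Omega> \<A>"
  shows "(\<exists>abar\<in>\<A>. principal_eigenvalue \<Omega> abar = (SUP a\<in>\<A>. principal_eigenvalue \<Omega> a)) \<and>
    (\<forall>abar\<in>\<A>.
       principal_eigenvalue \<Omega> abar = (SUP a\<in>\<A>. principal_eigenvalue \<Omega> a) \<longleftrightarrow>
       (\<forall>a\<in>\<A>.
          (LINT x|lebesgue_on \<Omega>.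
             ((a x - abar x) *v weak_grad \<Omega> (principal_eigenfunction \<Omega> abar) x)
               \<bullet> weak_grad \<Omega> (principal_eigenfunction \<Omega> abar) x) \<le> 0)) \<and>
    (\<forall>alow\<in>\<A>.
       principal_eigenvalue \<Omega> alow = (INF a\<in>\<A>. principal_eigenvalue \<Omega> a) \<longrightarrow>
       (\<forall>a\<in>\<A>.
          0 \<le> (LINT x|lebesgue_on \<Omega>.
             ((a x - alow x) *v weak_grad \<Omega> (principal_eigenfunction \<Omega> alow) x)
               \<bullet> weak_grad \<Omega> (principal_eigenfunction \<Omega> alow) x)))"
proof -
  interpret elliptic \<Omega> \<mu>0 \<mu>1
    using assms(1-3) by unfold_locales (auto simp: bounded_lipschitz_domain_def)
  note A = assms(4-7)
  have cf: "a \<in> coefs" if "a \<in> \<A>" for a using A(1) that by blast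
  obtain C where C: "\<And>a. a \<in> coefs \<Longrightarrow> lam a \<le> C" using lam_bounded_above by blast
  have above: "bdd_above (lam ` \<A>)" by (rule bdd_aboveI2[where M = C]) (rule C[OF cf])
  have below: "bdd_below (lam ` \<A>)" by (rule bdd_belowI2[where m = 0]) (rule lam_nonneg[OF cf])
  have sup: "lam b = (SUP a\<in>\<A>. lam a) \<longleftrightarrow> (\<forall>a\<in>\<A>. lam a \<le> lam b)" if b: "b \<in> \<A>" for b
  proof
    assume "lam b = (SUP a\<in>\<A>. lam a)"
    then show "\<forall>a\<in>\<A>. lam a \<le> lam b" using cSUP_upper[OF _ above] by simp
  next
    assume "\<forall>a\<in>\<A>. lam a \<le> lam b"
    then have "(SUP a\<in>\<A>. lam a) \<le> lam b" by (intro cSUP_least A(2)) blast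
    then show "lam b = (SUP a\<in>\<A>. lam a)" using cSUP_upper[OF b above] by simp
  qed
  define g where "g b = weak_grad \<Omega> (principal_eigenfunction \<Omega> b)" for b
  have eig: "eigenpair b (principal_eigenfunction \<Omega> b) (g b)" "AE x in M. 0 < principal_eigenfunction \<Omega> b x"
      "(LINT x|M. (norm (principal_eigenfunction \<Omega> b x))\<^sup>2) = 1" if "b \<in> \<A>" for b
    using principal_eigenfunction[OF cf[OF that]] by (simp_all add: g_def)
  have sg: "sqint M (g b)" if "b \<in> \<A>" for b by (rule H0_sqint(2)[OF eigenpairD(1)[OF eig(1)[OF that]]])
  have Eb: "E b (g b) (g b) = lam b" if "b \<in> \<A>" for b
    using eigenpair_energy[OF eig(1)[OF that]] unfolding eig(3)[OF that] by simp
  have Ea: "lam a \<le> E a (g b) (g b)" if "a \<in> \<A>" "b \<in> \<A>" for a b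
    using lam_le[OF cf[OF that(1)] eigenpairD(1)[OF eig(1)[OF that(2)]]] unfolding eig(3)[OF that(2)] by simp
  have diff: "(LINT x|M. ((a x - b x) *v weak_grad \<Omega> (principal_eigenfunction \<Omega> b) x)
      \<bullet> weak_grad \<Omega> (principal_eigenfunction \<Omega> b) x) = E a (g b) (g b) - E b (g b) (g b)"
    if "a \<in> \<A>" "b \<in> \<A>" for a b
    using E_difference[OF cf[OF that(1)] cf[OF that(2)] sg[OF that(2)]] by (simp add: g_def)
  show ?thesis
  proof (intro conjI ballI impI)
    show "\<exists>abar\<in>\<A>. lam abar = (SUP a\<in>\<A>. lam a)"
      using maximizer_exists[OF A] sup by blast
  next
    fix b assume b: "b \<in> \<A>"
    show "lam b = (SUP a\<in>\<A>. lam a) \<longleftrightarrow>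
       (\<forall>a\<in>\<A>. (LINT x|M. ((a x - b x) *v weak_grad \<Omega> (principal_eigenfunction \<Omega> b) x)
               \<bullet> weak_grad \<Omega> (principal_eigenfunction \<Omega> b) x) \<le> 0)"
      unfolding sup[OF b]
    proof (intro iffI ballI)
      fix a assume a: "a \<in> \<A>" and max: "\<forall>a\<in>\<A>. lam a \<le> lam b"
      have "E a (g b) (g b) \<le> E b (g b) (g b)"
      proof (rule maximizer_variation[OF cf[OF b] cf[OF a] eig[OF b]])
        fix t :: real assume "0 < t" "t < 1"
        then have "t \<in> {0..1}" by simp
        then obtain c where "c \<in> \<A>" "AE x in M. c x = (1 - t) *\<^sub>R b x + t *\<^sub>R a x"
          using A(3) a b unfolding L1_convex_def by blast
        then show "\<exists>c\<in>coefs. (AE x in M. c x = (1 - t) *\<^sub>R b x + t *\<^sub>R a x) \<and> lam c \<le> lam b"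
          using max cf by blast
      qed
      then show "(LINT x|M. ((a x - b x) *v weak_grad \<Omega> (principal_eigenfunction \<Omega> b) x)
               \<bullet> weak_grad \<Omega> (principal_eigenfunction \<Omega> b) x) \<le> 0" unfolding diff[OF a b] by simp
    next
      fix a assume a: "a \<in> \<A>" and neg: "\<forall>a\<in>\<A>. (LINT x|M. ((a x - b x) *v weak_grad \<Omega> (principal_eigenfunction \<Omega> b) x)
               \<bullet> weak_grad \<Omega> (principal_eigenfunction \<Omega> b) x) \<le> 0"
      have "E a (g b) (g b) - E b (g b) (g b) \<le> 0" unfolding diff[OF a b, symmetric] using neg a by (rule bspec)
      then show "lam a \<le> lam b" using Ea[OF a b] Eb[OF b] by simp
    qed
  next
    fix b a assume b: "b \<in> \<A>" and inf: "lam b = (INF a\<in>\<A>. lam a)" and a: "a \<in> \<A>"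
    have "lam b \<le> lam a" unfolding inf by (rule cINF_lower[OF below a])
    then show "0 \<le> (LINT x|M. ((a x - b x) *v weak_grad \<Omega> (principal_eigenfunction \<Omega> b) x)
               \<bullet> weak_grad \<Omega> (principal_eigenfunction \<Omega> b) x)"
      unfolding diff[OF a b] using Ea[OF a b] Eb[OF b] by simp
  qed
qed

end
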